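(* Let $n=4m+r$ with $m\geq 1$ and $r\in\{0,1,2,3\}$. Then $n-1\leq q_3(4m)\leq n$; $n-3\leq q_3(4m+1)\leq n-1$; $n-1\leq q_3(4m+2)\leq n+1$; and $n-3\leq q_3(4m+3)\leq n$.
   Context: There are $n$ balls with distinct identities, each colored with one of two colors; the coloring is unknown to a questioner. A color is the majority color if strictly more than half of the balls have it. The majority problem is: determine with certainty whether a majority color exists, and if it does, output a ball of the majority color. The questioner may adaptively ask triple queries in the Y/N model: choose a set of $3$ distinct balls and receive the answer YES if all three have the same color and NO otherwise (answers are consistent with the hidden coloring and may be adversarial). $q_3(n)$ denotes the minimum number of such queries that suffice in the worst case to solve the majority problem for $n$ balls. *)

theory Defs
  imports Main "HOL-Library.Extended_Nat"
begin

text \<open>The balls are \<open>0, \<dots>, n - 1\<close>; the two colors are the elements of \<^typ>\<open>bool\<close>.\<close>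

type_synonym coloring = "nat \<Rightarrow> bool"

definition majority_color :: "nat \<Rightarrow> coloring \<Rightarrow> bool \<Rightarrow> bool" where
  "majority_color n c col \<longleftrightarrow> 2 * card {i. i < n \<and> c i = col} > n"

text \<open>\<open>None\<close> claims that there is no majority color, \<open>Some b\<close> that ball \<open>b\<close> has the majority color.\<close>

fun correct_output :: "nat \<Rightarrow> coloring \<Rightarrow> nat option \<Rightarrow> bool" where
  "correct_output n c None \<longleftrightarrow> (\<nexists>col. majority_color n c col)"
| "correct_output n c (Some b) \<longleftrightarrow> b < n \<and> majority_color n c (c b)"

definition answer :: "coloring \<Rightarrow> nat set \<Rightarrow> bool" where
  "answer c Q \<longleftrightarrow> (\<forall>x\<in>Q. \<forall>y\<in>Q. c x = c y)"

text \<open>An adaptive strategy is a decision tree; \<open>Query Q y z\<close> asks \<open>Q\<close> and continues with \<open>y\<close> after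
  YES and with \<open>z\<close> after NO.\<close>

datatype strategy = Output "nat option" | Query "nat set" strategy strategy

fun triple_strategy :: "nat \<Rightarrow> strategy \<Rightarrow> bool" where
  "triple_strategy n (Output a) \<longleftrightarrow> True"
| "triple_strategy n (Query Q y z) \<longleftrightarrow>
     Q \<subseteq> {..<n} \<and> card Q = 3 \<and> triple_strategy n y \<and> triple_strategy n z"

fun run :: "coloring \<Rightarrow> strategy \<Rightarrow> nat option" where
  "run c (Output a) = a"
| "run c (Query Q y z) = (if answer c Q then run c y else run c z)"

fun queries :: "coloring \<Rightarrow> strategy \<Rightarrow> nat" where
  "queries c (Output a) = 0"
| "queries c (Query Q y z) = Suc (if answer c Q then queries c y else queries c z)"

definition solves_majority :: "nat \<Rightarrow> strategy \<Rightarrow> bool" where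
  "solves_majority n s \<longleftrightarrow> triple_strategy n s \<and> (\<forall>c. correct_output n c (run c s))"

definition worst_case_queries :: "strategy \<Rightarrow> enat" where
  "worst_case_queries s = (SUP c. enat (queries c s))"

text \<open>The value is \<open>\<infinity>\<close> if no strategy solves the problem, so a finite upper bound includes solvability.\<close>

definition q3 :: "nat \<Rightarrow> enat" where
  "q3 n = (INF s\<in>{s. solves_majority n s}. worst_case_queries s)"

end

theory Submission imports Complex_Main Defs begin

text \<open>Upper bounds: ask all four triples of disjoint groups of four balls. Four NO answers mean that the group splits
  evenly and can be discarded; the first YES gives two balls of equal color, against which every other ball costs one
  query.

  Lower bounds: the adversary answers NO and keeps the hypergraph of NO answers sparse, every set of \<open>k \<ge> 2\<close> nodes
  containing at most \<open>k - 2\<close> edges. As in Seymour's theorem on 3-chromatic hypergraphs, linear algebra shows that every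
  proper coloring can be turned into its complement by flipping the nodes one at a time while it stays proper. By
  an intermediate value argument, colorings of nearly balanced weight exist on every set of nodes. When a
  query would violate sparsity, the adversary contracts the overfull set along such a coloring into the class of ball
  \<open>0\<close>. The number of nodes minus the number of edges drops by at most one per query, and as long as it is large the
  majority is undetermined. For odd \<open>n\<close> the adversary must also keep the class of ball \<open>0\<close> from being always in the
  majority; it controls this until a cheap moment at which the class can be given weight \<open>0\<close> or \<open>-1\<close> for good, at the
  cost of one extra unit.\<close>

section \<open>Upper bounds\<close>

text \<open>The number \<open>k - 2\<close> comes from the averaging equations behind a flip order:
  they are invariant under translation, so one unknown can be fixed, and at most
  \<open>k - 2\<close> equations then face \<open>k - 1\<close> unknowns. Call a set with exactly
  \<open>k - 2\<close> edges tight. Absorbing it into the class of ball \<open>0\<close> changes the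
  potential \<open>psi\<close> by \<open>1 - 2\<close>, the price of one query. A tight set that
  misses ball \<open>0\<close> must not become a second class of nonzero weight. So all of it but
  one or two free balls is contracted to weight 0, which leaves enough potential to absorb the new
  node afterwards. For even \<open>n\<close> two nodes must remain at the end, so
  \<open>n - 2\<close> queries fail. For odd \<open>n\<close> three must remain, because every ball
  outside the root class has to be able to lie in the minority; one more unit pays for fixing the
  root along a set one edge short of tight, so \<open>n - 4\<close> queries fail. In the upper
  bounds, the 3 beyond \<open>4 * m\<close> is the price of comparing two balls by means of a
  remembered NO triple. For odd \<open>n\<close> one ball may stay undetermined, since in a tie of
  the others it has the majority color.\<close>

definition solvable :: "nat \<Rightarrow> nat \<Rightarrow> coloring set \<Rightarrow> bool" where
  "solvable n k C \<longleftrightarrow>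
    (\<exists>s. triple_strategy n s \<and> (\<forall>c\<in>C. correct_output n c (run c s) \<and> queries c s \<le> k))"

lemma solvable_output:
  assumes "\<And>c. c \<in> C \<Longrightarrow> correct_output n c a"
  shows "solvable n k C"
  unfolding solvable_def by (rule exI[of _ "Output a"]) (use assms in auto)

lemma solvable_mono:
  assumes "solvable n k C" "D \<subseteq> C" "k \<le> l"
  shows "solvable n l D"
  using assms unfolding solvable_def by (meson order_trans subsetD)

lemma solvable_query:
  assumes "Q \<subseteq> {..<n}" "card Q = 3"
    and "solvable n k {c \<in> C. answer c Q}" "solvable n k {c \<in> C. \<not> answer c Q}"
  shows "solvable n (Suc k) C"
proof -
  from assms(3,4) obtain y z where
    "triple_strategy n y" "\<forall>c\<in>{c \<in> C. answer c Q}. correct_output n c (run c y) \<and> queries c y \<le> k"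
    "triple_strategy n z" "\<forall>c\<in>{c \<in> C. \<not> answer c Q}. correct_output n c (run c z) \<and> queries c z \<le> k"
    unfolding solvable_def by blast
  with assms(1,2) show ?thesis
    unfolding solvable_def by (intro exI[of _ "Query Q y z"]) auto
qed

lemma q3_le:
  assumes "solvable n k UNIV"
  shows "q3 n \<le> enat k"
proof -
  from assms obtain s where s: "triple_strategy n s" "\<And>c. correct_output n c (run c s)" "\<And>c. queries c s \<le> k"
    unfolding solvable_def by blast
  then have "q3 n \<le> worst_case_queries s"
    unfolding q3_def solves_majority_def by (intro INF_lower) auto
  also have "\<dots> \<le> enat k"
    unfolding worst_case_queries_def using s(3) by (intro SUP_least) auto
  finally show ?thesis .
qed

lemma answer_triple: "answer c {p, q, t} \<longleftrightarrow> c p = c q \<and> c p = c t"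
  by (auto simp: answer_def)

lemma answer_insert_equal_pair:
  assumes "c a = c b"
  shows "answer c {a, b, x} \<longleftrightarrow> c x = c a"
  using assms by (auto simp: answer_def)

section \<open>Balanced sets and classification by a pair of equal color\<close>

definition balanced_on :: "nat set \<Rightarrow> coloring \<Rightarrow> bool" where
  "balanced_on Z c \<longleftrightarrow> card {i \<in> Z. c i} = card {i \<in> Z. \<not> c i}"

lemma card_color_class_Un:
  assumes "balanced_on Z c" "Z \<subseteq> {..<n}" "S \<subseteq> {..<n} - Z"
    and "\<And>x. x < n \<Longrightarrow> x \<notin> Z \<Longrightarrow> c x = col \<longleftrightarrow> x \<in> S"
  shows "2 * card {i. i < n \<and> c i = col} = card Z + 2 * card S"
    and "2 * card {i. i < n \<and> c i = (\<not> col)} = 2 * n - card Z - 2 * card S"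
proof -
  have fZ: "finite Z" using assms(2) finite_subset by blast
  have fS: "finite S" using assms(3) finite_subset by blast
  have "Z = {i \<in> Z. c i} \<union> {i \<in> Z. \<not> c i}" by blast
  then have "card Z = card {i \<in> Z. c i} + card {i \<in> Z. \<not> c i}"
    by (subst card_Un_disjoint[symmetric]) (use fZ in auto)
  then have h: "2 * card {i \<in> Z. c i = col} = card Z"
    using assms(1) by (cases col) (auto simp: balanced_on_def)
  have "{i. i < n \<and> c i = col} = {i \<in> Z. c i = col} \<union> S" using assms(2-4) by blast
  moreover have "card ({i \<in> Z. c i = col} \<union> S) = card {i \<in> Z. c i = col} + card S"
    by (rule card_Un_disjoint) (use fZ fS assms(3) in auto)
  ultimately show 1: "2 * card {i. i < n \<and> c i = col} = card Z + 2 * card S" using h by simp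
  have "{i. i < n \<and> c i = (\<not> col)} = {..<n} - {i. i < n \<and> c i = col}" by auto
  moreover have "card ({..<n} - {i. i < n \<and> c i = col}) = n - card {i. i < n \<and> c i = col}"
    by (subst card_Diff_subset) auto
  ultimately show "2 * card {i. i < n \<and> c i = (\<not> col)} = 2 * n - card Z - 2 * card S" using 1 by simp
qed

text \<open>A balanced part contributes equally to both colors, so the known split of the other
  balls relative to \<open>a\<close> decides everything. If the color opposite to \<open>a\<close>
  wins, some ball outside \<open>S\<close> and \<open>Z\<close> has it.\<close>

lemma solvable_known:
  assumes "a < n" "a \<notin> Z" "Z \<subseteq> {..<n}" "S \<subseteq> {..<n} - Z" "\<And>c. c \<in> C \<Longrightarrow> balanced_on Z c"
    and "\<And>c x. c \<in> C \<Longrightarrow> x \<in> {..<n} - Z \<Longrightarrow> c x = c a \<longleftrightarrow> x \<in> S"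
  shows "solvable n k C"
proof -
  have cc: "2 * card {i. i < n \<and> c i = c a} = card Z + 2 * card S"
    "2 * card {i. i < n \<and> c i = (\<not> c a)} = 2 * n - card Z - 2 * card S" if "c \<in> C" for c
    using card_color_class_Un[OF assms(5)[OF that] assms(3,4), of "c a"] assms(6)[OF that] by auto
  have "card (Z \<union> S) \<le> card {..<n}" using assms(3,4) by (intro card_mono) auto
  moreover have "card (Z \<union> S) = card Z + card S"
    by (rule card_Un_disjoint)
      (use assms(3,4) finite_subset[OF assms(3)] finite_subset[OF assms(4)] in auto)
  ultimately have le: "card Z + card S \<le> n" by simp
  consider "card Z + 2 * card S > n" | "card Z + 2 * card S < n" | "card Z + 2 * card S = n" by linarith
  then show ?thesis
  proof cases
    case 1
    show ?thesis
    proof (rule solvable_output[of _ _ "Some a"])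
      fix c assume "c \<in> C"
      from cc(1)[OF this] 1 assms(1) show "correct_output n c (Some a)" by (auto simp: majority_color_def)
    qed
  next
    case 2
    have "card ({..<n} - Z) = n - card Z" using assms(3) by (simp add: card_Diff_subset finite_subset)
    then have "S \<noteq> {..<n} - Z" using 2 by auto
    then obtain z where z: "z < n" "z \<notin> Z" "z \<notin> S" using assms(4) by blast
    show ?thesis
    proof (rule solvable_output[of _ _ "Some z"])
      fix c assume c: "c \<in> C"
      then have "c z = (\<not> c a)" using assms(6)[OF c, of z] z by auto
      then show "correct_output n c (Some z)" using cc(2)[OF c] 2 z le by (simp add: majority_color_def)
    qed
  next
    case 3
    show ?thesis
    proof (rule solvable_output[of _ _ None])
      fix c assume c: "c \<in> C"
      have "\<not> majority_color n c col" for col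
        using cc[OF c] 3 by (cases "col = c a") (auto simp: majority_color_def)
      then show "correct_output n c None" by simp
    qed
  qed
qed

text \<open>For odd \<open>n\<close> the ball \<open>z\<close> may stay undetermined: the other
  balls outside \<open>Z\<close> are even in number, so either one color leads among them by at
  least two and \<open>z\<close> cannot overturn this, or they tie and \<open>z\<close> itself has
  the majority color.\<close>

lemma solvable_known_but_one:
  assumes "odd n" "a < n" "z < n" "z \<noteq> a" "a \<notin> Z" "z \<notin> Z" "Z \<subseteq> {..<n}" "even (card Z)"
    and "S \<subseteq> {..<n} - Z - {z}" "\<And>c. c \<in> C \<Longrightarrow> balanced_on Z c"
    and "\<And>c x. c \<in> C \<Longrightarrow> x \<in> {..<n} - Z - {z} \<Longrightarrow> c x = c a \<longleftrightarrow> x \<in> S"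
  shows "solvable n k C"
proof -
  have fS: "finite S" using assms(9) finite_subset by blast
  have nz: "z \<notin> S" using assms(9) by blast
  have cc: "2 * card {i. i < n \<and> c i = c a} = card Z + 2 * (if c z = c a then Suc (card S) else card S)"
    "2 * card {i. i < n \<and> c i = (\<not> c a)} = 2 * n - card Z - 2 * (if c z = c a then Suc (card S) else card S)"
    if "c \<in> C" for c
  proof -
    let ?T = "if c z = c a then insert z S else S"
    have "?T \<subseteq> {..<n} - Z" using assms(3,6,9) by auto
    moreover have "\<And>x. x < n \<Longrightarrow> x \<notin> Z \<Longrightarrow> c x = c a \<longleftrightarrow> x \<in> ?T"
      using assms(11)[OF that] nz by (metis DiffI insert_iff lessThan_iff singletonD)
    moreover have "card ?T = (if c z = c a then Suc (card S) else card S)" using fS nz by simp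
    ultimately show
      "2 * card {i. i < n \<and> c i = c a} = card Z + 2 * (if c z = c a then Suc (card S) else card S)"
      "2 * card {i. i < n \<and> c i = (\<not> c a)} = 2 * n - card Z - 2 * (if c z = c a then Suc (card S) else card S)"
      using card_color_class_Un[OF assms(10)[OF that] assms(7), of ?T "c a"] by auto
  qed
  have "card (insert z (Z \<union> S)) \<le> card {..<n}" using assms(3,7,9) by (intro card_mono) auto
  moreover have "card (Z \<union> S) = card Z + card S"
    by (rule card_Un_disjoint) (use assms(7,9) fS finite_subset[OF assms(7)] in auto)
  moreover have "finite (Z \<union> S)" using fS assms(7) finite_subset by blast
  ultimately have le: "Suc (card Z + card S) \<le> n" using nz assms(6) by simp
  obtain j l where jl: "n = 2 * j + 1" "card Z = 2 * l" using assms(1,8) by (metis evenE oddE)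
  consider "card Z + 2 * card S > n" | "card Z + 2 * Suc (card S) < n" | "card Z + 2 * card S = n - 1"
    using jl by (cases "l + card S" j rule: linorder_cases) auto
  then show ?thesis
  proof cases
    case 1
    show ?thesis
    proof (rule solvable_output[of _ _ "Some a"])
      fix c assume "c \<in> C"
      from cc(1)[OF this] 1 assms(2) show "correct_output n c (Some a)"
        by (auto simp: majority_color_def split: if_splits)
    qed
  next
    case 2
    have "card ({..<n} - Z - {z}) = n - card Z - 1"
      using assms(3,6,7) by (simp add: card_Diff_subset finite_subset)
    then have "S \<noteq> {..<n} - Z - {z}" using 2 by auto
    then obtain w where w: "w < n" "w \<noteq> z" "w \<notin> Z" "w \<notin> S" using assms(9) by blast
    show ?thesis
    proof (rule solvable_output[of _ _ "Some w"])
      fix c assume c: "c \<in> C"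
      then have "c w = (\<not> c a)" using assms(11)[OF c, of w] w by auto
      then show "correct_output n c (Some w)" using cc(2)[OF c] 2 w
        by (auto simp: majority_color_def split: if_splits)
    qed
  next
    case 3
    show ?thesis
    proof (rule solvable_output[of _ _ "Some z"])
      fix c assume c: "c \<in> C"
      show "correct_output n c (Some z)"
      proof (cases "c z = c a")
        case True
        then show ?thesis using cc(1)[OF c] 3 assms(3) jl by (auto simp: majority_color_def)
      next
        case False
        then have "c z = (\<not> c a)" by blast
        then show ?thesis using cc(2)[OF c] False 3 assms(3) le jl by (auto simp: majority_color_def)
      qed
    qed
  qed
qed

text \<open>Once \<open>a\<close> and \<open>b\<close> are known to agree, the query
  \<open>{a, b, x}\<close> reads off the color of \<open>x\<close> relative to \<open>a\<close>, so
  each ball costs one query. \<open>R\<close> is the set to be classified and \<open>K\<close> the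
  part already classified; the last hypothesis finishes when all of \<open>R\<close> is
  known.\<close>

lemma solvable_equal_pair:
  assumes "a < n" "b < n" "a \<noteq> b" "K \<subseteq> R" "R \<subseteq> {..<n}" "S \<subseteq> K" "a \<in> S" "b \<in> S" "C \<subseteq> C0"
    and "\<And>c x. c \<in> C \<Longrightarrow> x \<in> K \<Longrightarrow> c x = c a \<longleftrightarrow> x \<in> S"
    and "\<And>D S. D \<subseteq> C0 \<Longrightarrow> S \<subseteq> R \<Longrightarrow> (\<And>c x. c \<in> D \<Longrightarrow> x \<in> R \<Longrightarrow> c x = c a \<longleftrightarrow> x \<in> S) \<Longrightarrow> solvable n 0 D"
  shows "solvable n (card (R - K)) C"
  using assms(4,6-10)
proof (induction "card (R - K)" arbitrary: K S C)
  case 0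
  have "finite (R - K)" using assms(5) finite_subset by blast
  then have "K = R" using 0 by auto
  then show ?case using assms(11)[of C S] 0 by auto
next
  case (Suc m)
  then obtain x where x: "x \<in> R" "x \<notin> K" by (metis DiffE card.empty all_not_in_conv nat.simps(3))
  have fin: "finite (R - K)" using assms(5) finite_subset by blast
  have m: "m = card (R - insert x K)"
    using Suc(2) fin x by (metis DiffI Diff_insert card_Diff_singleton diff_Suc_1)
  have ab: "a \<in> K" "b \<in> K" "x \<noteq> a" "x \<noteq> b" using Suc.prems x by auto
  have Q: "{a, b, x} \<subseteq> {..<n}" "card {a, b, x} = 3" using assms(1-3,5) x ab by auto
  have eq: "answer c {a, b, x} \<longleftrightarrow> c x = c a" if "c \<in> C" for c
    using Suc.prems(6)[OF that ab(2)] Suc.prems(4) by (intro answer_insert_equal_pair) auto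
  have "solvable n m {c \<in> C. answer c {a, b, x}}"
    unfolding m by (rule Suc.hyps(1)[OF m, of "insert x S"]) (use Suc.prems(1-5) x eq Suc.prems(6) in blast)+
  moreover have "solvable n m {c \<in> C. \<not> answer c {a, b, x}}"
    unfolding m by (rule Suc.hyps(1)[OF m, of S]) (use Suc.prems(1-5) x eq Suc.prems(6) in blast)+
  ultimately have "solvable n (Suc m) C" by (rule solvable_query[OF Q])
  then show ?case using Suc(2) by simp
qed

text \<open>Either everything outside \<open>Z\<close> is classified, or for odd \<open>n\<close>
  everything but one ball \<open>z\<close>, which saves a query.\<close>

lemma solvable_after_yes:
  assumes "a < n" "b < n" "a \<noteq> b" "Z \<subseteq> {..<n}" "K \<subseteq> {..<n} - Z" "S \<subseteq> K" "a \<in> S" "b \<in> S"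
    and "\<And>c. c \<in> C \<Longrightarrow> balanced_on Z c"
    and "\<And>c x. c \<in> C \<Longrightarrow> x \<in> K \<Longrightarrow> c x = c a \<longleftrightarrow> x \<in> S"
  shows "solvable n (n - card Z - card K) C"
    and "odd n \<Longrightarrow> even (card Z) \<Longrightarrow> z < n \<Longrightarrow> z \<notin> Z \<Longrightarrow> z \<notin> K \<Longrightarrow>
      solvable n (n - card Z - card K - 1) C"
proof -
  have fZ: "finite Z" and fK: "finite K" using assms(4,5) finite_subset by blast+
  have aZ: "a \<notin> Z" using assms(5-7) by blast
  have "card ({..<n} - Z - K) = n - card Z - card K"
    using assms(4,5) fZ fK by (simp add: card_Diff_subset)
  moreover have base: "solvable n 0 D"
    if "D \<subseteq> {c. balanced_on Z c}" "T \<subseteq> {..<n} - Z"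
      "\<And>c x. c \<in> D \<Longrightarrow> x \<in> {..<n} - Z \<Longrightarrow> c x = c a \<longleftrightarrow> x \<in> T" for D T
    by (rule solvable_known[OF assms(1) aZ assms(4) that(2) _ that(3)]) (use that(1) in auto)
  have "solvable n (card ({..<n} - Z - K)) C"
    by (rule solvable_equal_pair[OF assms(1-3,5) _ assms(6-8) _ assms(10) base]) (use assms(9) in auto)
  ultimately show "solvable n (n - card Z - card K) C" by simp
  assume z: "odd n" "even (card Z)" "z < n" "z \<notin> Z" "z \<notin> K"
  have za: "z \<noteq> a" using z assms(6,7) by blast
  have "card ({..<n} - Z - {z} - K) = n - card Z - card K - 1"
  proof -
    have "{..<n} - Z - {z} - K = ({..<n} - Z - K) - {z}" by blast
    then show ?thesis using z assms(4,5) fZ fK by (simp add: card_Diff_subset)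
  qed
  moreover have base: "solvable n 0 D"
    if "D \<subseteq> {c. balanced_on Z c}" "T \<subseteq> {..<n} - Z - {z}"
      "\<And>c x. c \<in> D \<Longrightarrow> x \<in> {..<n} - Z - {z} \<Longrightarrow> c x = c a \<longleftrightarrow> x \<in> T" for D T
    by (rule solvable_known_but_one[OF z(1) assms(1) z(3) za aZ z(4) assms(4) z(2) that(2) _ that(3)])
      (use that(1) in auto)
  have "solvable n (card ({..<n} - Z - {z} - K)) C"
    by (rule solvable_equal_pair[OF assms(1-3) _ _ assms(6-8) _ assms(10) base]) (use assms(5,9) z(5) in auto)
  ultimately show "solvable n (n - card Z - card K - 1) C" by simp
qed

text \<open>Four NO answers exclude the splits 4-0 and 3-1 of the group and leave only 2-2.\<close>

lemma balanced_on_insert4: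
  assumes "finite Z" "a \<notin> Z" "b \<notin> Z" "x \<notin> Z" "y \<notin> Z" "distinct [a, b, x, y]" "balanced_on Z c"
    and "\<not> answer c {a, b, x}" "\<not> answer c {a, b, y}" "\<not> answer c {a, x, y}" "\<not> answer c {b, x, y}"
  shows "balanced_on (Z \<union> {a, b, x, y}) c"
proof -
  have eq: "{i \<in> Z \<union> {a, b, x, y}. P i} = {i \<in> Z. P i} \<union> {i \<in> {a, b, x, y}. P i}" for P by blast
  have card: "card {i \<in> Z \<union> {a, b, x, y}. P i} = card {i \<in> Z. P i} + card {i \<in> {a, b, x, y}. P i}" for P
    unfolding eq by (rule card_Un_disjoint) (use assms in auto)
  have split: "{i \<in> insert u A. P i} = (if P u then insert u {i \<in> A. P i} else {i \<in> A. P i})" for u A and P :: "nat \<Rightarrow> bool"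
    by auto
  have "card {i \<in> {a, b, x, y}. c i} = card {i \<in> {a, b, x, y}. \<not> c i}"
    unfolding split using assms(6,8-11)
    by (cases "c a"; cases "c b"; cases "c x"; cases "c y") (simp_all add: answer_triple)
  then show ?thesis using assms(7) unfolding balanced_on_def card by simp
qed

text \<open>A YES at the \<open>j\<close>-th query leaves \<open>k + 4 - j\<close> queries, with
  three balls of the group classified for \<open>j = 1\<close> and all four afterwards. The fourth
  query is the tight case and dictates the condition on \<open>n\<close>, with one ball of slack for
  odd \<open>n\<close>. The NO to \<open>{a, b, x}\<close> is handed on for a later comparison of
  two balls.\<close>

lemma solvable_group:
  assumes Z: "Z \<subseteq> {..<n}" "even (card Z)" and C: "\<And>c. c \<in> C \<Longrightarrow> balanced_on Z c"
    and G: "{a, b, x, y} \<subseteq> {..<n} - Z" "distinct [a, b, x, y]"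
    and rest: "solvable n k {c \<in> C. balanced_on (Z \<union> {a, b, x, y}) c \<and> \<not> answer c {a, b, x}}"
    and k: "n \<le> card Z + k + 4 \<or> odd n \<and> n = Suc (card Z + k + 4)"
  shows "solvable n (k + 4) C"
proof -
  have fZ: "finite Z" using Z finite_subset by blast
  have yes: "solvable n l D"
    if D: "D \<subseteq> C" and K: "K \<subseteq> {a, b, x, y}" "S \<subseteq> K" "u \<in> S" "v \<in> S" "u \<noteq> v"
      and kn: "\<And>c w. c \<in> D \<Longrightarrow> w \<in> K \<Longrightarrow> c w = c u \<longleftrightarrow> w \<in> S" and l: "k + 4 \<le> l + card K" for l D K S u v
  proof -
    have sub: "u < n" "v < n" "K \<subseteq> {..<n} - Z" using K G by auto
    have bal: "\<And>c. c \<in> D \<Longrightarrow> balanced_on Z c" using C D by blast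
    from k show ?thesis
    proof
      assume "n \<le> card Z + k + 4"
      moreover have "solvable n (n - card Z - card K) D"
        by (rule solvable_after_yes(1)[OF sub(1,2) K(5) Z(1) sub(3) K(2-4)]) (fact bal kn)+
      ultimately show ?thesis using l by (elim solvable_mono) auto
    next
      assume n: "odd n \<and> n = Suc (card Z + k + 4)"
      have "card (Z \<union> K) = card Z + card K"
        by (rule card_Un_disjoint) (use fZ sub(3) K(1) finite_subset[OF K(1)] in auto)
      moreover have "card K \<le> card {a, b, x, y}" using K(1) by (intro card_mono) auto
      moreover have "card {a, b, x, y} = 4" using G(2) by simp
      ultimately have "card (Z \<union> K) < n" using n by simp
      moreover have "Z \<union> K \<subseteq> {..<n}" using Z sub by blast
      ultimately obtain z where z: "z < n" "z \<notin> Z" "z \<notin> K"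
        by (metis UnI1 UnI2 card_lessThan lessThan_iff less_irrefl subsetI subset_antisym)
      have "solvable n (n - card Z - card K - 1) D"
        by (rule solvable_after_yes(2)[OF sub(1,2) K(5) Z(1) sub(3) K(2-4) _ _ _ Z(2) z]) (use bal kn n in auto)
      then show ?thesis by (rule solvable_mono) (use n l in auto)
    qed
  qed
  let ?A = "{a, b, x}" and ?B = "{a, b, y}" and ?E = "{a, x, y}" and ?F = "{b, x, y}"
  have Q: "?A \<subseteq> {..<n}" "card ?A = 3" "?B \<subseteq> {..<n}" "card ?B = 3" "?E \<subseteq> {..<n}" "card ?E = 3"
    "?F \<subseteq> {..<n}" "card ?F = 3" using G by auto
  \<comment> \<open>The tree is built from the last query to the first. After a YES at a later
    query, the NO answers before it show that the fourth ball of the group has the other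
    color.\<close>
  have 4: "solvable n (Suc k) {c \<in> {c \<in> {c \<in> C. \<not> answer c ?A}. \<not> answer c ?B}. \<not> answer c ?E}"
  proof (rule solvable_query[OF Q(7,8)])
    show "solvable n k {c \<in> {c \<in> {c \<in> {c \<in> C. \<not> answer c ?A}. \<not> answer c ?B}. \<not> answer c ?E}. answer c ?F}"
      by (rule yes[of _ "{a, b, x, y}" ?F b x]) (use G in \<open>auto simp: answer_triple\<close>)
    show "solvable n k {c \<in> {c \<in> {c \<in> {c \<in> C. \<not> answer c ?A}. \<not> answer c ?B}. \<not> answer c ?E}. \<not> answer c ?F}"
      by (rule solvable_mono[OF rest]) (use balanced_on_insert4[OF fZ] G C in auto)
  qed
  have 3: "solvable n (Suc (Suc k)) {c \<in> {c \<in> C. \<not> answer c ?A}. \<not> answer c ?B}"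
    by (rule solvable_query[OF Q(5,6) _ 4], rule yes[of _ "{a, b, x, y}" ?E a x])
      (use G in \<open>auto simp: answer_triple\<close>)
  have 2: "solvable n (Suc (Suc (Suc k))) {c \<in> C. \<not> answer c ?A}"
    by (rule solvable_query[OF Q(3,4) _ 3], rule yes[of _ "{a, b, x, y}" ?B a b])
      (use G in \<open>auto simp: answer_triple\<close>)
  have "solvable n (Suc (Suc (Suc (Suc k)))) C"
    by (rule solvable_query[OF Q(1,2) _ 2], rule yes[of _ ?A ?A a b])
      (use G in \<open>auto simp: answer_triple\<close>)
  then show ?thesis by (simp add: numeral_eq_Suc)
qed

text \<open>The induction runs from the last group back to the first. \<open>B\<close> is the budget
  for the leftover balls; the NO to \<open>{0, 1, 2}\<close> is kept for comparing two of
  them.\<close>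

lemma solvable_groups:
  assumes "4 * m \<le> n" "n \<le> 4 * m + B \<or> odd n \<and> n = Suc (4 * m + B)" "i \<le> m"
    and base: "solvable n B {c. balanced_on {..<4 * m} c \<and> (m > 0 \<longrightarrow> \<not> answer c {0, 1, 2})}"
  shows "solvable n (B + 4 * (m - i)) {c. balanced_on {..<4 * i} c \<and> (i > 0 \<longrightarrow> \<not> answer c {0, 1, 2})}"
  using assms(3)
proof (induction i rule: inc_induct)
  case base
  then show ?case using assms(4) by simp
next
  case (step i)
  let ?C = "{c. balanced_on {..<4 * i} c \<and> (i > 0 \<longrightarrow> \<not> answer c {0, 1, 2})}"
  let ?G = "{4 * i, 4 * i + 1, 4 * i + 2, 4 * i + 3}"
  have Un: "{..<4 * i} \<union> ?G = {..<4 * Suc i}" by auto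
  have "solvable n (B + 4 * (m - Suc i) + 4) ?C"
  proof (rule solvable_group)
    show "solvable n (B + 4 * (m - Suc i))
      {c \<in> ?C. balanced_on ({..<4 * i} \<union> ?G) c \<and> \<not> answer c {4 * i, 4 * i + 1, 4 * i + 2}}"
      unfolding Un by (rule solvable_mono[OF step.IH]) (auto simp: numeral_2_eq_2)
    show "n \<le> card {..<4 * i} + (B + 4 * (m - Suc i)) + 4 \<or>
      odd n \<and> n = Suc (card {..<4 * i} + (B + 4 * (m - Suc i)) + 4)"
      using assms(2) step.hyps by auto
  qed (use assms(1) step.hyps in auto)
  moreover have "B + 4 * (m - Suc i) + 4 = B + 4 * (m - i)" using step.hyps by simp
  ultimately show ?case by simp
qed

lemma q3_le_groups:
  assumes "4 * m \<le> n" "n \<le> 4 * m + B \<or> odd n \<and> n = Suc (4 * m + B)"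
    and "solvable n B {c. balanced_on {..<4 * m} c \<and> (m > 0 \<longrightarrow> \<not> answer c {0, 1, 2})}"
  shows "q3 n \<le> enat (4 * m + B)"
proof -
  have "solvable n (B + 4 * m) UNIV"
    using solvable_groups[OF assms(1,2) _ assms(3), of 0] by (simp add: balanced_on_def)
  then show ?thesis using q3_le by (metis add.commute)
qed

text \<open>A triple answered NO contains both colors, so two balls of equal color form a YES triple
  with one of its members. Three queries thus compare \<open>x\<close> with
  \<open>y\<close>.\<close>

lemma answer_pair_iff:
  assumes "\<not> answer c {u, v, w}"
  shows "c x = c y \<longleftrightarrow> answer c {x, y, u} \<or> answer c {x, y, v} \<or> answer c {x, y, w}"
  using assms by (auto simp: answer_def)

lemma solvable_pair:
  assumes "x < n" "y < n" "x \<noteq> y" "{u, v, w} \<subseteq> {..<n} - {x, y}"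
    and "\<And>c. c \<in> C \<Longrightarrow> \<not> answer c {u, v, w}"
    and "solvable n 0 {c \<in> C. c x = c y}" "solvable n 0 {c \<in> C. c x \<noteq> c y}"
  shows "solvable n 3 C"
proof -
  have Q: "{x, y, t} \<subseteq> {..<n}" "card {x, y, t} = 3" if "t \<in> {u, v, w}" for t
  proof -
    have "t \<in> {..<n} - {x, y}" using that assms(4) by blast
    then show "{x, y, t} \<subseteq> {..<n}" "card {x, y, t} = 3" using assms(1-3) by simp_all
  qed
  have *: "solvable n k {c \<in> D. answer c {x, y, t}}" if "D \<subseteq> C" for D k t
    by (rule solvable_mono[OF assms(6)]) (use that in \<open>auto simp: answer_def\<close>)
  have "solvable n (Suc (Suc (Suc 0))) C"
  proof (rule solvable_query[OF Q[of u]]; (rule *)?)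
    show "solvable n (Suc (Suc 0)) {c \<in> C. \<not> answer c {x, y, u}}"
    proof (rule solvable_query[OF Q[of v]]; (rule *)?)
      show "solvable n (Suc 0) {c \<in> {c \<in> C. \<not> answer c {x, y, u}}. \<not> answer c {x, y, v}}"
      proof (rule solvable_query[OF Q[of w]]; (rule *)?)
        show "solvable n 0 {c \<in> {c \<in> {c \<in> C. \<not> answer c {x, y, u}}. \<not> answer c {x, y, v}}. \<not> answer c {x, y, w}}"
          by (rule solvable_mono[OF assms(7)]) (use answer_pair_iff[OF assms(5)] in auto)
      qed auto
    qed auto
  qed auto
  then show ?thesis by (simp add: numeral_eq_Suc)
qed

lemma solvable_balanced_rest:
  assumes "4 * m \<le> n" "\<And>c. c \<in> C \<Longrightarrow> balanced_on {..<4 * m} c" "S \<subseteq> {4 * m..<n}" "2 * card S > n - 4 * m" "s \<in> S"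
    and "\<And>c x. c \<in> C \<Longrightarrow> x \<in> S \<Longrightarrow> c x = c s"
  shows "solvable n k C"
proof (rule solvable_output[of _ _ "Some s"])
  fix c assume c: "c \<in> C"
  let ?T = "{i \<in> {4 * m..<n}. c i = c s}"
  have "2 * card {i. i < n \<and> c i = c s} = card {..<4 * m} + 2 * card ?T"
    by (rule card_color_class_Un(1)[OF assms(2)[OF c]]) (use assms(1) in auto)
  moreover have "card S \<le> card ?T" using assms(3,6) c by (intro card_mono) auto
  ultimately show "correct_output n c (Some s)"
    using assms(1,3-5) by (auto simp: majority_color_def)
qed

text \<open>For \<open>4 * m\<close> no ball is left over. For \<open>4 * m + 1\<close> the one
  leftover ball has the majority color, and the odd case of the group bound applies. Otherwise two
  leftover balls are compared with three queries; for \<open>4 * m + 3\<close> unequal ones cancel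
  and the third decides.\<close>

lemma q3_upper_bounds:
  assumes "m \<ge> 1"
  shows "q3 (4 * m) \<le> enat (4 * m)" "q3 (4 * m + 1) \<le> enat (4 * m)"
    "q3 (4 * m + 2) \<le> enat (4 * m + 3)" "q3 (4 * m + 3) \<le> enat (4 * m + 3)"
proof -
  let ?C = "{c. balanced_on {..<4 * m} c \<and> (m > 0 \<longrightarrow> \<not> answer c {0, 1, 2})}"
  have none: "correct_output n c None"
    if "balanced_on {..<4 * m} c" "n = 4 * m \<or> n = 4 * m + 2 \<and> c (4 * m) \<noteq> c (4 * m + 1)" for n c
  proof -
    have "\<not> majority_color n c col" for col
    proof -
      have "2 * card {i. i < n \<and> c i = col} = card {..<4 * m} + 2 * card {i \<in> {4 * m..<n}. c i = col}"
        by (rule card_color_class_Un(1)[OF that(1)]) (use that(2) in auto)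
      moreover have "2 * card {i \<in> {4 * m..<n}. c i = col} = n - 4 * m"
      proof (cases "n = 4 * m")
        case False
        then have n: "n = 4 * m + 2" "c (4 * m) \<noteq> c (4 * m + 1)" using that(2) by auto
        then have "{i \<in> {4 * m..<n}. c i = col} = {if c (4 * m) = col then 4 * m else 4 * m + 1}"
          by (auto simp: less_Suc_eq)
        then show ?thesis using n by simp
      qed simp
      ultimately show ?thesis using that(2) by (auto simp: majority_color_def)
    qed
    then show ?thesis by simp
  qed
  show "q3 (4 * m) \<le> enat (4 * m)"
    using q3_le_groups[of m "4 * m" 0] solvable_output[of ?C _ None] none by auto
  have "solvable (4 * m + 1) 0 ?C"
    by (rule solvable_balanced_rest[of m _ _ "{4 * m}" "4 * m"]) auto
  then show "q3 (4 * m + 1) \<le> enat (4 * m)"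
    using q3_le_groups[of m "4 * m + 1" 0] by auto
  have "solvable (4 * m + 2) 3 ?C"
  proof (rule solvable_pair[of "4 * m" _ "4 * m + 1" 0 1 2])
    show "solvable (4 * m + 2) 0 {c \<in> ?C. c (4 * m) = c (4 * m + 1)}"
      by (rule solvable_balanced_rest[of m _ _ "{4 * m, 4 * m + 1}" "4 * m"]) auto
    show "solvable (4 * m + 2) 0 {c \<in> ?C. c (4 * m) \<noteq> c (4 * m + 1)}"
      by (rule solvable_output[of _ _ None]) (use none in auto)
  qed (use assms in auto)
  then show "q3 (4 * m + 2) \<le> enat (4 * m + 3)"
    using q3_le_groups[of m "4 * m + 2" 3] by auto
  have "solvable (4 * m + 3) 3 ?C"
  proof (rule solvable_pair[of "4 * m" _ "4 * m + 1" 0 1 2])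
    show "solvable (4 * m + 3) 0 {c \<in> ?C. c (4 * m) = c (4 * m + 1)}"
      by (rule solvable_balanced_rest[of m _ _ "{4 * m, 4 * m + 1}" "4 * m"]) auto
    show "solvable (4 * m + 3) 0 {c \<in> ?C. c (4 * m) \<noteq> c (4 * m + 1)}"
    proof (rule solvable_output[of _ _ "Some (4 * m + 2)"])
      fix c assume c: "c \<in> {c \<in> ?C. c (4 * m) \<noteq> c (4 * m + 1)}"
      let ?col = "c (4 * m + 2)"
      have "2 * card {i. i < 4 * m + 3 \<and> c i = ?col}
          = card {..<4 * m} + 2 * card {i \<in> {4 * m..<4 * m + 3}. c i = ?col}"
        by (rule card_color_class_Un(1)) (use c in auto)
      moreover have "{i \<in> {4 * m..<4 * m + 3}. c i = ?col}
          = {4 * m + 2, if c (4 * m) = ?col then 4 * m else 4 * m + 1}"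
        using c by (auto simp: less_Suc_eq numeral_3_eq_3)
      ultimately show "correct_output (4 * m + 3) c (Some (4 * m + 2))"
        by (simp add: majority_color_def)
    qed
  qed (use assms in auto)
  then show "q3 (4 * m + 3) \<le> enat (4 * m + 3)"
    using q3_le_groups[of m "4 * m + 3" 3] by auto
qed

section \<open>Orders in which nodes can be flipped\<close>

text \<open>Gaussian elimination: a pivot \<open>p\<close> of equation \<open>i\<close> is removed
  from the other equations, and a solution of the smaller system is extended by the value that
  equation \<open>i\<close> forces on \<open>p\<close>.\<close>

lemma homogeneous_system_nontrivial:
  fixes A :: "'i \<Rightarrow> 'u \<Rightarrow> real"
  assumes "finite I" "finite U" "card I < card U"
  shows "\<exists>x. (\<exists>u\<in>U. x u \<noteq> 0) \<and> (\<forall>i\<in>I. (\<Sum>u\<in>U. A i u * x u) = 0)"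
  using assms
proof (induction I arbitrary: U A rule: finite_induct)
  case empty
  then obtain u where "u \<in> U" by fastforce
  then show ?case by (intro exI[of _ "\<lambda>_. 1"]) auto
next
  case (insert i I)
  show ?case
  proof (cases "\<forall>u\<in>U. A i u = 0")
    case True
    from insert.IH[of U A] insert.prems insert.hyps obtain x where
      "\<exists>u\<in>U. x u \<noteq> 0" "\<forall>j\<in>I. (\<Sum>u\<in>U. A j u * x u) = 0" by auto
    then show ?thesis using True by (intro exI[of _ x]) auto
  next
    case False
    then obtain p where p: "p \<in> U" "A i p \<noteq> 0" by blast
    let ?U = "U - {p}"
    let ?B = "\<lambda>j u. A j u - A j p * A i u / A i p"
    have "finite ?U" "card I < card ?U" using insert.prems insert.hyps p by auto
    from insert.IH[OF this, of ?B] obtain x where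
      x: "\<exists>u\<in>?U. x u \<noteq> 0" "\<forall>j\<in>I. (\<Sum>u\<in>?U. ?B j u * x u) = 0" by blast
    define s where "s = (\<Sum>u\<in>?U. A i u * x u)"
    define y where "y = x(p := - s / A i p)"
    have sum: "(\<Sum>u\<in>U. A j u * y u) = A j p * (- s / A i p) + (\<Sum>u\<in>?U. A j u * x u)" for j
    proof -
      have "(\<Sum>u\<in>U. A j u * y u) = A j p * y p + (\<Sum>u\<in>?U. A j u * y u)"
        using p insert.prems by (intro sum.remove) auto
      also have "(\<Sum>u\<in>?U. A j u * y u) = (\<Sum>u\<in>?U. A j u * x u)"
        by (intro sum.cong) (auto simp: y_def)
      finally show ?thesis by (simp add: y_def)
    qed
    have "(\<Sum>u\<in>U. A j u * y u) = 0" if "j \<in> insert i I" for j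
    proof (cases "j = i")
      case True
      then show ?thesis using sum[of i] p by (simp add: s_def)
    next
      case False
      have "(\<Sum>u\<in>?U. ?B j u * x u) = (\<Sum>u\<in>?U. A j u * x u - A j p / A i p * (A i u * x u))"
        by (intro sum.cong) (auto simp: algebra_simps)
      also have "\<dots> = (\<Sum>u\<in>?U. A j u * x u) - A j p / A i p * s"
        unfolding sum_subtractf s_def sum_distrib_left ..
      finally show ?thesis using sum[of j] x(2) that False by simp
    qed
    moreover have "\<exists>u\<in>U. y u \<noteq> 0" using x(1) by (auto simp: y_def)
    ultimately show ?thesis by blast
  qed
qed

lemma small_perturbation:
  fixes a b :: "'s \<Rightarrow> real"
  assumes "finite S" "\<And>s. s \<in> S \<Longrightarrow> 0 < a s"
  shows "\<exists>\<epsilon>>0. \<forall>s\<in>S. \<epsilon> * b s < a s"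
  using assms
proof (induction S rule: finite_induct)
  case empty
  show ?case by (intro exI[of _ 1]) auto
next
  case (insert t S)
  then obtain \<epsilon> where \<epsilon>: "\<epsilon> > 0" "\<forall>s\<in>S. \<epsilon> * b s < a s" by auto
  define \<delta> where "\<delta> = min \<epsilon> (a t / (\<bar>b t\<bar> + 1))"
  have at: "a t > 0" using insert by auto
  then have \<delta>: "0 < \<delta>" "\<delta> \<le> \<epsilon>" "\<delta> \<le> a t / (\<bar>b t\<bar> + 1)" using \<epsilon> by (auto simp: \<delta>_def)
  have "\<delta> * b s < a s" if "s \<in> S" for s
  proof (cases "b s \<ge> 0")
    case True
    then have "\<delta> * b s \<le> \<epsilon> * b s" using \<delta> by (intro mult_right_mono) auto
    then show ?thesis using \<epsilon> that by fastforce
  next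
    case False
    then have "\<delta> * b s < 0" using \<delta> by (simp add: mult_pos_neg)
    then show ?thesis using insert.prems that by fastforce
  qed
  moreover have "\<delta> * b t < a t"
  proof -
    have "\<delta> * b t < \<delta> * (\<bar>b t\<bar> + 1)" using \<delta> by (intro mult_strict_left_mono) auto
    also have "\<dots> \<le> a t" using \<delta>(3) by (simp add: pos_le_divide_eq)
    finally show ?thesis .
  qed
  ultimately show ?case using \<delta> by auto
qed

text \<open>Solving \<open>r l = (r b + r d) / 2\<close> for all triples gives a nonconstant \<open>r\<close>, since there are at least two
  more points than equations. A triple then is either strictly ordered as wanted or lies in one level set of
  \<open>r\<close>, and the level sets are refined recursively.\<close>

lemma between_order:
  fixes U :: "'u set"
  assumes "finite U" "finite F" "\<And>l b d. (l, b, d) \<in> F \<Longrightarrow> b \<noteq> d"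
    and "\<And>S. S \<subseteq> U \<Longrightarrow> 2 \<le> card S \<Longrightarrow> card {(l, b, d) \<in> F. {l, b, d} \<subseteq> S} + 2 \<le> card S"
  shows "\<exists>r::'u \<Rightarrow> real. inj_on r U \<and> (\<forall>(l, b, d)\<in>F. {l, b, d} \<subseteq> U \<longrightarrow>
    r b < r l \<and> r l < r d \<or> r d < r l \<and> r l < r b)"
  using assms(1,4)
proof (induction "card U" arbitrary: U rule: less_induct)
  case less
  show ?case
  proof (cases "card U \<le> 1")
    case True
    then have one: "u = v" if "u \<in> U" "v \<in> U" for u v
      using that less.prems(1) by (metis card_le_Suc0_iff_eq One_nat_def)
    have "inj_on (\<lambda>_. 0 :: real) U" using one by (auto intro!: inj_onI)
    moreover have "\<not> {l, b, d} \<subseteq> U" if "(l, b, d) \<in> F" for l b d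
      using one[of b d] assms(3)[OF that] by auto
    ultimately show ?thesis by (intro exI[of _ "\<lambda>_. 0"]) auto
  next
    case False
    \<comment> \<open>Adding a constant preserves the equations, so the value at \<open>o1\<close>
      is set to 0. The other \<open>card U - 1\<close> unknowns outnumber the equations, and a
      nonzero solution is then nonconstant on \<open>U\<close>, so all level sets are proper
      subsets.\<close>
    then obtain o1 where o1: "o1 \<in> U" by fastforce
    let ?U = "U - {o1}"
    let ?I = "{(l, b, d) \<in> F. {l, b, d} \<subseteq> U}"
    define A :: "'u \<times> 'u \<times> 'u \<Rightarrow> 'u \<Rightarrow> real" where
      "A = (\<lambda>(l, b, d) u. (if u = l then 2 else 0) - (if u = b then 1 else 0) - (if u = d then 1 else 0))"
    have "finite ?I" using assms(2) by (rule rev_finite_subset) auto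
    moreover have "card ?I < card ?U" using less.prems(2)[of U] False o1 less.prems(1) by simp
    ultimately obtain x where x: "\<exists>u\<in>?U. x u \<noteq> 0" "\<forall>t\<in>?I. (\<Sum>u\<in>?U. A t u * x u) = 0"
      using homogeneous_system_nontrivial[of ?I ?U A] less.prems(1) by auto
    define y where "y = x(o1 := 0)"
    have y: "2 * y l = y b + y d" if "(l, b, d) \<in> F" "{l, b, d} \<subseteq> U" for l b d
    proof -
      have "(\<Sum>u\<in>?U. A (l, b, d) u * x u) = (\<Sum>u\<in>U. A (l, b, d) u * y u)"
        by (rule sum.mono_neutral_cong_left) (use less.prems(1) in \<open>auto simp: y_def\<close>)
      also have "\<dots> = (\<Sum>u\<in>U. (if u = l then 2 * y u else 0) - (if u = b then y u else 0) - (if u = d then y u else 0))"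
        by (intro sum.cong) (auto simp: A_def)
      also have "\<dots> = 2 * y l - y b - y d"
        using that(2) less.prems(1) by (simp add: sum_subtractf)
      finally show ?thesis using x(2) that by auto
    qed
    have "\<exists>q::'u \<Rightarrow> real. inj_on q {u \<in> U. y u = t} \<and> (\<forall>(l, b, d)\<in>F. {l, b, d} \<subseteq> {u \<in> U. y u = t} \<longrightarrow>
        q b < q l \<and> q l < q d \<or> q d < q l \<and> q l < q b)" for t
    proof (rule less.hyps)
      have "{u \<in> U. y u = t} \<noteq> U" using x(1) o1 by (auto simp: y_def)
      then have "{u \<in> U. y u = t} \<subset> U" by blast
      then show "card {u \<in> U. y u = t} < card U" using less.prems(1) by (rule psubset_card_mono[rotated])
    qed (use less.prems in auto)
    then have "\<exists>q. \<forall>t. inj_on (q t) {u \<in> U. y u = t} \<and> (\<forall>(l, b, d)\<in>F. {l, b, d} \<subseteq> {u \<in> U. y u = t} \<longrightarrow>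
        q t b < q t l \<and> q t l < q t d \<or> q t d < q t l \<and> q t l < (q t b :: real))" by (intro choice allI)
    then obtain q where q0: "\<forall>t. inj_on (q t) {u \<in> U. y u = t} \<and> (\<forall>(l, b, d)\<in>F. {l, b, d} \<subseteq> {u \<in> U. y u = t} \<longrightarrow>
        q t b < q t l \<and> q t l < q t d \<or> q t d < q t l \<and> q t l < (q t b :: real))" ..
    have q: "inj_on (q t) {u \<in> U. y u = t}" for t by (rule conjunct1[OF spec[OF q0, of t]])
    have q2: "q t b < q t l \<and> q t l < q t d \<or> q t d < q t l \<and> q t l < q t b"
      if "(l, b, d) \<in> F" "{l, b, d} \<subseteq> {u \<in> U. y u = t}" for t l b d
      using bspec[OF conjunct2[OF spec[OF q0, of t]] that(1)] that(2) by simp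
    \<comment> \<open>\<open>y\<close> orders the level sets and the recursive orders
      \<open>p\<close> break ties inside them; \<open>\<epsilon>\<close> is small enough to respect
      the strict inequalities of \<open>y\<close>.\<close>
    define p where "p u = q (y u) u" for u
    have "\<exists>\<epsilon>>0. \<forall>(u, v)\<in>{(u, v) \<in> U \<times> U. y u < y v}. \<epsilon> * (p u - p v) < y v - y u"
      using small_perturbation[of "{(u, v) \<in> U \<times> U. y u < y v}" "\<lambda>(u, v). y v - y u" "\<lambda>(u, v). p u - p v"]
        less.prems(1) finite_subset[of "{(u, v) \<in> U \<times> U. y u < y v}" "U \<times> U"] by (auto simp: case_prod_beta)
    then obtain \<epsilon> where \<epsilon>: "\<epsilon> > 0"
      "\<And>u v. u \<in> U \<Longrightarrow> v \<in> U \<Longrightarrow> y u < y v \<Longrightarrow> \<epsilon> * (p u - p v) < y v - y u" by auto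
    define r where "r u = y u + \<epsilon> * p u" for u
    have lt: "r u < r v" if "u \<in> U" "v \<in> U" "y u < y v" for u v
      using \<epsilon>(2)[OF that] by (simp add: r_def algebra_simps)
    have lt': "r u < r v" if "y u = y v" "p u < p v" for u v
      using that \<epsilon>(1) by (simp add: r_def)
    have "inj_on r U"
    proof (rule inj_onI)
      fix u v assume uv: "u \<in> U" "v \<in> U" "r u = r v"
      then have "y u = y v" using lt[of u v] lt[of v u] by force
      moreover from this have "p u = p v" using uv \<epsilon>(1) by (simp add: r_def)
      ultimately show "u = v" using q[of "y u"] uv by (auto simp: p_def dest: inj_onD)
    qed
    moreover have "r b < r l \<and> r l < r d \<or> r d < r l \<and> r l < r b"
      if t: "(l, b, d) \<in> F" "{l, b, d} \<subseteq> U" for l b d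
    proof -
      consider "y b < y l" "y l < y d" | "y d < y l" "y l < y b" | "y b = y l" "y d = y l"
        using y[OF t] by fastforce
      then show ?thesis
      proof cases
        case 3
        then show ?thesis using q2[OF t(1), of "y l"] t(2) lt' by (auto simp: p_def)
      qed (use lt t(2) in auto)
    qed
    ultimately show ?thesis by blast
  qed
qed

section \<open>Colorings of balls and nodes\<close>

text \<open>\<open>\<nu>\<close> sends a ball to its node, a class of balls whose relative colors
  are known. Flips act on whole nodes.\<close>

definition flp :: "(nat \<Rightarrow> nat) \<Rightarrow> nat set \<Rightarrow> coloring \<Rightarrow> coloring" where
  "flp \<nu> X c = (\<lambda>b. if \<nu> b \<in> X then \<not> c b else c b)"

definition proper :: "nat set set \<Rightarrow> coloring \<Rightarrow> bool" where
  "proper F c \<longleftrightarrow> (\<forall>e\<in>F. \<not> answer c e)"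

definition inside :: "(nat \<Rightarrow> nat) \<Rightarrow> nat set set \<Rightarrow> nat set \<Rightarrow> nat set set" where
  "inside \<nu> E U = {e \<in> E. \<nu> ` e \<subseteq> U}"

text \<open>Supermodular in \<open>U\<close>. Sparsity bounds it by \<open>-2\<close>, and the cost
  of a contraction is read off from it.\<close>

definition excess :: "(nat \<Rightarrow> nat) \<Rightarrow> nat set set \<Rightarrow> nat set \<Rightarrow> int" where
  "excess \<nu> E U = int (card (inside \<nu> E U)) - int (card U)"

text \<open>Equivalently, the colorings that arise from \<open>g\<close> by complementing any set of
  nodes. Together, \<open>\<nu>\<close> and \<open>g\<close> encode what is known inside the
  classes.\<close>

definition sig :: "(nat \<Rightarrow> nat) \<Rightarrow> coloring \<Rightarrow> coloring set" where
  "sig \<nu> g = {c. \<forall>a b. \<nu> a = \<nu> b \<longrightarrow> (c a = c b) = (g a = g b)}"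

definition single :: "(nat \<Rightarrow> nat) \<Rightarrow> nat \<Rightarrow> bool" where
  "single \<nu> v \<longleftrightarrow> (\<forall>b. \<nu> b = v \<longleftrightarrow> b = v)"

definition val :: "bool \<Rightarrow> int" where
  "val x = (if x then 1 else - 1)"

lemma flp_commute: "flp \<nu> X (flp \<nu> Y c) = flp \<nu> Y (flp \<nu> X c)"
  by (auto simp: flp_def)

lemma flp_flp_same [simp]: "flp \<nu> X (flp \<nu> X c) = c"
  by (auto simp: flp_def)

lemma flp_insert: "v \<notin> X \<Longrightarrow> flp \<nu> {v} (flp \<nu> X c) = flp \<nu> (insert v X) c"
  by (auto simp: flp_def)

lemma flp_sig: "c \<in> sig \<nu> g \<Longrightarrow> flp \<nu> X c \<in> sig \<nu> g"
  by (auto simp: sig_def flp_def)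

lemma sig_refl: "g \<in> sig \<nu> g"
  by (auto simp: sig_def)

lemma answer_cong: "(\<And>b. b \<in> e \<Longrightarrow> c b = c' b) \<Longrightarrow> answer c e = answer c' e"
  by (auto simp: answer_def)

lemma answer_compl: "(\<And>b. b \<in> e \<Longrightarrow> c b = (\<not> c' b)) \<Longrightarrow> answer c e = answer c' e"
  by (auto simp: answer_def)

lemma proper_mono: "proper F c \<Longrightarrow> F' \<subseteq> F \<Longrightarrow> proper F' c"
  by (auto simp: proper_def)

lemma inside_mono: "U \<subseteq> U' \<Longrightarrow> inside \<nu> E U \<subseteq> inside \<nu> E U'"
  by (auto simp: inside_def)

lemma proper_flp_all:
  assumes "proper (inside \<nu> E W) c"
  shows "proper (inside \<nu> E W) (flp \<nu> W c)"
  unfolding proper_def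
proof
  fix e assume e: "e \<in> inside \<nu> E W"
  then have "answer (flp \<nu> W c) e = answer c e"
    by (intro answer_compl) (auto simp: inside_def flp_def)
  then show "\<not> answer (flp \<nu> W c) e" using assms e by (auto simp: proper_def)
qed

lemma proper_inside_cong:
  assumes "proper (inside \<nu> E W) c" "\<And>b. \<nu> b \<in> W \<Longrightarrow> c b = c' b"
  shows "proper (inside \<nu> E W) c'"
  unfolding proper_def
proof
  fix e assume e: "e \<in> inside \<nu> E W"
  then have "answer c' e = answer c e" using assms(2)
    by (intro answer_cong) (auto simp: inside_def)
  then show "\<not> answer c' e" using assms e by (auto simp: proper_def)
qed

text \<open>An edge inside \<open>A\<close> or \<open>B\<close> is inside the union, an edge inside
  both is inside the intersection, and cardinality is modular.\<close>

lemma excess_supermodular: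
  assumes "finite E" "finite A" "finite B"
  shows "excess \<nu> E A + excess \<nu> E B \<le> excess \<nu> E (A \<union> B) + excess \<nu> E (A \<inter> B)"
proof -
  let ?i = "inside \<nu> E"
  have fin: "finite (?i U)" for U using assms(1) by (auto simp: inside_def)
  have "card (?i A) + card (?i B) = card (?i A \<union> ?i B) + card (?i A \<inter> ?i B)"
    using fin by (intro card_Un_Int)
  moreover have "?i A \<inter> ?i B = ?i (A \<inter> B)" by (auto simp: inside_def)
  moreover have "card (?i A \<union> ?i B) \<le> card (?i (A \<union> B))"
    using fin by (intro card_mono) (auto simp: inside_def)
  moreover have "card A + card B = card (A \<union> B) + card (A \<inter> B)"
    using assms by (intro card_Un_Int)
  ultimately show ?thesis by (simp add: excess_def)
qed

lemma card_3_nonmono: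
  assumes "card e = 3" "\<not> answer c e"
  shows "\<exists>a b d. e = {d, a, b} \<and> c a = c b \<and> c d \<noteq> c a \<and> a \<noteq> b"
proof -
  from assms(1) obtain x y z where "e = {x, y, z}" "x \<noteq> y" "x \<noteq> z" "y \<noteq> z" by (auto simp: card_3_iff)
  note xyz = this
  then consider "c y = c z" "c x \<noteq> c y" | "c x = c z" "c y \<noteq> c x" | "c x = c y" "c z \<noteq> c x"
    using assms(2) by (auto simp: answer_def)
  then show ?thesis
  proof cases
    case 1
    then show ?thesis using xyz by blast
  next
    case 2
    moreover have "e = {y, x, z}" using xyz(1) by (simp add: insert_commute)
    ultimately show ?thesis using xyz(3) by blast
  next
    case 3
    moreover have "e = {z, x, y}" using xyz(1) by (simp add: insert_commute)
    ultimately show ?thesis using xyz(2) by blast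
  qed
qed

lemma strict_enumeration:
  fixes r :: "'a \<Rightarrow> real"
  assumes "finite W" "inj_on r W"
  shows "\<exists>h. bij_betw h {..<card W} W \<and> (\<forall>i j. i < j \<longrightarrow> j < card W \<longrightarrow> r (h i) < r (h j))"
proof -
  let ?xs = "sorted_list_of_set (r ` W)"
  have len: "length ?xs = card W" using assms by (simp add: card_image)
  have set: "set ?xs = r ` W" using assms by simp
  have mem: "?xs ! i \<in> r ` W" if "i < card W" for i using that len set nth_mem by metis
  define h where "h i = inv_into W r (?xs ! i)" for i
  have rh: "r (h i) = ?xs ! i" if "i < card W" for i
    unfolding h_def using mem[OF that] by (rule f_inv_into_f)
  have hW: "h i \<in> W" if "i < card W" for i unfolding h_def using mem[OF that] by (rule inv_into_into)
  have lt: "r (h i) < r (h j)" if "i < j" "j < card W" for i j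
    using that rh len strict_sorted_list_of_set[of "r ` W"]
    by (simp add: sorted_wrt_nth_less)
  have inj: "inj_on h {..<card W}"
    using lt by (metis (mono_tags, lifting) inj_onI lessThan_iff less_irrefl linorder_neqE_nat)
  moreover have "h ` {..<card W} = W"
    by (rule card_subset_eq) (use assms hW inj card_image[OF inj] in auto)
  ultimately show ?thesis using lt by (auto simp: bij_betw_def)
qed

text \<open>Contraction of a set of nodes. In the applications the name \<open>x\<close> is taken
  from \<open>X\<close>, and \<open>x = 0\<close> means absorption into the root class.\<close>

definition mrg :: "nat set \<Rightarrow> nat \<Rightarrow> (nat \<Rightarrow> nat) \<Rightarrow> nat \<Rightarrow> nat" where
  "mrg X x \<nu> = (\<lambda>b. if \<nu> b \<in> X then x else \<nu> b)"

section \<open>Discrete intermediate values for integer walks\<close>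

lemma even_step_sign_constant:
  fixes a :: "nat \<Rightarrow> int"
  assumes "\<And>i. i < m \<Longrightarrow> \<bar>a (Suc i) - a i\<bar> \<le> 2" "\<And>i. i \<le> m \<Longrightarrow> even (a i - t)"
    and "\<And>i. i \<le> m \<Longrightarrow> a i \<noteq> t" "i \<le> m"
  shows "a i < t \<longleftrightarrow> a 0 < t"
  using assms(4)
proof (induction i)
  case (Suc i)
  then have "\<bar>a (Suc i) - a i\<bar> \<le> 2" "even (a i - t)" "a i \<noteq> t" "a (Suc i) \<noteq> t" "even (a (Suc i) - t)"
    using assms by auto
  then have "a (Suc i) < t \<longleftrightarrow> a i < t" by presburger
  then show ?case using Suc by simp
qed simp

lemma even_step_attained:
  fixes a :: "nat \<Rightarrow> int"
  assumes "\<And>i. i < m \<Longrightarrow> \<bar>a (Suc i) - a i\<bar> \<le> 2" "\<And>i. i \<le> m \<Longrightarrow> even (a i - t)"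
    and "i \<le> m" "j \<le> m" "a i \<le> t" "t \<le> a j"
  shows "\<exists>l\<le>m. a l = t"
proof (rule ccontr)
  assume "\<not> ?thesis"
  then have "\<And>i. i \<le> m \<Longrightarrow> a i \<noteq> t" by blast
  then show False using even_step_sign_constant[of m a t i] even_step_sign_constant[of m a t j] assms
    by (metis order_le_less not_less)
qed

text \<open>Odd values with steps of size at most 2 can change sign only between 1 and
  \<open>-1\<close>.\<close>

lemma odd_step_crossing:
  fixes a :: "nat \<Rightarrow> int"
  assumes "\<And>i. i < m \<Longrightarrow> \<bar>a (Suc i) - a i\<bar> \<le> 2" "\<And>i. i \<le> m \<Longrightarrow> odd (a i)"
    and "i \<le> m" "j \<le> m" "a i < 0" "0 < a j"
  shows "\<exists>l<m. a l = 1 \<and> a (Suc l) = - 1 \<or> a l = - 1 \<and> a (Suc l) = 1"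
proof (rule ccontr)
  assume no: "\<not> ?thesis"
  have "a i < 0 \<longleftrightarrow> a 0 < 0" if "i \<le> m" for i
    using that
  proof (induction i)
    case (Suc i)
    then have "\<bar>a (Suc i) - a i\<bar> \<le> 2" "odd (a i)" "odd (a (Suc i))" using assms(1,2) by auto
    moreover have "\<not> (a i = 1 \<and> a (Suc i) = - 1)" "\<not> (a i = - 1 \<and> a (Suc i) = 1)" using no Suc.prems by auto
    ultimately have "a (Suc i) < 0 \<longleftrightarrow> a i < 0" by presburger
    then show ?case using Suc by simp
  qed simp
  from this[OF assms(3)] this[OF assms(4)] show False using assms(5,6) by simp
qed

section \<open>Colorings compatible with a contraction\<close>

lemma sigD: "c \<in> sig \<nu> g \<Longrightarrow> \<nu> a = \<nu> b \<Longrightarrow> (c a = c b) = (g a = g b)"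
  unfolding sig_def by blast

lemma mrg_sig_subset:
  assumes "c \<in> sig \<nu> g"
  shows "sig (mrg X x \<nu>) c \<subseteq> sig \<nu> g"
proof
  fix c' assume c': "c' \<in> sig (mrg X x \<nu>) c"
  have "(c' a = c' b) = (g a = g b)" if "\<nu> a = \<nu> b" for a b
  proof -
    have "mrg X x \<nu> a = mrg X x \<nu> b" using that by (simp add: mrg_def)
    then show ?thesis using sigD[OF c'] sigD[OF assms that] by simp
  qed
  then show "c' \<in> sig \<nu> g" by (simp add: sig_def)
qed

lemma sig_mrg_cases:
  assumes "c' \<in> sig (mrg X x \<nu>) c"
  shows "(\<forall>b. \<nu> b \<in> X \<longrightarrow> c' b = c b) \<or> (\<forall>b. \<nu> b \<in> X \<longrightarrow> c' b = (\<not> c b))"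
proof (rule ccontr)
  assume "\<not> ?thesis"
  then obtain a b where ab: "\<nu> a \<in> X" "c' a \<noteq> c a" "\<nu> b \<in> X" "c' b = c b" by auto
  then have "mrg X x \<nu> a = mrg X x \<nu> b" by (simp add: mrg_def)
  from sigD[OF assms this] show False using ab by auto
qed

lemma sig_cases:
  assumes "c \<in> sig \<nu> g" "c' \<in> sig \<nu> g"
  shows "(\<forall>b. \<nu> b = v \<longrightarrow> c' b = c b) \<or> (\<forall>b. \<nu> b = v \<longrightarrow> c' b = (\<not> c b))"
proof (rule ccontr)
  assume "\<not> ?thesis"
  then obtain a b where ab: "\<nu> a = v" "c' a \<noteq> c a" "\<nu> b = v" "c' b = c b" by auto
  then show False using sigD[OF assms(1), of a b] sigD[OF assms(2), of a b] by auto
qed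

lemma proper_sig_mrg:
  assumes "proper (inside \<nu> E W) c" "c' \<in> sig (mrg W x \<nu>) c"
  shows "proper (inside \<nu> E W) c'"
  using sig_mrg_cases[OF assms(2)]
proof
  assume "\<forall>b. \<nu> b \<in> W \<longrightarrow> c' b = (\<not> c b)"
  then show ?thesis
    using proper_inside_cong[OF proper_flp_all[OF assms(1)], of c'] by (simp add: flp_def)
qed (use proper_inside_cong[OF assms(1)] in auto)

lemma val_cases: "val x = 1 \<and> x \<or> val x = - 1 \<and> \<not> x"
  by (simp add: val_def)

lemma val_not [simp]: "val (\<not> x) = - val x"
  by (simp add: val_def)

lemma val_eq_iff [simp]: "val x = val y \<longleftrightarrow> x = y"
  by (simp add: val_def)

lemma periodic_window_inj:
  fixes h :: "nat \<Rightarrow> 'a"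
  assumes "\<And>i. h (i + p) = h i" "inj_on h {..<p}" "i < j" "j < i + p"
  shows "h i \<noteq> h j"
proof
  assume eq: "h i = h j"
  have p: "p > 0" using assms by simp
  have mod: "h (i mod p) = h i" for i
  proof (induction i rule: less_induct)
    case (less i)
    show ?case
    proof (cases "i < p")
      case False
      then have "h ((i - p) mod p) = h (i - p)" using p by (intro less) auto
      then show ?thesis using False assms(1)[of "i - p"] by (simp add: le_mod_geq)
    qed simp
  qed
  have "i mod p = j mod p" using inj_onD[OF assms(2), of "i mod p" "j mod p"] mod eq p by simp
  then have "p dvd j - i" using assms(3) mod_eq_dvd_iff_nat[of i j p] by auto
  then show False using assms(3,4) by (auto dest: dvd_imp_le)
qed

text \<open>If both values exceeded \<open>t\<close>, parity would put both at \<open>t + 2\<close>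
  or above, and their average \<open>w\<close> as well.\<close>

lemma even_pair_le:
  fixes x y w t :: int
  assumes "x + y = 2 * w" "w - 1 \<le> t" "even (x - t)" "even (y - t)"
  shows "x \<le> t \<or> y \<le> t"
  using assms by presburger

lemma even_pair_ge:
  fixes x y w t :: int
  assumes "x + y = 2 * w" "t \<le> w + 1" "even (x - t)" "even (y - t)"
  shows "t \<le> x \<or> t \<le> y"
  using assms by presburger

text \<open>\<open>P\<close> is the sign of the walk, where a zero takes the sign of the next value.
  If every visit to 0 returned to the side it came from, this sign would never change, against the
  antiperiodicity.\<close>

lemma straight_crossing_through_zero:
  fixes a :: "nat \<Rightarrow> int"
  assumes "\<And>i. a (Suc i) = a i + 2 \<or> a (Suc i) = a i - 2" "\<And>i. even (a i)" "\<And>i. a (i + p) = - a i"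
  shows "\<exists>i s. (s = 1 \<or> s = - 1) \<and> a i = 2 * s \<and> a (Suc i) = 0 \<and> a (Suc (Suc i)) = - 2 * s"
proof (rule ccontr)
  assume no: "\<not> ?thesis"
  define P where "P i \<longleftrightarrow> a i > 0 \<or> a i = 0 \<and> a (Suc i) > 0" for i
  have step: "P (Suc i) \<longleftrightarrow> P i" for i
  proof -
    have "\<not> (a i = 2 \<and> a (Suc i) = 0 \<and> a (Suc (Suc i)) = - 2)"
      "\<not> (a i = - 2 \<and> a (Suc i) = 0 \<and> a (Suc (Suc i)) = 2)"
      using no[unfolded not_ex, rule_format, of 1 i] no[unfolded not_ex, rule_format, of "- 1" i] by simp_all
    then show ?thesis unfolding P_def using assms(1)[of i] assms(1)[of "Suc i"] assms(2)[of i] by presburger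
  qed
  have "P i \<longleftrightarrow> P 0" for i by (induction i) (auto simp: step)
  moreover have "P (0 + p) \<longleftrightarrow> \<not> P 0"
    unfolding P_def using assms(3)[of 0] assms(3)[of 1] assms(1)[of 0] by auto
  ultimately show False by blast
qed

lemma single_self: "single \<nu> v \<Longrightarrow> \<nu> v = v"
  by (simp add: single_def)

definition same_up_to_compl :: "(nat \<Rightarrow> nat) \<Rightarrow> nat set \<Rightarrow> coloring \<Rightarrow> coloring \<Rightarrow> bool" where
  "same_up_to_compl \<nu> W c d \<longleftrightarrow> (\<forall>b. \<nu> b \<in> W \<longrightarrow> c b = d b) \<or> (\<forall>b. \<nu> b \<in> W \<longrightarrow> c b = (\<not> d b))"

lemma same_answer:
  assumes "same_up_to_compl \<nu> W c d" "\<nu> ` e \<subseteq> W"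
  shows "answer c e = answer d e"
  using assms(1) unfolding same_up_to_compl_def
proof
  assume "\<forall>b. \<nu> b \<in> W \<longrightarrow> c b = d b"
  then show ?thesis using assms(2) by (intro answer_cong) auto
next
  assume "\<forall>b. \<nu> b \<in> W \<longrightarrow> c b = (\<not> d b)"
  then show ?thesis using assms(2) by (intro answer_compl) auto
qed

lemma same_proper:
  assumes "same_up_to_compl \<nu> W c d" "proper (inside \<nu> E W) d"
  shows "proper (inside \<nu> E W) c"
  using same_answer[OF assms(1)] assms(2) by (auto simp: proper_def inside_def)

lemma sig_mrg_same:
  assumes "c' \<in> sig (mrg X x \<nu>) c"
  shows "same_up_to_compl \<nu> X c' c"
  using sig_mrg_cases[OF assms] by (simp add: same_up_to_compl_def)

text \<open>When all of \<open>W\<close> but \<open>u\<close> is contracted, only the orientation of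
  \<open>u\<close> against the rest stays open. Hence two proper colorings, before and after
  flipping \<open>u\<close>, suffice to make every coloring of the contraction proper inside
  \<open>W\<close>. With two free nodes, four colorings are needed.\<close>

lemma sig_mrg_one_free:
  assumes c: "c \<in> sig \<nu> g" and c': "c' \<in> sig (mrg (W - {u}) x \<nu>) c" and u: "u \<in> W"
  shows "same_up_to_compl \<nu> W c' c \<or> same_up_to_compl \<nu> W c' (flp \<nu> {u} c)"
proof -
  have "c' \<in> sig \<nu> g" using mrg_sig_subset[OF c] c' by blast
  note u = sig_cases[OF c this, of u] and X = sig_mrg_cases[OF c']
  show ?thesis using u X unfolding same_up_to_compl_def flp_def by (elim disjE) auto
qed

lemma sig_mrg_two_free:
  assumes c: "c \<in> sig \<nu> g" and c': "c' \<in> sig (mrg (W - {u, v}) x \<nu>) c" and uv: "u \<noteq> v"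
  shows "same_up_to_compl \<nu> W c' c \<or> same_up_to_compl \<nu> W c' (flp \<nu> {u} c) \<or>
    same_up_to_compl \<nu> W c' (flp \<nu> {v} c) \<or> same_up_to_compl \<nu> W c' (flp \<nu> {v} (flp \<nu> {u} c))"
proof -
  have c'g: "c' \<in> sig \<nu> g" using mrg_sig_subset[OF c] c' by blast
  note u = sig_cases[OF c c'g, of u] and v = sig_cases[OF c c'g, of v] and X = sig_mrg_cases[OF c']
  have S: "same_up_to_compl \<nu> W c' d" if "\<And>b. \<nu> b \<in> W \<Longrightarrow> c' b = d b" for d
    using that by (simp add: same_up_to_compl_def)
  have N: "same_up_to_compl \<nu> W c' d" if "\<And>b. \<nu> b \<in> W \<Longrightarrow> c' b = (\<not> d b)" for d
    using that by (simp add: same_up_to_compl_def)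
  define p q r where "p \<longleftrightarrow> (\<forall>b. \<nu> b = u \<longrightarrow> c' b = c b)" and "q \<longleftrightarrow> (\<forall>b. \<nu> b = v \<longrightarrow> c' b = c b)"
    and "r \<longleftrightarrow> (\<forall>b. \<nu> b \<in> W - {u, v} \<longrightarrow> c' b = c b)"
  have c'b: "c' b = (c b = (if \<nu> b = u then p else if \<nu> b = v then q else r))" if "\<nu> b \<in> W" for b
    using u v X that unfolding p_def q_def r_def by auto
  show ?thesis
    by (cases p; cases q; cases r) (use S[of c] S[of "flp \<nu> {u} c"] S[of "flp \<nu> {v} c"] S[of "flp \<nu> {v} (flp \<nu> {u} c)"]
      N[of c] N[of "flp \<nu> {u} c"] N[of "flp \<nu> {v} c"] N[of "flp \<nu> {v} (flp \<nu> {u} c)"] c'b uv in \<open>simp_all add: flp_def\<close>)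
qed

lemma sig_piecewise:
  assumes "c \<in> sig \<nu> g" "d \<in> sig \<nu> g" "Y \<inter> X = {}" "x \<in> X"
  shows "(\<lambda>b. if \<nu> b \<in> Y then c b else d b) \<in> sig (mrg X x \<nu>) d"
  unfolding sig_def
proof (intro CollectI allI impI)
  fix a b assume ab: "mrg X x \<nu> a = mrg X x \<nu> b"
  show "((if \<nu> a \<in> Y then c a else d a) = (if \<nu> b \<in> Y then c b else d b)) = (d a = d b)"
  proof (cases "\<nu> a \<in> X \<or> \<nu> b \<in> X")
    case True
    then have "\<nu> a \<in> X \<and> \<nu> b \<in> X" using ab assms(4) by (auto simp: mrg_def split: if_splits)
    then have "\<nu> a \<notin> Y" "\<nu> b \<notin> Y" using assms(3) by auto
    then show ?thesis by simp
  next
    case False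
    then have eq: "\<nu> a = \<nu> b" using ab by (simp add: mrg_def)
    show ?thesis unfolding eq using sigD[OF assms(1) eq] sigD[OF assms(2) eq] by simp
  qed
qed

section \<open>The adversary principle for decision trees\<close>

definition const_on :: "coloring set \<Rightarrow> nat set \<Rightarrow> bool" where
  "const_on C e \<longleftrightarrow> (\<forall>c\<in>C. \<forall>c'\<in>C. answer c e = answer c' e)"

lemma const_onI: "(\<And>c. c \<in> C \<Longrightarrow> answer c e = a) \<Longrightarrow> const_on C e"
  by (simp add: const_on_def)

lemma const_on_subset: "const_on C e \<Longrightarrow> D \<subseteq> C \<Longrightarrow> const_on D e"
  by (auto simp: const_on_def)

lemma excess_insert:
  assumes "finite E" "e \<notin> E"
  shows "excess \<nu> (insert e E) Z = excess \<nu> E Z + (if \<nu> ` e \<subseteq> Z then 1 else 0)"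
proof -
  have "inside \<nu> (insert e E) Z = (if \<nu> ` e \<subseteq> Z then insert e (inside \<nu> E Z) else inside \<nu> E Z)"
    by (auto simp: inside_def)
  then show ?thesis using assms by (auto simp: excess_def inside_def)
qed

text \<open>The adversary answers a query by passing to a set \<open>D\<close> on which the answer
  is constant. \<open>D\<close> may be much smaller than the answer requires: extra information is
  given away to keep the state simple.\<close>

lemma not_solvable:
  assumes out: "\<And>a. \<exists>c\<in>C. \<not> correct_output n c a"
    and step: "\<And>l e. k = Suc l \<Longrightarrow> e \<subseteq> {..<n} \<Longrightarrow> card e = 3 \<Longrightarrow> \<exists>D\<subseteq>C. const_on D e \<and> \<not> solvable n l D"
  shows "\<not> solvable n k C"
proof
  assume "solvable n k C"
  then obtain s where s: "triple_strategy n s" "\<And>c. c \<in> C \<Longrightarrow> correct_output n c (run c s) \<and> queries c s \<le> k"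
    by (auto simp: solvable_def)
  show False
  proof (cases s)
    case (Output a)
    then show False using s(2) out[of a] by auto
  next
    case (Query e y z)
    obtain c0 where "c0 \<in> C" using out by blast
    then obtain l where l: "k = Suc l" using s(2)[of c0] Query by (cases k) auto
    have e: "e \<subseteq> {..<n}" "card e = 3" using s(1) Query by auto
    from step[OF l e] obtain D where D: "D \<subseteq> C" "const_on D e" "\<not> solvable n l D" by blast
    have s2: "answer c e \<Longrightarrow> correct_output n c (run c y) \<and> queries c y \<le> l"
      "\<not> answer c e \<Longrightarrow> correct_output n c (run c z) \<and> queries c z \<le> l" if "c \<in> C" for c
      using s(2)[OF that] Query l by auto
    have "solvable n l {c \<in> C. answer c e}" unfolding solvable_def
      by (rule exI[of _ y]) (use s(1) s2 Query in auto)
    moreover have "solvable n l {c \<in> C. \<not> answer c e}" unfolding solvable_def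
      by (rule exI[of _ z]) (use s(1) s2 Query in auto)
    moreover have "D \<subseteq> {c \<in> C. answer c e} \<or> D \<subseteq> {c \<in> C. \<not> answer c e}"
      using D(1,2) by (auto simp: const_on_def)
    ultimately show False using D(3) solvable_mono[of n l _ D l] by blast
  qed
qed

lemma q3_ge:
  assumes "\<not> solvable n k UNIV"
  shows "enat (Suc k) \<le> q3 n"
  unfolding q3_def
proof (rule INF_greatest)
  fix s assume "s \<in> {s. solves_majority n s}"
  then have "triple_strategy n s" "\<And>c. correct_output n c (run c s)" by (auto simp: solves_majority_def)
  then obtain c where "\<not> queries c s \<le> k" using assms by (auto simp: solvable_def)
  then have "enat (Suc k) \<le> enat (queries c s)" by simp
  also have "\<dots> \<le> worst_case_queries s" unfolding worst_case_queries_def by (rule SUP_upper) simp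
  finally show "enat (Suc k) \<le> worst_case_queries s" .
qed

context
  fixes n :: nat
begin

section \<open>Sparse sets of NO answers and rotations\<close>

definition nodes :: "(nat \<Rightarrow> nat) \<Rightarrow> nat set" where
  "nodes \<nu> = \<nu> ` {..<n}"

text \<open>Edges are sets of balls while the count runs over nodes; injectivity gives each edge
  three nodes. Single nodes are exempt from the bound since their excess is
  \<open>-1\<close>.\<close>

definition sparse :: "(nat \<Rightarrow> nat) \<Rightarrow> nat set set \<Rightarrow> bool" where
  "sparse \<nu> E \<longleftrightarrow> finite E \<and> (\<forall>e\<in>E. e \<subseteq> {..<n} \<and> card e = 3 \<and> inj_on \<nu> e) \<and>
    (\<forall>U \<subseteq> nodes \<nu>. 2 \<le> card U \<longrightarrow> excess \<nu> E U \<le> - 2)"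

definition wt :: "(nat \<Rightarrow> nat) \<Rightarrow> nat set \<Rightarrow> coloring \<Rightarrow> int" where
  "wt \<nu> U c = (\<Sum>b | b < n \<and> \<nu> b \<in> U. val (c b))"

definition total :: "coloring \<Rightarrow> int" where
  "total c = (\<Sum>b<n. val (c b))"

definition cols :: "(nat \<Rightarrow> nat) \<Rightarrow> coloring \<Rightarrow> nat set set \<Rightarrow> coloring set" where
  "cols \<nu> g E = {c \<in> sig \<nu> g. proper E c}"

lemma finite_nodes [simp]: "finite (nodes \<nu>)"
  by (simp add: nodes_def)

lemma sparse_finite: "sparse \<nu> E \<Longrightarrow> finite E"
  by (simp add: sparse_def)

lemma sparse_edge:
  assumes "sparse \<nu> E" "e \<in> E"
  shows "e \<subseteq> {..<n}" "card e = 3" "inj_on \<nu> e" "card (\<nu> ` e) = 3" "\<nu> ` e \<subseteq> nodes \<nu>"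
  using assms by (auto simp: sparse_def nodes_def card_image)

lemma sparse_excess: "sparse \<nu> E \<Longrightarrow> U \<subseteq> nodes \<nu> \<Longrightarrow> 2 \<le> card U \<Longrightarrow> excess \<nu> E U \<le> - 2"
  by (auto simp: sparse_def)

lemma sparse_subset:
  assumes "sparse \<nu> E" "F \<subseteq> E"
  shows "sparse \<nu> F"
proof -
  have "excess \<nu> F U \<le> excess \<nu> E U" for U
    unfolding excess_def using assms sparse_finite[OF assms(1)]
    by (auto simp: inside_def intro!: card_mono)
  then show ?thesis using assms finite_subset unfolding sparse_def by (meson order_trans subsetD)
qed

lemma inside_nodes: "sparse \<nu> E \<Longrightarrow> inside \<nu> E (nodes \<nu>) = E"
  using sparse_edge(5) by (fastforce simp: inside_def)

text \<open>In every edge the node whose color differs from the other two has to be flipped second.\<close>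

lemma rotation:
  assumes sp: "sparse \<nu> E" and W: "W \<subseteq> nodes \<nu>" "W \<noteq> {}" and c: "proper (inside \<nu> E W) c"
  obtains C h where "C 0 = c" "\<And>i. C (Suc i) = flp \<nu> {h i} (C i)" "\<And>i. proper (inside \<nu> E W) (C i)"
    "\<And>i. C (i + card W) = flp \<nu> W (C i)" "\<And>i. h (i + card W) = h i" "bij_betw h {..<card W} W"
    "\<And>i. h i \<in> W"
proof -
  let ?p = "card W"
  let ?I = "inside \<nu> E W"
  have fW: "finite W" using W(1) finite_subset[OF _ finite_nodes] by blast
  then have p: "?p > 0" using W by (simp add: card_gt_0_iff)
  have "\<forall>e\<in>?I. \<exists>t. case t of (d, a, b) \<Rightarrow> e = {d, a, b} \<and> c a = c b \<and> c d \<noteq> c a \<and> a \<noteq> b"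
  proof
    fix e assume "e \<in> ?I"
    then have "card e = 3" "\<not> answer c e" using sparse_edge[OF sp] c by (auto simp: inside_def proper_def)
    from card_3_nonmono[OF this] show "\<exists>t. case t of (d, a, b) \<Rightarrow> e = {d, a, b} \<and> c a = c b \<and> c d \<noteq> c a \<and> a \<noteq> b"
      by auto
  qed
  from bchoice[OF this] obtain t where t0: "\<forall>e\<in>?I. case t e of (d, a, b) \<Rightarrow> e = {d, a, b} \<and> c a = c b \<and> c d \<noteq> c a \<and> a \<noteq> b" ..
  define \<tau> where "\<tau> e = (case t e of (d, a, b) \<Rightarrow> (\<nu> d, \<nu> a, \<nu> b))" for e
  let ?F = "\<tau> ` ?I"
  have t: "\<exists>d a b. e = {d, a, b} \<and> c a = c b \<and> c d \<noteq> c a \<and> \<nu> a \<noteq> \<nu> b \<and> \<tau> e = (\<nu> d, \<nu> a, \<nu> b)" if "e \<in> ?I" for e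
  proof -
    obtain d a b where tt: "t e = (d, a, b)" by (cases "t e")
    then have "e = {d, a, b} \<and> c a = c b \<and> c d \<noteq> c a \<and> a \<noteq> b" using t0 that by fastforce
    moreover from this have "\<nu> a \<noteq> \<nu> b" using sparse_edge(3)[OF sp, of e] that
      by (auto simp: inside_def dest: inj_onD)
    ultimately show ?thesis using tt by (auto simp: \<tau>_def)
  qed
  have fE: "finite (inside \<nu> E S)" for S using sparse_finite[OF sp] by (auto simp: inside_def)
  have "\<exists>r::nat \<Rightarrow> real. inj_on r W \<and> (\<forall>(l, b, d)\<in>?F. {l, b, d} \<subseteq> W \<longrightarrow>
    r b < r l \<and> r l < r d \<or> r d < r l \<and> r l < r b)"
  proof (rule between_order[OF fW])
    show "finite ?F" using fE by simp
    show "b \<noteq> d" if "(l, b, d) \<in> ?F" for l b d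
    proof -
      from that obtain e where "e \<in> ?I" "\<tau> e = (l, b, d)" by auto
      then show ?thesis using t[of e] by auto
    qed
    fix S assume S: "S \<subseteq> W" "2 \<le> card S"
    have "{(l, b, d) \<in> ?F. {l, b, d} \<subseteq> S} \<subseteq> \<tau> ` inside \<nu> E S"
    proof
      fix z assume z: "z \<in> {(l, b, d) \<in> ?F. {l, b, d} \<subseteq> S}"
      then obtain e where e: "e \<in> ?I" "z = \<tau> e" by auto
      from t[OF e(1)] obtain d a b where "e = {d, a, b}" "\<tau> e = (\<nu> d, \<nu> a, \<nu> b)" by blast
      then have "e \<in> inside \<nu> E S" using z e by (auto simp: inside_def)
      then show "z \<in> \<tau> ` inside \<nu> E S" using e by blast
    qed
    then have "card {(l, b, d) \<in> ?F. {l, b, d} \<subseteq> S} \<le> card (inside \<nu> E S)"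
      using fE surj_card_le by blast
    moreover have "excess \<nu> E S \<le> - 2" using sparse_excess[OF sp _ S(2)] S(1) W by blast
    ultimately show "card {(l, b, d) \<in> ?F. {l, b, d} \<subseteq> S} + 2 \<le> card S"
      by (simp add: excess_def)
  qed
  then obtain r :: "nat \<Rightarrow> real" where r: "inj_on r W" and btw0: "\<forall>(l, b, d)\<in>?F. {l, b, d} \<subseteq> W \<longrightarrow>
    r b < r l \<and> r l < r d \<or> r d < r l \<and> r l < r b" by blast
  from strict_enumeration[OF fW r] obtain h0 where h0: "bij_betw h0 {..<?p} W"
    "\<And>i j. i < j \<Longrightarrow> j < ?p \<Longrightarrow> r (h0 i) < r (h0 j)" by blast
  \<comment> \<open>The order is continued periodically: after \<open>card W\<close> flips the
    coloring is complemented on \<open>W\<close>, which keeps it proper, so the same order works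
    again.\<close>
  define h where "h i = h0 (i mod ?p)" for i
  define C where "C = rec_nat c (\<lambda>i. flp \<nu> {h i})"
  have C0: "C 0 = c" and CS: "C (Suc i) = flp \<nu> {h i} (C i)" for i by (auto simp: C_def)
  have hh: "h i = h0 i" if "i < ?p" for i using that by (simp add: h_def)
  have inj: "inj_on h0 {..<?p}" and im: "h0 ` {..<?p} = W" using h0(1) by (auto simp: bij_betw_def)
  have Ci: "C i = flp \<nu> (h0 ` {..<i}) c" if "i \<le> ?p" for i
    using that
  proof (induction i)
    case 0
    then show ?case by (auto simp: C0 flp_def)
  next
    case (Suc i)
    have "h0 i \<noteq> h0 j" if "j < i" for j using inj_onD[OF inj, of i j] Suc.prems that by auto
    then have "h0 i \<notin> h0 ` {..<i}" by auto
    then show ?case using Suc CS hh by (simp add: flp_insert lessThan_Suc)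
  qed
  have pr1: "proper ?I (C i)" if i: "i \<le> ?p" for i
    unfolding proper_def Ci[OF i]
  proof
    fix e assume e: "e \<in> ?I"
    from t[OF e] obtain d a b where dab: "e = {d, a, b}" "c a = c b" "c d \<noteq> c a" "\<tau> e = (\<nu> d, \<nu> a, \<nu> b)" by blast
    have sub: "{\<nu> d, \<nu> a, \<nu> b} \<subseteq> W" using e dab by (auto simp: inside_def)
    have "(\<nu> d, \<nu> a, \<nu> b) \<in> ?F" using dab(4) e by (metis imageI)
    from bspec[OF btw0 this] sub have bt:
      "r (\<nu> a) < r (\<nu> d) \<and> r (\<nu> d) < r (\<nu> b) \<or> r (\<nu> b) < r (\<nu> d) \<and> r (\<nu> d) < r (\<nu> a)" by simp
    have down: "u \<in> h0 ` {..<i}" if uv: "u \<in> W" "v \<in> h0 ` {..<i}" "r u < r v" for u v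
    proof -
      have "u \<in> h0 ` {..<?p}" using uv(1) im by simp
      then obtain j where j: "j < ?p" "u = h0 j" by blast
      obtain k where k: "k < i" "v = h0 k" using uv(2) by blast
      have "j < k" using h0(2)[of k j] j k uv(3) by (metis less_asym linorder_neqE_nat)
      then show ?thesis using j k by auto
    qed
    from bt show "\<not> answer (flp \<nu> (h0 ` {..<i}) c) e"
    proof
      assume "r (\<nu> a) < r (\<nu> d) \<and> r (\<nu> d) < r (\<nu> b)"
      then have "\<nu> b \<in> h0 ` {..<i} \<Longrightarrow> \<nu> d \<in> h0 ` {..<i}" "\<nu> d \<in> h0 ` {..<i} \<Longrightarrow> \<nu> a \<in> h0 ` {..<i}"
        using down sub by auto
      then have "flp \<nu> (h0 ` {..<i}) c a \<noteq> flp \<nu> (h0 ` {..<i}) c b \<or> flp \<nu> (h0 ` {..<i}) c a \<noteq> flp \<nu> (h0 ` {..<i}) c d"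
        using dab(2,3) unfolding flp_def by metis
      then show ?thesis using dab(1) by (auto simp: answer_def)
    next
      assume "r (\<nu> b) < r (\<nu> d) \<and> r (\<nu> d) < r (\<nu> a)"
      then have "\<nu> a \<in> h0 ` {..<i} \<Longrightarrow> \<nu> d \<in> h0 ` {..<i}" "\<nu> d \<in> h0 ` {..<i} \<Longrightarrow> \<nu> b \<in> h0 ` {..<i}"
        using down sub by auto
      then have "flp \<nu> (h0 ` {..<i}) c a \<noteq> flp \<nu> (h0 ` {..<i}) c b \<or> flp \<nu> (h0 ` {..<i}) c a \<noteq> flp \<nu> (h0 ` {..<i}) c d"
        using dab(2,3) unfolding flp_def by metis
      then show ?thesis using dab(1) by (auto simp: answer_def)
    qed
  qed
  have hp: "h (i + ?p) = h i" for i by (simp add: h_def)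
  have Cp: "C (i + ?p) = flp \<nu> W (C i)" for i
  proof (induction i)
    case 0
    then show ?case using Ci[of ?p] im C0 by simp
  next
    case (Suc i)
    then show ?case using CS hp by (simp add: flp_commute)
  qed
  have pr: "proper ?I (C i)" for i
  proof (induction i rule: less_induct)
    case (less i)
    show ?case
    proof (cases "i \<le> ?p")
      case False
      then have "C i = flp \<nu> W (C (i - ?p))" using Cp[of "i - ?p"] by simp
      then show ?thesis using less[of "i - ?p"] p False proper_flp_all by simp
    qed (use pr1 in simp)
  qed
  have bij: "bij_betw h {..<?p} W" using h0(1) bij_betw_cong[of "{..<?p}" h0 h W] hh by auto
  have hW: "h i \<in> W" for i using im p by (auto simp: h_def)
  show ?thesis by (rule that[OF C0 CS pr Cp hp bij hW])
qed

section \<open>Weights and contraction\<close>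

lemma wt_flp: "wt \<nu> U (flp \<nu> X c) = wt \<nu> U c - 2 * wt \<nu> (U \<inter> X) c"
proof -
  have "wt \<nu> U (flp \<nu> X c) = (\<Sum>b | b < n \<and> \<nu> b \<in> U. val (c b) - (if \<nu> b \<in> X then 2 * val (c b) else 0))"
    unfolding wt_def by (intro sum.cong) (auto simp: flp_def val_def)
  also have "\<dots> = wt \<nu> U c - (\<Sum>b | b < n \<and> \<nu> b \<in> U. if \<nu> b \<in> X then 2 * val (c b) else 0)"
    by (simp add: sum_subtractf wt_def)
  also have "(\<Sum>b | b < n \<and> \<nu> b \<in> U. if \<nu> b \<in> X then 2 * val (c b) else 0) =
      (\<Sum>b \<in> {b \<in> {b. b < n \<and> \<nu> b \<in> U}. \<nu> b \<in> X}. 2 * val (c b))"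
    by (rule sum.inter_filter[symmetric]) auto
  also have "{b \<in> {b. b < n \<and> \<nu> b \<in> U}. \<nu> b \<in> X} = {b. b < n \<and> \<nu> b \<in> U \<inter> X}" by auto
  finally show ?thesis by (simp add: wt_def sum_distrib_left)
qed

lemma wt_Un:
  assumes "U \<inter> X = {}"
  shows "wt \<nu> (U \<union> X) c = wt \<nu> U c + wt \<nu> X c"
proof -
  have "{b. b < n \<and> \<nu> b \<in> U \<union> X} = {b. b < n \<and> \<nu> b \<in> U} \<union> {b. b < n \<and> \<nu> b \<in> X}" by auto
  then show ?thesis unfolding wt_def by (simp only:) (rule sum.union_disjoint, use assms in auto)
qed

lemma wt_Diff:
  assumes "X \<subseteq> U"
  shows "wt \<nu> (U - X) c = wt \<nu> U c - wt \<nu> X c"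
proof -
  have "(U - X) \<union> X = U" using assms by blast
  moreover have "(U - X) \<inter> X = {}" by blast
  ultimately show ?thesis using wt_Un[of "U - X" X \<nu> c] by simp
qed

lemma wt_cong: "(\<And>b. b < n \<Longrightarrow> \<nu> b \<in> U \<Longrightarrow> c b = c' b) \<Longrightarrow> wt \<nu> U c = wt \<nu> U c'"
  unfolding wt_def by (intro sum.cong) auto

lemma wt_compl: "(\<And>b. b < n \<Longrightarrow> \<nu> b \<in> U \<Longrightarrow> c b = (\<not> c' b)) \<Longrightarrow> wt \<nu> U c = - wt \<nu> U c'"
  unfolding wt_def sum_negf[symmetric] by (intro sum.cong) (auto simp: val_def)

lemma wt_empty [simp]: "wt \<nu> {} c = 0"
  by (simp add: wt_def)

lemma wt_parity: "even (wt \<nu> U c) \<longleftrightarrow> even (wt \<nu> U c')"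
proof -
  have "even (wt \<nu> U c - wt \<nu> U c')"
    unfolding wt_def sum_subtractf[symmetric] by (intro dvd_sum) (auto simp: val_def)
  then show ?thesis by simp
qed

lemma wt_nodes: "wt \<nu> (nodes \<nu>) c = total c"
proof -
  have "{b. b < n \<and> \<nu> b \<in> nodes \<nu>} = {..<n}" by (auto simp: nodes_def)
  then show ?thesis by (simp add: wt_def total_def)
qed

lemma total_parity: "even (total c) \<longleftrightarrow> even n"
proof -
  have "total (\<lambda>_. True) = int n" by (simp add: total_def val_def)
  then show ?thesis using wt_parity[of id "nodes id" c "\<lambda>_. True"] by (simp add: wt_nodes)
qed

lemma total_flp_nodes: "total (flp \<nu> (nodes \<nu>) c) = - total c"
  using wt_flp[of \<nu> "nodes \<nu>" "nodes \<nu>" c] by (simp add: wt_nodes)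

lemma single_less:
  assumes "single \<nu> v" "v \<in> nodes \<nu>"
  shows "v < n"
proof -
  obtain b where "b < n" "\<nu> b = v" using assms(2) by (auto simp: nodes_def)
  then show ?thesis using assms(1) by (auto simp: single_def)
qed

lemma wt_single:
  assumes "single \<nu> v" "v \<in> nodes \<nu>"
  shows "wt \<nu> {v} c = val (c v)"
proof -
  have "{b. b < n \<and> \<nu> b \<in> {v}} = {v}" using assms single_less[OF assms] by (auto simp: single_def)
  then show ?thesis by (simp add: wt_def)
qed

lemma wt_sig_abs:
  assumes "c \<in> sig \<nu> g" "c' \<in> sig \<nu> g"
  shows "\<bar>wt \<nu> {v} c\<bar> = \<bar>wt \<nu> {v} c'\<bar>"
  using sig_cases[OF assms, of v] wt_cong[of \<nu> "{v}" c' c] wt_compl[of \<nu> "{v}" c' c] by auto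

lemma wt_sig_same:
  assumes "c \<in> sig \<nu> g" "c' \<in> sig \<nu> g" "c a = c' a"
  shows "wt \<nu> {\<nu> a} c = wt \<nu> {\<nu> a} c'"
  using sig_cases[OF assms(1,2), of "\<nu> a"] assms(3) wt_cong[of \<nu> "{\<nu> a}" c' c] by auto

lemma cols_flp_nodes:
  assumes "sparse \<nu> E" "c \<in> cols \<nu> g E"
  shows "flp \<nu> (nodes \<nu>) c \<in> cols \<nu> g E"
  using assms proper_flp_all[of \<nu> E "nodes \<nu>" c] by (auto simp: cols_def inside_nodes flp_sig)

text \<open>A rotation flips the node of \<open>a\<close> at some step and leaves that of
  \<open>b\<close> alone, so \<open>e\<close> cannot be monochromatic both before and after this
  step.\<close>

lemma nonmono_exists:
  assumes sp: "sparse \<nu> E" and c: "c \<in> cols \<nu> g E" and e: "e \<subseteq> {..<n}" "card (\<nu> ` e) \<ge> 2"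
  shows "\<exists>c'\<in>cols \<nu> g E. \<not> answer c' e"
proof -
  have "\<not> (\<forall>x\<in>\<nu> ` e. \<forall>y\<in>\<nu> ` e. x = y)"
    using e card_le_Suc0_iff_eq[of "\<nu> ` e"] finite_subset[OF e(1)] by auto
  then obtain a b where ab: "a \<in> e" "b \<in> e" "\<nu> a \<noteq> \<nu> b" by blast
  have V: "nodes \<nu> \<noteq> {}" "\<nu> a \<in> nodes \<nu>" using ab e by (auto simp: nodes_def)
  have "proper (inside \<nu> E (nodes \<nu>)) c" using c sp by (simp add: inside_nodes cols_def)
  from rotation[OF sp subset_refl V(1) this] obtain C h where C: "C 0 = c" "\<And>i. C (Suc i) = flp \<nu> {h i} (C i)"
    "\<And>i. proper (inside \<nu> E (nodes \<nu>)) (C i)" "bij_betw h {..<card (nodes \<nu>)} (nodes \<nu>)" by metis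
  have "C i \<in> cols \<nu> g E" for i
  proof -
    have "C i \<in> sig \<nu> g" using c C(1,2) by (induction i) (auto simp: flp_sig cols_def)
    then show ?thesis using C(3) sp by (simp add: cols_def inside_nodes)
  qed
  moreover obtain i where "h i = \<nu> a" using C(4) V(2) by (metis bij_betw_def imageE)
  then have "C (Suc i) a = (\<not> C i a)" "C (Suc i) b = C i b" using C(2)[of i] ab(3) by (auto simp: flp_def)
  then have "\<not> answer (C i) e \<or> \<not> answer (C (Suc i)) e" using ab by (auto simp: answer_def)
  ultimately show ?thesis by blast
qed

lemma colorable:
  assumes "sparse \<nu> E"
  shows "\<exists>c. c \<in> cols \<nu> g E"
proof -
  have "finite E" using assms by (rule sparse_finite)
  then show ?thesis using assms
  proof (induction E rule: finite_induct)
    case empty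
    then show ?case using sig_refl by (auto simp: cols_def proper_def)
  next
    case (insert e E)
    have sp: "sparse \<nu> E" using insert.prems by (rule sparse_subset) auto
    with insert.IH obtain c where "c \<in> cols \<nu> g E" by blast
    moreover have "e \<subseteq> {..<n}" "card (\<nu> ` e) \<ge> 2"
      using sparse_edge[OF insert.prems, of e] by auto
    ultimately obtain c' where "c' \<in> cols \<nu> g E" "\<not> answer c' e" using nonmono_exists[OF sp] by blast
    then show ?case by (intro exI[of _ c']) (auto simp: cols_def proper_def)
  qed
qed

text \<open>No edge contains both \<open>u\<close> and \<open>v\<close>: it would be monochromatic after both flips.\<close>

lemma proper_swap_flips:
  assumes sp: "sparse \<nu> E" "F \<subseteq> E" and uv: "single \<nu> u" "single \<nu> v" "u \<noteq> v" "c u = c v"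
    and pr: "proper F c" "proper F (flp \<nu> {u} c)" "proper F (flp \<nu> {v} (flp \<nu> {u} c))"
  shows "proper F (flp \<nu> {v} c)"
  unfolding proper_def
proof
  fix e assume e: "e \<in> F"
  have na: "\<not> answer c e" "\<not> answer (flp \<nu> {u} c) e" "\<not> answer (flp \<nu> {v} (flp \<nu> {u} c)) e"
    using pr e by (auto simp: proper_def)
  have sing: "\<nu> b = u \<longleftrightarrow> b = u" "\<nu> b = v \<longleftrightarrow> b = v" for b using uv by (auto simp: single_def)
  consider "v \<notin> e" | "v \<in> e" "u \<notin> e" | "u \<in> e" "v \<in> e" by blast
  then show "\<not> answer (flp \<nu> {v} c) e"
  proof cases
    case 1
    then have "answer (flp \<nu> {v} c) e = answer c e" by (intro answer_cong) (auto simp: flp_def sing)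
    then show ?thesis using na by simp
  next
    case 2
    then have "answer (flp \<nu> {v} c) e = answer (flp \<nu> {v} (flp \<nu> {u} c)) e"
      by (intro answer_cong) (auto simp: flp_def sing)
    then show ?thesis using na by simp
  next
    case 3
    have "card e = 3" using sparse_edge(2)[OF sp(1)] sp(2) e by blast
    then have "card (e - {u, v}) = 1" using 3 uv(3) by (subst card_Diff_subset) auto
    then obtain w where "e - {u, v} = {w}" by (auto simp: card_1_singleton_iff)
    then have w: "e = {u, v, w}" "w \<noteq> u" "w \<noteq> v" using 3 by auto
    then have "c w \<noteq> c u" using na(1) uv(4) by (auto simp: answer_def)
    then have False using na(3) w uv by (auto simp: answer_def flp_def sing)
    then show ?thesis ..
  qed
qed

lemma nodes_mrg: "X \<subseteq> nodes \<nu> \<Longrightarrow> x \<in> X \<Longrightarrow> nodes (mrg X x \<nu>) = insert x (nodes \<nu> - X)"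
  by (auto simp: nodes_def mrg_def)

lemma card_nodes_mrg:
  assumes "X \<subseteq> nodes \<nu>" "x \<in> X"
  shows "card (nodes (mrg X x \<nu>)) + card X = Suc (card (nodes \<nu>))"
proof -
  have fX: "finite X" using assms finite_subset[OF _ finite_nodes] by blast
  have "card (nodes (mrg X x \<nu>)) = Suc (card (nodes \<nu> - X))"
    unfolding nodes_mrg[OF assms] using assms by (subst card_insert_disjoint) auto
  also have "card (nodes \<nu> - X) = card (nodes \<nu>) - card X" using assms fX by (simp add: card_Diff_subset)
  finally show ?thesis using card_mono[OF finite_nodes assms(1)] by simp
qed

lemma wt_mrg_merged: "x \<in> X \<Longrightarrow> wt (mrg X x \<nu>) {x} c = wt \<nu> X c"
  unfolding wt_def by (intro sum.cong) (auto simp: mrg_def)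

lemma wt_mrg_other: "x \<in> X \<Longrightarrow> U \<inter> X = {} \<Longrightarrow> wt (mrg X x \<nu>) U c = wt \<nu> U c"
  unfolding wt_def by (intro sum.cong) (auto simp: mrg_def)

text \<open>An edge that survives inside \<open>Z\<close> lies in \<open>Z \<union> W\<close> but
  not in \<open>W\<close>; the term \<open>card (Z \<inter> W)\<close> is inclusion-exclusion for
  the sizes.\<close>

lemma merge_excess:
  assumes "finite E" "finite Z" "finite W" "X \<subseteq> W"
  shows "excess (mrg X x \<nu>) (E - inside \<nu> E W) Z \<le> excess \<nu> E (Z \<union> W) - excess \<nu> E W - int (card (Z \<inter> W))"
proof -
  let ?I = "inside (mrg X x \<nu>) (E - inside \<nu> E W) Z"
  have fin: "finite (inside \<nu> E U)" for U using assms(1) by (simp add: inside_def)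
  have "\<nu> b \<in> Z \<union> W" if "mrg X x \<nu> b \<in> Z" for b using that assms(4) by (auto simp: mrg_def split: if_splits)
  then have sub: "?I \<subseteq> inside \<nu> E (Z \<union> W) - inside \<nu> E W" unfolding inside_def by blast
  have "inside \<nu> E W \<subseteq> inside \<nu> E (Z \<union> W)" by (rule inside_mono) auto
  then have "card (inside \<nu> E (Z \<union> W) - inside \<nu> E W) = card (inside \<nu> E (Z \<union> W)) - card (inside \<nu> E W)"
    "card (inside \<nu> E W) \<le> card (inside \<nu> E (Z \<union> W))" using fin by (auto simp: card_Diff_subset intro: card_mono)
  then have "card ?I + card (inside \<nu> E W) \<le> card (inside \<nu> E (Z \<union> W))"
    using card_mono[OF _ sub] fin by simp
  moreover have "card Z + card W = card (Z \<union> W) + card (Z \<inter> W)" using assms by (intro card_Un_Int) auto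
  ultimately show ?thesis by (simp add: excess_def)
qed

lemma merge_excess_other:
  assumes "finite E" "x \<notin> Z"
  shows "excess (mrg X x \<nu>) (E - F) Z \<le> excess \<nu> E Z"
proof -
  have "\<nu> b \<in> Z" if "mrg X x \<nu> b \<in> Z" for b using that assms(2) by (auto simp: mrg_def split: if_splits)
  then have "inside (mrg X x \<nu>) (E - F) Z \<subseteq> inside \<nu> E Z" unfolding inside_def by blast
  then show ?thesis unfolding excess_def using card_mono[of "inside \<nu> E Z"] assms(1) by (simp add: inside_def)
qed

text \<open>Strictness means that \<open>W\<close> cannot grow even at equal excess. This is what
  lets a contraction inside \<open>W\<close> preserve sparsity.\<close>

definition strict_max :: "(nat \<Rightarrow> nat) \<Rightarrow> nat set set \<Rightarrow> nat set \<Rightarrow> bool" where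
  "strict_max \<nu> E W \<longleftrightarrow> W \<subseteq> nodes \<nu> \<and> (\<forall>U. W \<subset> U \<longrightarrow> U \<subseteq> nodes \<nu> \<longrightarrow> excess \<nu> E U < excess \<nu> E W)"

text \<open>For \<open>Z\<close> through the new node: if \<open>Z\<close> lies in \<open>W\<close>,
  its excess is at most \<open>- card Z\<close>; otherwise passing from \<open>W\<close> to
  \<open>Z \<union> W\<close> loses 1 by strict maximality, and the new node in
  \<open>Z \<inter> W\<close> loses 1 more. \<open>X\<close> may be smaller than \<open>W\<close>,
  so that some nodes of \<open>W\<close> stay free.\<close>

lemma merge_sparse:
  assumes sp: "sparse \<nu> E" and W: "strict_max \<nu> E W" and X: "X \<subseteq> W" "x \<in> X"
  shows "sparse (mrg X x \<nu>) (E - inside \<nu> E W)"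
  unfolding sparse_def
proof (intro conjI ballI allI impI)
  have WV: "W \<subseteq> nodes \<nu>" and mx: "\<And>U. W \<subset> U \<Longrightarrow> U \<subseteq> nodes \<nu> \<Longrightarrow> excess \<nu> E U < excess \<nu> E W"
    using W by (auto simp: strict_max_def)
  have fW: "finite W" using WV finite_subset[OF _ finite_nodes] by blast
  have fE: "finite E" using sp by (rule sparse_finite)
  then have fI: "finite (inside \<nu> E U)" for U by (simp add: inside_def)
  show "finite (E - inside \<nu> E W)" using fE by simp
  fix e assume e: "e \<in> E - inside \<nu> E W"
  note ee = sparse_edge[OF sp, of e]
  show "e \<subseteq> {..<n}" "card e = 3" using ee e by auto
  \<comment> \<open>An edge with two nodes in \<open>W\<close> could be added together with its
    third node at no loss of excess, against strict maximality.\<close>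
  have one: "a = b" if ab: "a \<in> e" "b \<in> e" "\<nu> a \<in> W" "\<nu> b \<in> W" for a b
  proof (rule ccontr)
    assume "a \<noteq> b"
    then have "card (e - {a, b}) = 1" using ab ee(2) e by (subst card_Diff_subset) auto
    then obtain d where "e - {a, b} = {d}" by (auto simp: card_1_singleton_iff)
    then have d: "e = {a, b, d}" using ab by auto
    have dW: "\<nu> d \<notin> W" using e ab d by (auto simp: inside_def)
    have dV: "\<nu> d \<in> nodes \<nu>" using ee(5) e d by auto
    have "insert e (inside \<nu> E W) \<subseteq> inside \<nu> E (insert (\<nu> d) W)" using e ab d by (auto simp: inside_def)
    then have "card (insert e (inside \<nu> E W)) \<le> card (inside \<nu> E (insert (\<nu> d) W))" using fI by (intro card_mono)
    then have "excess \<nu> E W \<le> excess \<nu> E (insert (\<nu> d) W)" using e fI fW dW by (simp add: excess_def)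
    then show False using mx[of "insert (\<nu> d) W"] dW dV WV by fastforce
  qed
  show "inj_on (mrg X x \<nu>) e"
  proof (rule inj_onI)
    fix a b assume ab: "a \<in> e" "b \<in> e" "mrg X x \<nu> a = mrg X x \<nu> b"
    then have "\<nu> a \<in> X \<longleftrightarrow> \<nu> b \<in> X" using X by (auto simp: mrg_def split: if_splits)
    then show "a = b" using ab one X(1) ee(3) e by (auto simp: mrg_def inj_on_def split: if_splits)
  qed
next
  have WV: "W \<subseteq> nodes \<nu>" and mx: "\<And>U. W \<subset> U \<Longrightarrow> U \<subseteq> nodes \<nu> \<Longrightarrow> excess \<nu> E U < excess \<nu> E W"
    using W by (auto simp: strict_max_def)
  have fW: "finite W" using WV finite_subset[OF _ finite_nodes] by blast
  have fE: "finite E" using sp by (rule sparse_finite)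
  fix Z assume Z: "Z \<subseteq> nodes (mrg X x \<nu>)" "2 \<le> card Z"
  have ZV: "Z \<subseteq> nodes \<nu>" using Z(1) nodes_mrg[of X \<nu> x] X WV by auto
  have fZ: "finite Z" using ZV finite_subset[OF _ finite_nodes] by blast
  show "excess (mrg X x \<nu>) (E - inside \<nu> E W) Z \<le> - 2"
  proof (cases "x \<in> Z")
    case False
    then show ?thesis using merge_excess_other[OF fE, of x Z X \<nu> "inside \<nu> E W"] sparse_excess[OF sp ZV Z(2)] by simp
  next
    case True
    note me = merge_excess[OF fE fZ fW X(1), of x \<nu>]
    show ?thesis
    proof (cases "Z \<subseteq> W")
      case True
      then have "Z \<union> W = W" "Z \<inter> W = Z" by auto
      then show ?thesis using me Z(2) by simp
    next
      case False
      then have "W \<subset> Z \<union> W" by blast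
      then have "excess \<nu> E (Z \<union> W) < excess \<nu> E W" using mx ZV WV by simp
      moreover have "card (Z \<inter> W) \<ge> 1" using True X fZ by (metis IntI One_nat_def Suc_leI card_gt_0_iff empty_iff finite_Int subsetD)
      ultimately show ?thesis using me by simp
    qed
  qed
qed

text \<open>The edges inside \<open>W\<close> can be forgotten once every coloring compatible with
  the contraction satisfies them.\<close>

lemma merge_cols:
  assumes "c \<in> sig \<nu> g" "\<And>c'. c' \<in> sig (mrg X x \<nu>) c \<Longrightarrow> proper (inside \<nu> E W) c'"
  shows "cols (mrg X x \<nu>) c (E - inside \<nu> E W) \<subseteq> cols \<nu> g E"
proof
  fix c' assume c': "c' \<in> cols (mrg X x \<nu>) c (E - inside \<nu> E W)"
  then have "c' \<in> sig \<nu> g" using mrg_sig_subset[OF assms(1)] by (auto simp: cols_def)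
  moreover have "proper E c'" using assms(2)[of c'] c' by (auto simp: cols_def proper_def)
  ultimately show "c' \<in> cols \<nu> g E" by (simp add: cols_def)
qed

definition psi :: "(nat \<Rightarrow> nat) \<Rightarrow> nat set set \<Rightarrow> int" where
  "psi \<nu> E = int (card (nodes \<nu>)) - int (card E)"

text \<open>For \<open>X = W\<close> of excess \<open>-2\<close> the potential drops by 1; each node
  of \<open>W\<close> left out of \<open>X\<close> raises it by 1 again.\<close>

lemma merge_psi:
  assumes "finite E" "X \<subseteq> nodes \<nu>" "x \<in> X"
  shows "psi (mrg X x \<nu>) (E - inside \<nu> E W) = psi \<nu> E + 1 + excess \<nu> E W + int (card W) - int (card X)"
proof -
  have sub: "inside \<nu> E W \<subseteq> E" by (auto simp: inside_def)
  then have "card (E - inside \<nu> E W) = card E - card (inside \<nu> E W)" "card (inside \<nu> E W) \<le> card E"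
    using assms(1) by (auto simp: card_Diff_subset finite_subset intro: card_mono)
  then show ?thesis using card_nodes_mrg[OF assms(2,3)] by (simp add: psi_def excess_def)
qed

section \<open>Intermediate values along a rotation\<close>

lemma wt_flp_single_node:
  assumes "v \<in> W"
  shows "wt \<nu> W (flp \<nu> {v} c) = wt \<nu> W c - 2 * wt \<nu> {v} c"
  using wt_flp[of \<nu> W "{v}" c] assms by (simp add: Int_absorb1)

lemma wt_flp_all:
  assumes "U \<subseteq> W"
  shows "wt \<nu> U (flp \<nu> W c) = - wt \<nu> U c"
  using assms by (intro wt_compl) (auto simp: flp_def)

text \<open>A rotation cut open at the flip of \<open>z\<close>: until the next flip of
  \<open>z\<close> its color is constant, and complementing makes it the color in \<open>c\<close>.
  The two end colorings are complementary off \<open>z\<close>, so their weights average to that of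
  \<open>z\<close>.\<close>

lemma root_path:
  assumes sp: "sparse \<nu> E" and W: "W \<subseteq> nodes \<nu>" "z \<in> W" and c: "c \<in> sig \<nu> g" "proper (inside \<nu> E W) c"
  obtains D m k where "\<And>i. i \<le> m \<Longrightarrow> D i \<in> sig \<nu> g \<and> proper (inside \<nu> E W) (D i) \<and> (\<forall>a. \<nu> a = z \<longrightarrow> D i a = c a)"
    "\<And>i. i < m \<Longrightarrow> \<exists>v\<in>W - {z}. D (Suc i) = flp \<nu> {v} (D i)" "k \<le> m" "D k = c"
    "proper (inside \<nu> E W) (flp \<nu> {z} (D 0))" "wt \<nu> W (D 0) + wt \<nu> W (D m) = 2 * wt \<nu> {z} c" "Suc m = card W"
proof -
  have "W \<noteq> {}" using W by blast
  from rotation[OF sp W(1) this c(2)] obtain C h where C: "C 0 = c" "\<And>i. C (Suc i) = flp \<nu> {h i} (C i)"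
    "\<And>i. proper (inside \<nu> E W) (C i)" "\<And>i. C (i + card W) = flp \<nu> W (C i)"
    "\<And>i. h (i + card W) = h i" "bij_betw h {..<card W} W" "\<And>i. h i \<in> W" by metis
  let ?p = "card W"
  have inj: "inj_on h {..<?p}" using C(6) by (simp add: bij_betw_def)
  obtain j where j: "j < ?p" "h j = z" using C(6) W(2) by (metis bij_betw_def imageE lessThan_iff)
  have Cs: "C i \<in> sig \<nu> g" for i using c C(1,2) by (induction i) (auto simp: flp_sig)
  define D where "D i = flp \<nu> W (C (Suc (j + i)))" for i
  define m where "m = ?p - 1"
  define k where "k = ?p - 1 - j"
  have DS: "D (Suc i) = flp \<nu> {h (Suc (j + i))} (D i)" for i
    using C(2)[of "Suc (j + i)"] by (simp add: D_def flp_commute)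
  have nz: "h (Suc (j + i)) \<in> W - {z}" if "i < m" for i
  proof -
    have "Suc (j + i) < j + ?p" using that j by (simp add: m_def)
    then have "h j \<noteq> h (Suc (j + i))" by (intro periodic_window_inj[OF C(5) inj]) auto
    then show ?thesis using C(7) j by simp
  qed
  have root0: "D i a = D 0 a" if "\<nu> a = z" "i \<le> m" for i a
    using that(2)
  proof (induction i)
    case (Suc i)
    then show ?case using DS[of i] nz[of i] that(1) by (auto simp: flp_def)
  qed simp
  have "j + k = ?p - 1" "k \<le> m" using j by (auto simp: k_def m_def)
  then have "Suc (j + k) = 0 + ?p" using j by simp
  then have Dk: "D k = c" using C(4)[of 0] C(1) by (simp add: D_def)
  have root: "D i a = c a" if "\<nu> a = z" "i \<le> m" for i a
    using root0[OF that] root0[OF that(1) \<open>k \<le> m\<close>] Dk by simp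
  have fl: "flp \<nu> {z} (D 0) = flp \<nu> W (C j)" unfolding D_def using C(2)[of j] j(2) by (simp add: flp_commute)
  have "Suc (j + m) = j + ?p" using j by (simp add: m_def)
  then have Dm: "D m = C j" unfolding D_def by (simp only: C(4) flp_flp_same)
  have "D 0 = flp \<nu> {z} (flp \<nu> W (C j))" using fl by (metis flp_flp_same)
  then have "wt \<nu> W (D 0) = - wt \<nu> W (C j) + 2 * wt \<nu> {z} (C j)"
    using wt_flp_single_node[OF W(2), of \<nu> "flp \<nu> W (C j)"] wt_flp_all[of W W \<nu> "C j"] wt_flp_all[of "{z}" W \<nu> "C j"] W(2)
    by simp
  moreover have "wt \<nu> {z} (C j) = wt \<nu> {z} c" using root[of _ m] Dm by (intro wt_cong) auto
  ultimately have sum: "wt \<nu> W (D 0) + wt \<nu> W (D m) = 2 * wt \<nu> {z} c" using Dm by simp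
  show ?thesis
  proof (rule that[of m D k])
    show "D i \<in> sig \<nu> g \<and> proper (inside \<nu> E W) (D i) \<and> (\<forall>a. \<nu> a = z \<longrightarrow> D i a = c a)" if "i \<le> m" for i
      using root[OF _ that] C(3) Cs proper_flp_all flp_sig by (auto simp: D_def)
    show "\<exists>v\<in>W - {z}. D (Suc i) = flp \<nu> {v} (D i)" if "i < m" for i using DS nz[OF that] by blast
    show "proper (inside \<nu> E W) (flp \<nu> {z} (D 0))" unfolding fl using C(3) proper_flp_all by blast
  qed (use \<open>k \<le> m\<close> Dk sum j in \<open>auto simp: m_def\<close>)
qed

lemma path_step:
  assumes "c \<in> sig \<nu> g" "\<And>v. v \<in> W - {z} \<Longrightarrow> \<bar>wt \<nu> {v} g\<bar> \<le> 1" "v \<in> W - {z}"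
  shows "\<bar>wt \<nu> W (flp \<nu> {v} c) - wt \<nu> W c\<bar> \<le> 2"
  using wt_flp_single_node[of v W \<nu> c] assms(2)[OF assms(3)] assms(3) wt_sig_abs[OF assms(1) sig_refl, of v] by auto

text \<open>The ends of the root path average to the weight of \<open>z\<close>, and
  \<open>c\<close> lies on the path, so the path has a value at most \<open>t\<close> and one at
  least \<open>t\<close>. Light nodes keep its steps at size 2.\<close>

lemma weight_attained:
  assumes sp: "sparse \<nu> E" and W: "W \<subseteq> nodes \<nu>" "z \<in> W" and c: "c \<in> sig \<nu> g" "proper (inside \<nu> E W) c"
    and wv: "\<And>v. v \<in> W - {z} \<Longrightarrow> \<bar>wt \<nu> {v} g\<bar> \<le> 1" and t: "even (wt \<nu> W c - t)"
    "wt \<nu> {z} c - 1 \<le> t \<or> wt \<nu> W c \<le> t" "t \<le> wt \<nu> {z} c + 1 \<or> t \<le> wt \<nu> W c"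
  shows "\<exists>c'\<in>sig \<nu> g. proper (inside \<nu> E W) c' \<and> (\<forall>a. \<nu> a = z \<longrightarrow> c' a = c a) \<and> wt \<nu> W c' = t"
proof (rule root_path[OF sp W c])
  fix D and m k :: nat
  assume D:
    "\<And>i. i \<le> m \<Longrightarrow> D i \<in> sig \<nu> g \<and> proper (inside \<nu> E W) (D i) \<and> (\<forall>a. \<nu> a = z \<longrightarrow> D i a = c a)"
    "\<And>i. i < m \<Longrightarrow> \<exists>v\<in>W - {z}. D (Suc i) = flp \<nu> {v} (D i)" "k \<le> m" "D k = c"
    "wt \<nu> W (D 0) + wt \<nu> W (D m) = 2 * wt \<nu> {z} c"
  let ?a = "\<lambda>i. wt \<nu> W (D i)"
  have step: "\<bar>?a (Suc i) - ?a i\<bar> \<le> 2" if "i < m" for i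
    using D(1)[of i] D(2)[OF that] path_step[OF _ wv] that by fastforce
  have par: "even (?a i - t)" for i using wt_parity[of \<nu> W "D i" c] t(1) by auto
  have "\<exists>i\<le>m. ?a i \<le> t"
  proof -
    have "?a 0 \<le> t \<or> ?a m \<le> t \<or> ?a k \<le> t"
      using even_pair_le[OF D(5) _ par par] t(2) D(4) by blast
    then show ?thesis using D(3) by blast
  qed
  moreover have "\<exists>j\<le>m. t \<le> ?a j"
  proof -
    have "t \<le> ?a 0 \<or> t \<le> ?a m \<or> t \<le> ?a k"
      using even_pair_ge[OF D(5) _ par par] t(3) D(4) by blast
    then show ?thesis using D(3) by blast
  qed
  ultimately obtain l where "l \<le> m" "?a l = t" using even_step_attained[of m ?a t] step par by blast
  then show ?thesis using D(1) by blast
qed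

text \<open>The crossing yields a free node: both colors of \<open>v\<close> are proper, and
  \<open>W - {v}\<close> has weight 0.\<close>

lemma weight_crossing:
  assumes sp: "sparse \<nu> E" and W: "W \<subseteq> nodes \<nu>" "z \<in> W" and c: "c \<in> sig \<nu> g" "proper (inside \<nu> E W) c"
    and wv: "\<And>v. v \<in> W - {z} \<Longrightarrow> \<bar>wt \<nu> {v} g\<bar> \<le> 1" and t: "odd (wt \<nu> W c)"
    "wt \<nu> {z} c \<le> 0 \<or> wt \<nu> W c < 0" "0 \<le> wt \<nu> {z} c \<or> 0 < wt \<nu> W c"
  shows "\<exists>c'\<in>sig \<nu> g. \<exists>v\<in>W - {z}. proper (inside \<nu> E W) c' \<and> proper (inside \<nu> E W) (flp \<nu> {v} c') \<and>
    wt \<nu> W c' = 1 \<and> wt \<nu> {v} c' = 1"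
proof (rule root_path[OF sp W c])
  fix D and m k :: nat
  assume D:
    "\<And>i. i \<le> m \<Longrightarrow> D i \<in> sig \<nu> g \<and> proper (inside \<nu> E W) (D i) \<and> (\<forall>a. \<nu> a = z \<longrightarrow> D i a = c a)"
    "\<And>i. i < m \<Longrightarrow> \<exists>v\<in>W - {z}. D (Suc i) = flp \<nu> {v} (D i)" "k \<le> m" "D k = c"
    "wt \<nu> W (D 0) + wt \<nu> W (D m) = 2 * wt \<nu> {z} c"
  let ?a = "\<lambda>i. wt \<nu> W (D i)"
  have step: "\<bar>?a (Suc i) - ?a i\<bar> \<le> 2" if "i < m" for i
    using D(1)[of i] D(2)[OF that] path_step[OF _ wv] that by fastforce
  have par: "odd (?a i)" for i using wt_parity[of \<nu> W "D i" c] t(1) by auto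
  have "\<exists>i\<le>m. ?a i < 0"
  proof -
    have "?a 0 < 0 \<or> ?a m < 0 \<or> ?a k < 0"
      using even_pair_le[OF D(5), of "- 1"] par[of 0] par[of m] t(2) D(4) by auto
    then show ?thesis using D(3) by blast
  qed
  moreover have "\<exists>j\<le>m. 0 < ?a j"
  proof -
    have "0 < ?a 0 \<or> 0 < ?a m \<or> 0 < ?a k"
      using even_pair_ge[OF D(5), of 1] par[of 0] par[of m] t(3) D(4) by auto
    then show ?thesis using D(3) by blast
  qed
  ultimately obtain l where l: "l < m" "?a l = 1 \<and> ?a (Suc l) = - 1 \<or> ?a l = - 1 \<and> ?a (Suc l) = 1"
    using odd_step_crossing[of m ?a] step par by blast
  from D(2)[OF l(1)] obtain v where v: "v \<in> W - {z}" "D (Suc l) = flp \<nu> {v} (D l)" by blast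
  have eq: "?a (Suc l) = ?a l - 2 * wt \<nu> {v} (D l)" using v wt_flp_single_node[of v W \<nu> "D l"] by simp
  from l(2) show ?thesis
  proof
    assume "?a l = 1 \<and> ?a (Suc l) = - 1"
    then show ?thesis using v l(1) eq D(1)[of l] D(1)[of "Suc l"] by (intro bexI[of _ "D l"] bexI[of _ v]) auto
  next
    assume a: "?a l = - 1 \<and> ?a (Suc l) = 1"
    have "flp \<nu> {v} (D (Suc l)) = D l" using v by simp
    moreover have "wt \<nu> {v} (D (Suc l)) = 1" using v(2) a eq wt_flp[of \<nu> "{v}" "{v}" "D l"] by simp
    ultimately show ?thesis using v l(1) a D(1)[of l] D(1)[of "Suc l"]
      by (intro bexI[of _ "D (Suc l)"] bexI[of _ v]) auto
  qed
qed

text \<open>Contract the block and compare the two proper colorings that differ in the contracted node.\<close>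

lemma extend_block:
  assumes sp: "sparse \<nu> E" and Y: "strict_max \<nu> E Y" "z \<in> Y" and c: "c \<in> sig \<nu> g" "proper (inside \<nu> E Y) c"
  shows "\<exists>c'\<in>cols \<nu> g E. total c' \<le> wt \<nu> Y c \<and> (\<forall>b. \<nu> b \<in> Y \<longrightarrow> c' b = c b)"
proof -
  let ?\<nu> = "mrg Y z \<nu>" and ?E = "E - inside \<nu> E Y"
  have sp': "sparse ?\<nu> ?E" by (rule merge_sparse[OF sp Y(1) subset_refl Y(2)])
  have YV: "Y \<subseteq> nodes \<nu>" using Y by (simp add: strict_max_def)
  have zV: "z \<in> nodes ?\<nu>" using nodes_mrg[OF YV Y(2)] by simp
  have sub: "cols ?\<nu> c ?E \<subseteq> cols \<nu> g E" by (rule merge_cols[OF c(1)]) (rule proper_sig_mrg[OF c(2)])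
  have mem: "?\<nu> b = z" if "\<nu> b \<in> Y" for b using that by (simp add: mrg_def)
  obtain c0 where c0: "c0 \<in> cols ?\<nu> c ?E" using colorable[OF sp'] by blast
  have "\<exists>c1\<in>cols ?\<nu> c ?E. \<forall>b. \<nu> b \<in> Y \<longrightarrow> c1 b = c b"
  proof -
    have "c0 \<in> sig ?\<nu> c" using c0 by (simp add: cols_def)
    from sig_mrg_cases[OF this] show ?thesis
    proof
      assume "\<forall>b. \<nu> b \<in> Y \<longrightarrow> c0 b = (\<not> c b)"
      then show ?thesis using cols_flp_nodes[OF sp' c0] mem zV
        by (intro bexI[of _ "flp ?\<nu> (nodes ?\<nu>) c0"]) (auto simp: flp_def)
    qed (use c0 in blast)
  qed
  then obtain c1 where c1: "c1 \<in> cols ?\<nu> c ?E" "\<And>b. \<nu> b \<in> Y \<Longrightarrow> c1 b = c b" by blast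
  have c1': "c1 \<in> sig ?\<nu> c" "proper (inside ?\<nu> ?E (nodes ?\<nu>)) c1" using c1(1) sp' by (auto simp: cols_def inside_nodes)
  show ?thesis
  proof (rule root_path[OF sp' subset_refl zV c1'])
    fix D and m :: nat
    assume D: "\<And>i. i \<le> m \<Longrightarrow> D i \<in> sig ?\<nu> c \<and> proper (inside ?\<nu> ?E (nodes ?\<nu>)) (D i) \<and> (\<forall>a. ?\<nu> a = z \<longrightarrow> D i a = c1 a)"
      and sum: "wt ?\<nu> (nodes ?\<nu>) (D 0) + wt ?\<nu> (nodes ?\<nu>) (D m) = 2 * wt ?\<nu> {z} c1"
    have "wt ?\<nu> {z} c1 = wt \<nu> Y c" using wt_mrg_merged[OF Y(2), of \<nu> c1] wt_cong[of \<nu> Y c1 c] c1(2) by simp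
    then have "total (D 0) \<le> wt \<nu> Y c \<or> total (D m) \<le> wt \<nu> Y c" using sum by (auto simp: wt_nodes)
    moreover have Dc: "D i \<in> cols \<nu> g E \<and> (\<forall>b. \<nu> b \<in> Y \<longrightarrow> D i b = c b)" if "i \<le> m" for i
    proof -
      have "D i \<in> cols ?\<nu> c ?E" using D[OF that] sp' by (simp add: cols_def inside_nodes)
      then show ?thesis using sub D[OF that] mem c1(2) by auto
    qed
    ultimately show ?thesis using Dc[OF order_refl] Dc[OF le0] by metis
  qed
qed

text \<open>The weight along a rotation passes straight through 0 at two consecutive flips of balls
  \<open>u\<close>, \<open>v\<close> of equal color, so the rest has weight 0. The two flips can be
  exchanged, so all four colorings of \<open>u\<close> and \<open>v\<close> are proper.\<close>

lemma two_free_singles: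
  assumes sp: "sparse \<nu> E" and W: "W \<subseteq> nodes \<nu>" "W \<noteq> {}" "\<And>v. v \<in> W \<Longrightarrow> single \<nu> v"
    and ev: "even (wt \<nu> W g)"
  shows "\<exists>u v c. u \<in> W \<and> v \<in> W \<and> u \<noteq> v \<and> c \<in> sig \<nu> g \<and> proper (inside \<nu> E W) c \<and> proper (inside \<nu> E W) (flp \<nu> {u} c) \<and>
    proper (inside \<nu> E W) (flp \<nu> {v} c) \<and> proper (inside \<nu> E W) (flp \<nu> {v} (flp \<nu> {u} c)) \<and> wt \<nu> (W - {u, v}) c = 0"
proof -
  let ?I = "inside \<nu> E W"
  obtain c0 where c0: "c0 \<in> cols \<nu> g E" using colorable[OF sp] by blast
  have "?I \<subseteq> E" by (auto simp: inside_def)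
  then have "proper ?I c0" using c0 by (auto simp: cols_def intro: proper_mono)
  from rotation[OF sp W(1,2) this] obtain C h where C: "C 0 = c0" "\<And>i. C (Suc i) = flp \<nu> {h i} (C i)"
    "\<And>i. proper ?I (C i)" "\<And>i. C (i + card W) = flp \<nu> W (C i)"
    "\<And>i. h (i + card W) = h i" "bij_betw h {..<card W} W" "\<And>i. h i \<in> W" by metis
  have Cs: "C i \<in> sig \<nu> g" for i using c0 C(1,2) by (induction i) (auto simp: flp_sig cols_def)
  define a where "a i = wt \<nu> W (C i)" for i
  have wh: "wt \<nu> {h i} c = val (c (h i))" for i c using W C(7)[of i] by (intro wt_single) auto
  have step: "a (Suc i) = a i - 2 * val (C i (h i))" for i
    unfolding a_def using C(2)[of i] wt_flp_single_node[OF C(7), of \<nu> i "C i"] wh by simp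
  have "\<exists>i s. (s = 1 \<or> s = - 1) \<and> a i = 2 * s \<and> a (Suc i) = 0 \<and> a (Suc (Suc i)) = - 2 * s"
  proof (rule straight_crossing_through_zero)
    show "a (Suc i) = a i + 2 \<or> a (Suc i) = a i - 2" for i using step[of i] val_cases[of "C i (h i)"] by auto
    show "even (a i)" for i using wt_parity[of \<nu> W "C i" g] ev by (simp add: a_def)
    show "a (i + card W) = - a i" for i using C(4) wt_flp_all[of W W] by (simp add: a_def)
  qed
  then obtain i s where i: "s = 1 \<or> s = - 1" "a i = 2 * s" "a (Suc i) = 0" "a (Suc (Suc i)) = - 2 * s" by blast
  let ?u = "h i" and ?v = "h (Suc i)" and ?c = "C i"
  have u: "val (?c ?u) = s" using step[of i] i by simp
  have v: "val (C (Suc i) ?v) = s" using step[of "Suc i"] i by simp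
  have sing: "single \<nu> ?u" "single \<nu> ?v" using W(3) C(7) by auto
  have CS: "C (Suc i) b = (if b = ?u then \<not> ?c b else ?c b)" for b
    using C(2)[of i] sing by (auto simp: flp_def single_def)
  have ne: "?u \<noteq> ?v"
  proof
    assume "?u = ?v"
    then have "val (C (Suc i) ?v) = - val (?c ?u)" using CS by simp
    then show False using u v i(1) by auto
  qed
  have same: "?c ?u = ?c ?v" using u v CS[of ?v] ne by (metis val_eq_iff)
  have pr: "proper ?I (flp \<nu> {?u} ?c)" "proper ?I (flp \<nu> {?v} (flp \<nu> {?u} ?c))"
    using C(3)[of "Suc i"] C(3)[of "Suc (Suc i)"] C(2) by auto
  have pr3: "proper ?I (flp \<nu> {?v} ?c)"
    by (rule proper_swap_flips[OF sp _ sing ne same C(3) pr]) (auto simp: inside_def)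
  have "wt \<nu> (W - {?u, ?v}) ?c = wt \<nu> W ?c - wt \<nu> {?u, ?v} ?c" using C(7) by (intro wt_Diff) auto
  also have "wt \<nu> {?u, ?v} ?c = wt \<nu> {?u} ?c + wt \<nu> {?v} ?c"
    using wt_Un[of "{?u}" "{?v}" \<nu> ?c] ne by (simp add: insert_commute)
  also have "\<dots> = 2 * s" using wh u same by simp
  finally have "wt \<nu> (W - {?u, ?v}) ?c = 0" using i(2) by (simp add: a_def)
  then show ?thesis using C(3,7) Cs ne pr pr3 by blast
qed

text \<open>No single ball is a safe output. If \<open>v\<close> always had the majority color, the
  total would change sign exactly when a rotation flips \<open>v\<close>. Exchanging this flip with
  a neighboring flip of another single ball separates the two events.\<close>

lemma minority_single:
  assumes sp: "sparse \<nu> E" and z: "z \<in> nodes \<nu>" "\<bar>wt \<nu> {z} g\<bar> \<le> 1" and sing: "\<And>v. v \<in> nodes \<nu> - {z} \<Longrightarrow> single \<nu> v"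
    and "3 \<le> card (nodes \<nu>)" "odd n" and v: "v \<in> nodes \<nu> - {z}"
  shows "\<exists>c\<in>cols \<nu> g E. c v \<and> total c < 0"
proof (rule ccontr)
  assume no: "\<not> ?thesis"
  let ?V = "nodes \<nu>"
  have no1: "val (c v) * total c > 0" if c: "c \<in> cols \<nu> g E" for c
  proof -
    have od: "odd (total c)" using total_parity \<open>odd n\<close> by simp
    have vV: "v \<in> ?V" and "single \<nu> v" using v sing by auto
    then have "flp \<nu> ?V c v = (\<not> c v)" by (simp add: flp_def single_self)
    moreover have "\<not> (flp \<nu> ?V c v \<and> total (flp \<nu> ?V c) < 0)" "\<not> (c v \<and> total c < 0)"
      using no c cols_flp_nodes[OF sp c] by blast+
    ultimately have "\<not> (\<not> c v \<and> total c > 0)" "\<not> (c v \<and> total c < 0)"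
      using total_flp_nodes[of \<nu> c] by simp_all
    moreover have "total c \<noteq> 0" using od by auto
    ultimately show ?thesis by (auto simp: val_def)
  qed
  obtain c0 where c0: "c0 \<in> cols \<nu> g E" using colorable[OF sp] by blast
  then have "proper (inside \<nu> E ?V) c0" using sp by (simp add: cols_def inside_nodes)
  note pr = this
  have ne: "?V \<noteq> {}" using z by blast
  obtain C h where C: "C 0 = c0" "\<And>i. C (Suc i) = flp \<nu> {h i} (C i)"
    "\<And>i. proper (inside \<nu> E ?V) (C i)" "\<And>i. C (i + card ?V) = flp \<nu> ?V (C i)"
    "\<And>i. h (i + card ?V) = h i" "bij_betw h {..<card ?V} ?V" "\<And>i. h i \<in> ?V"
    using rotation[OF sp subset_refl ne pr] by metis
  have Cs: "C i \<in> sig \<nu> g" for i using c0 C(1,2) by (induction i) (auto simp: flp_sig cols_def)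
  have Cc: "C i \<in> cols \<nu> g E" for i using Cs C(3)[of i] sp by (simp add: cols_def inside_nodes)
  define a where "a i = total (C i)" for i
  have step: "a (Suc i) = a i - 2 * wt \<nu> {h i} (C i)" for i
    unfolding a_def using C(2)[of i] wt_flp_single_node[OF C(7), of \<nu> i "C i"] by (simp add: wt_nodes)
  have "v \<in> h ` {..<card ?V}" using C(6) v by (simp add: bij_betw_def)
  then obtain j where j: "j < card ?V" "h j = v" by auto
  \<comment> \<open>Shifted by one period, so that the flip of \<open>v\<close> has a
    predecessor.\<close>
  define i where "i = j + card ?V"
  have iv: "h i = v" "i \<ge> 1" using j C(5) by (auto simp: i_def)
  obtain k where k: "i = Suc k" using iv(2) by (cases i) auto
  have inj: "inj_on h {..<card ?V}" using C(6) by (simp add: bij_betw_def)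
  have win: "h l \<noteq> h (Suc l)" "h l \<noteq> h (Suc (Suc l))" for l
    using periodic_window_inj[of h "card ?V" l, OF C(5) inj] assms(5) by auto
  have svn: "single \<nu> v" "v \<in> ?V" using sing v by auto
  have s2: "val (C i v) = 1 \<or> val (C i v) = - 1" using val_cases by blast
  define s where "s = val (C i v)"
  have s1: "s = 1 \<or> s = - 1" using s2 by (simp add: s_def)
  have wv: "wt \<nu> {v} c = val (c v)" for c using svn by (rule wt_single)
  have CSv: "C (Suc i) v = (\<not> C i v)" using C(2)[of i] iv svn by (auto simp: flp_def single_self)
  have pos: "val (C l v) * a l > 0" for l using no1[OF Cc] by (simp add: a_def)
  have "a (Suc i) = a i - 2 * s" using step[of i] iv wv by (simp add: s_def)
  moreover have "s * a i > 0" "- s * a (Suc i) > 0" using pos[of i] pos[of "Suc i"] CSv by (auto simp: s_def)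
  ultimately have ai: "a i = s" "a (Suc i) = - s" using s1 by auto
  have keep: "C (Suc l) b = C l b" if "h l \<noteq> b" "single \<nu> b" for l b
    using C(2)[of l] that by (auto simp: flp_def single_self)
  \<comment> \<open>With at least three nodes, the root is not flipped both right before and right
    after \<open>v\<close>; the exchange is made on the side where it is not.\<close>
  show False
  proof (cases "h (Suc i) = z")
    case False
    let ?y = "h (Suc i)"
    have y: "single \<nu> ?y" "?y \<in> ?V" using sing C(7) False by auto
    have ne: "v \<noteq> ?y" using win(1)[of i] iv by simp
    have "val (C (Suc (Suc i)) v) = - s" using keep[of "Suc i" v] ne svn CSv by (simp add: s_def)
    then have "- s * a (Suc (Suc i)) > 0" using pos[of "Suc (Suc i)"] by simp
    moreover have "a (Suc (Suc i)) = - s - 2 * val (C (Suc i) ?y)" using step[of "Suc i"] ai wt_single[OF y] by simp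
    ultimately have "val (C (Suc i) ?y) = s" using s1 val_cases[of "C (Suc i) ?y"] by auto
    then have same: "C i v = C i ?y" using keep[of i ?y] y ne iv by (simp add: s_def)
    have "proper (inside \<nu> E ?V) (flp \<nu> {?y} (C i))"
      by (rule proper_swap_flips[OF sp _ svn(1) y(1) ne same C(3)]) 
        (use C(2)[of i] C(2)[of "Suc i"] C(3)[of "Suc i"] C(3)[of "Suc (Suc i)"] iv in \<open>auto simp: inside_def\<close>)
    then have "flp \<nu> {?y} (C i) \<in> cols \<nu> g E" using Cs sp by (simp add: cols_def inside_nodes flp_sig)
    from no1[OF this] have "val (flp \<nu> {?y} (C i) v) * total (flp \<nu> {?y} (C i)) > 0" .
    moreover have "flp \<nu> {?y} (C i) v = C i v" using svn ne by (auto simp: flp_def single_self)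
    moreover have "total (flp \<nu> {?y} (C i)) = - s"
      using wt_flp_single_node[OF y(2), of \<nu> "C i"] wt_single[OF y] ai same by (simp add: wt_nodes a_def s_def)
    ultimately show False using s2 by (auto simp: s_def)
  next
    case True
    let ?y = "h k"
    have nz: "?y \<noteq> z" using win(2)[of k] True k by simp
    have y: "single \<nu> ?y" "?y \<in> ?V" using sing C(7) nz by auto
    have ne: "?y \<noteq> v" using win(1)[of k] iv k by auto
    have kv: "C k v = C i v" using keep[of k v] ne svn k by simp
    then have "s * a k > 0" using pos[of k] by (simp add: s_def)
    moreover have "a k = s + 2 * val (C k ?y)" using step[of k] ai k wt_single[OF y] by simp
    ultimately have "val (C k ?y) = s" "a k = 3 * s" using s1 val_cases[of "C k ?y"] by auto
    note yk = this
    then have same: "C k ?y = C k v" using kv by (simp add: s_def)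
    have "proper (inside \<nu> E ?V) (flp \<nu> {v} (C k))"
      by (rule proper_swap_flips[OF sp _ y(1) svn(1) ne same C(3)]) 
        (use C(2)[of i] C(2)[of k] C(3)[of i] C(3)[of "Suc i"] iv k in \<open>auto simp: inside_def\<close>)
    then have "flp \<nu> {v} (C k) \<in> cols \<nu> g E" using Cs sp by (simp add: cols_def inside_nodes flp_sig)
    from no1[OF this] have "val (flp \<nu> {v} (C k) v) * total (flp \<nu> {v} (C k)) > 0" .
    moreover have "flp \<nu> {v} (C k) v = (\<not> C i v)" using svn kv by (auto simp: flp_def single_self)
    moreover have "total (flp \<nu> {v} (C k)) = s"
      using wt_flp_single_node[OF svn(2), of \<nu> "C k"] wv yk kv by (simp add: wt_nodes a_def s_def)
    ultimately show False using s2 by (auto simp: s_def)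
  qed
qed

text \<open>The freed node must leave the answer to \<open>e\<close> fixed. If this fails, then at
  every sign change of the weight the flipped node lies in \<open>e\<close> and the answer changes.
  Exchanging neighboring flips of equal color produces more sign changes; \<open>A\<close> excludes
  those that start from a monochromatic \<open>e\<close>, \<open>B\<close> the others.\<close>

lemma one_free_single:
  assumes sp: "sparse \<nu> E" and W: "W \<subseteq> nodes \<nu>" "\<And>v. v \<in> W \<Longrightarrow> single \<nu> v"
    and od: "odd (wt \<nu> W g)" and e: "e \<subseteq> W" "card e = 3"
    and c0: "c0 \<in> sig \<nu> g" "proper (inside \<nu> E W) c0"
  shows "\<exists>u c. u \<in> W \<and> c \<in> sig \<nu> g \<and> proper (inside \<nu> E W) c \<and> proper (inside \<nu> E W) (flp \<nu> {u} c) \<and>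
    wt \<nu> (W - {u}) c = 0 \<and> answer c e = answer (flp \<nu> {u} c) e"
proof (rule ccontr)
  assume no: "\<not> ?thesis"
  let ?I = "inside \<nu> E W" and ?p = "card W"
  have fW: "finite W" using W(1) finite_subset[OF _ finite_nodes] by blast
  have p3: "3 \<le> ?p" using card_mono[OF fW e(1)] e(2) by simp
  then have ne: "W \<noteq> {}" by auto
  have no_free: False if "c \<in> sig \<nu> g" "proper ?I c" "u \<in> W" "proper ?I (flp \<nu> {u} c)" "wt \<nu> W c = val (c u)"
    "u \<notin> e \<or> answer c e = answer (flp \<nu> {u} c) e" for c u
  proof -
    have su: "single \<nu> u" "u \<in> nodes \<nu>" using W that(3) by auto
    have "wt \<nu> (W - {u}) c = 0" using that(3,5) wt_Diff[of "{u}" W \<nu> c] wt_single[OF su] by simp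
    moreover have "answer c e = answer (flp \<nu> {u} c) e"
    proof (cases "u \<in> e")
      case False
      then have "\<nu> b \<noteq> u" if "b \<in> e" for b using that su by (auto simp: single_def)
      then show ?thesis by (intro answer_cong) (auto simp: flp_def)
    qed (use that(6) in blast)
    ultimately show False using no that by blast
  qed
  from rotation[OF sp W(1) ne c0(2)] obtain C h where C: "C 0 = c0" "\<And>i. C (Suc i) = flp \<nu> {h i} (C i)"
    "\<And>i. proper ?I (C i)" "\<And>i. C (i + card W) = flp \<nu> W (C i)"
    "\<And>i. h (i + card W) = h i" "bij_betw h {..<card W} W" "\<And>i. h i \<in> W" by metis
  have Cs: "C i \<in> sig \<nu> g" for i using c0 C(1,2) by (induction i) (auto simp: flp_sig)
  define a where "a i = wt \<nu> W (C i)" for i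
  have sh: "single \<nu> (h i)" for i using W C(7) by blast
  have wh: "wt \<nu> {h i} c = val (c (h i))" for i c using W C(7)[of i] by (intro wt_single) auto
  have step: "a (Suc i) = a i - 2 * val (C i (h i))" for i
    unfolding a_def using C(2)[of i] wt_flp_single_node[OF C(7), of \<nu> i "C i"] wh by simp
  have ap: "a (i + ?p) = - a i" for i using C(4) wt_flp_all[of W W] by (simp add: a_def)
  have odd: "odd (a i)" for i using wt_parity[of \<nu> W "C i" g] od by (simp add: a_def)
  have abs: "\<bar>a (Suc i) - a i\<bar> \<le> 2" for i using step[of i] val_cases[of "C i (h i)"] by auto
  have inj: "inj_on h {..<?p}" using C(6) by (simp add: bij_betw_def)
  have win: "h i \<noteq> h j" if "i < j" "j < i + ?p" for i j by (rule periodic_window_inj[OF C(5) inj that])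
  have keep: "C (Suc l) b = C l b" if "h l \<noteq> b" "single \<nu> b" for l b
    using C(2)[of l] that by (auto simp: flp_def single_self)
  have flip: "C (Suc l) (h l) = (\<not> C l (h l))" for l
    using C(2)[of l] sh by (auto simp: flp_def single_self)
  have cross: "val (C i (h i)) = a i" "h i \<in> e" "answer (C i) e \<noteq> answer (C (Suc i)) e"
    if "a (Suc i) = - a i" for i
  proof -
    show v: "val (C i (h i)) = a i" using step[of i] that by simp
    have pr: "proper ?I (flp \<nu> {h i} (C i))" using C(3)[of "Suc i"] C(2) by simp
    show "h i \<in> e" "answer (C i) e \<noteq> answer (C (Suc i)) e"
      using no_free[OF Cs C(3) C(7) pr] v C(2)[of i] by (auto simp: a_def)
  qed
  have swap: "proper ?I (flp \<nu> {h (Suc i)} (C i))" if "C i (h i) = C i (h (Suc i))" for i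
    by (rule proper_swap_flips[OF sp _ sh sh _ that C(3)])
      (use win[of i "Suc i"] p3 C(2)[of i] C(2)[of "Suc i"] C(3)[of "Suc i"] C(3)[of "Suc (Suc i)"] in \<open>auto simp: inside_def\<close>)
  \<comment> \<open>If the previous flip has the color of the crossing node, exchanging the two
    gives a crossing outside \<open>e\<close>. Otherwise the previous flip is itself a crossing in
    \<open>e\<close>, and the next flip is either a crossing at which \<open>e\<close> fails to
    become monochromatic again or the third node of \<open>e\<close>.\<close>
  have A: False if cr: "a (Suc (Suc k)) = - a (Suc k)" and mono: "answer (C (Suc k)) e" for k
  proof -
    let ?i = "Suc k"
    define s where "s = a ?i"
    have v: "val (C ?i (h ?i)) = s" and he: "h ?i \<in> e" and nm: "\<not> answer (C (Suc ?i)) e"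
      using cross[OF cr] mono by (auto simp: s_def)
    then have s: "s = 1 \<or> s = - 1" using val_cases by auto
    have ve: "val (C ?i b) = s" if "b \<in> e" for b
    proof -
      have "C ?i b = C ?i (h ?i)" using mono he that unfolding answer_def by blast
      then show ?thesis using v by simp
    qed
    have ne1: "h k \<noteq> h ?i" "h ?i \<noteq> h (Suc ?i)" "h k \<noteq> h (Suc ?i)" using win p3 by auto
    show False
    proof (cases "val (C k (h k)) = s")
      case True
      have ak: "a k = 3 * s" using step[of k] True by (simp add: s_def)
      have "val (C ?i (h k)) = - s" using flip[of k] True by simp
      then have nke: "h k \<notin> e" using ve s by force
      have "C k (h k) = C k (h ?i)" using True v keep[of k "h ?i"] ne1 sh val_eq_iff[of "C k (h k)" "C k (h ?i)"] by simp
      from swap[OF this] have pr: "proper ?I (flp \<nu> {h ?i} (C k))" .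
      have "flp \<nu> {h k} (flp \<nu> {h ?i} (C k)) = C (Suc ?i)" using C(2) by (simp add: flp_commute)
      then have pr2: "proper ?I (flp \<nu> {h k} (flp \<nu> {h ?i} (C k)))" using C(3) by simp
      have "val (C k (h ?i)) = s" using v keep[of k "h ?i"] ne1 sh by simp
      then have "wt \<nu> W (flp \<nu> {h ?i} (C k)) = s"
        using wt_flp_single_node[OF C(7), of \<nu> ?i "C k"] wh ak by (simp add: a_def)
      moreover have "flp \<nu> {h ?i} (C k) (h k) = C k (h k)" using ne1 sh by (auto simp: flp_def single_self)
      ultimately show False using no_free[OF flp_sig[OF Cs] pr C(7) pr2] nke True by simp
    next
      case False
      then have "val (C k (h k)) = - s" using s val_cases[of "C k (h k)"] by auto
      then have ak: "a k = - s" using step[of k] by (simp add: s_def)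
      then have ke: "h k \<in> e" using cross(2)[of k] by (simp add: s_def)
      let ?y = "h (Suc ?i)"
      have ai2: "a (Suc (Suc ?i)) = - s - 2 * val (C (Suc ?i) ?y)" using step[of "Suc ?i"] cr by (simp add: s_def)
      show False
      proof (cases "val (C (Suc ?i) ?y) = s")
        case False
        then have "val (C (Suc ?i) ?y) = - s" using s val_cases[of "C (Suc ?i) ?y"] by auto
        then have "a (Suc (Suc ?i)) = - a (Suc ?i)" using ai2 cr by (simp add: s_def)
        from cross(3)[OF this] have m2: "answer (C (Suc (Suc ?i))) e" using nm by blast
        have "C (Suc (Suc ?i)) (h k) = C ?i (h k)" using keep[of "Suc ?i" "h k"] keep[of ?i "h k"] ne1 sh by auto
        moreover have "C (Suc (Suc ?i)) (h ?i) = (\<not> C ?i (h ?i))" using keep[of "Suc ?i" "h ?i"] flip[of ?i] ne1 sh by auto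
        moreover have "C ?i (h k) = C ?i (h ?i)" using ve[OF ke] ve[OF he] val_eq_iff[of "C ?i (h k)" "C ?i (h ?i)"] by simp
        ultimately show False using m2 ke he unfolding answer_def by blast
      next
        case True
        then have vy: "val (C ?i ?y) = s" using keep[of ?i ?y] ne1 sh by simp
        then have "C ?i (h ?i) = C ?i ?y" using v val_eq_iff[of "C ?i (h ?i)" "C ?i ?y"] by simp
        from swap[OF this] have pr: "proper ?I (flp \<nu> {?y} (C ?i))" .
        have ye: "?y \<in> e" using no_free[OF Cs C(3) C(7) pr] vy by (auto simp: a_def s_def)
        have "finite e" using e(2) by (intro card_ge_0_finite) simp
        moreover have "card {h k, h ?i, ?y} = 3" using ne1 by simp
        ultimately have eq: "e = {h k, h ?i, ?y}" using e(2) ke he ye by (intro card_seteq[symmetric]) auto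
        \<comment> \<open>Two steps past the crossing start the weight is \<open>-3 * s\<close>, but
          one period after step \<open>k\<close> it is \<open>s\<close>. It changes sign in between
          at a node outside \<open>e\<close>, since all three nodes of \<open>e\<close> were already
          flipped in this period.\<close>
        define m where "m = k + ?p - Suc (Suc ?i)"
        let ?b = "\<lambda>l. s * a (Suc (Suc ?i) + l)"
        have km: "Suc (Suc ?i) + m = k + ?p" using p3 by (simp add: m_def)
        have "?b 0 < 0" using ai2 True s by auto
        moreover have "?b m > 0" unfolding km ap ak using s by auto
        moreover have "\<bar>?b (Suc l) - ?b l\<bar> \<le> 2" for l using abs[of "Suc (Suc ?i) + l"] s by auto
        moreover have "odd (?b l)" for l using odd[of "Suc (Suc ?i) + l"] s by auto
        ultimately obtain l where l: "l < m" "?b l = 1 \<and> ?b (Suc l) = - 1 \<or> ?b l = - 1 \<and> ?b (Suc l) = 1"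
          using odd_step_crossing[of m ?b 0 m] by blast
        then have "a (Suc (Suc (Suc ?i) + l)) = - a (Suc (Suc ?i) + l)" using s by auto
        from cross(2)[OF this] have "h (Suc (Suc ?i) + l) \<in> e" .
        moreover have "h (Suc (Suc ?i) + l) \<noteq> h k" "h (Suc (Suc ?i) + l) \<noteq> h ?i" "h (Suc (Suc ?i) + l) \<noteq> ?y"
          using win[of k "Suc (Suc ?i) + l"] win[of ?i "Suc (Suc ?i) + l"] win[of "Suc ?i" "Suc (Suc ?i) + l"] l(1) km by auto
        ultimately show False unfolding eq by blast
      qed
    qed
  qed
  \<comment> \<open>After the crossing \<open>e\<close> is monochromatic. The next flip either is a
    crossing excluded by \<open>A\<close>, or its node has the color opposite to \<open>e\<close>,
    lies outside \<open>e\<close>, and gives a crossing when moved forward.\<close>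
  have B: False if cr: "a (Suc i) = - a i" and nm: "\<not> answer (C i) e" for i
  proof -
    define s where "s = a i"
    have v: "val (C i (h i)) = s" and he: "h i \<in> e" and mono: "answer (C (Suc i)) e"
      using cross[OF cr] nm by (auto simp: s_def)
    then have s: "s = 1 \<or> s = - 1" using val_cases by auto
    let ?y = "h (Suc i)"
    have ne1: "h i \<noteq> ?y" using win p3 by auto
    have ai2: "a (Suc (Suc i)) = - s - 2 * val (C (Suc i) ?y)" using step[of "Suc i"] cr by (simp add: s_def)
    show False
    proof (cases "val (C (Suc i) ?y) = s")
      case False
      then have "val (C (Suc i) ?y) = - s" using s val_cases[of "C (Suc i) ?y"] by auto
      then show False using A[OF _ mono] ai2 cr by (simp add: s_def)
    next
      case True
      have "val (C (Suc i) (h i)) = - s" using flip[of i] v by simp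
      then have "val (C (Suc i) (h i)) \<noteq> val (C (Suc i) ?y)" using True s by linarith
      then have "C (Suc i) (h i) \<noteq> C (Suc i) ?y" by auto
      then have ye: "?y \<notin> e" using mono he unfolding answer_def by blast
      have vy: "val (C i ?y) = s" using True keep[of i ?y] ne1 sh by simp
      then have "C i (h i) = C i ?y" using v val_eq_iff[of "C i (h i)" "C i ?y"] by simp
      from swap[OF this] have pr: "proper ?I (flp \<nu> {?y} (C i))" .
      show False using no_free[OF Cs C(3) C(7) pr] vy ye by (simp add: a_def s_def)
    qed
  qed
  have "\<exists>l. a (Suc l) = - a l"
  proof -
    have "a ?p = - a 0" using ap[of 0] by simp
    then have "(a 0 < 0 \<and> 0 < a ?p) \<or> (a ?p < 0 \<and> 0 < a 0)" using odd[of 0] by (cases "a 0 = 0") auto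
    then obtain l where "a l = 1 \<and> a (Suc l) = - 1 \<or> a l = - 1 \<and> a (Suc l) = 1"
      using odd_step_crossing[of ?p a 0 ?p, OF abs odd] odd_step_crossing[of ?p a ?p 0, OF abs odd] by blast
    then show ?thesis by (intro exI[of _ l]) auto
  qed
  then obtain l where l: "a (Suc l) = - a l" by blast
  \<comment> \<open>\<open>A\<close> needs a step before the crossing, so the crossing is moved by
    one period.\<close>
  obtain q where q: "?p = Suc q" using p3 by (cases ?p) auto
  have l2: "a (Suc (Suc (l + q))) = - a (Suc (l + q))" using ap[of l] ap[of "Suc l"] l q by simp
  show False using A[OF l2] B[OF l2] by blast
qed

text \<open>\<open>key\<close> maximizes the excess first and the size second; the factor exceeds
  every possible size. Preferring larger sets in ties gives strictness.\<close>

lemma maximal_excess: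
  assumes "A \<subseteq> nodes \<nu>"
  shows "\<exists>W. A \<subseteq> W \<and> strict_max \<nu> E W \<and> (\<forall>U. A \<subseteq> U \<longrightarrow> U \<subseteq> nodes \<nu> \<longrightarrow> excess \<nu> E U \<le> excess \<nu> E W)"
proof -
  let ?S = "{U. A \<subseteq> U \<and> U \<subseteq> nodes \<nu>}" and ?N = "int (card (nodes \<nu>))"
  define key where "key U = excess \<nu> E U * (?N + 1) + int (card U)" for U
  have fS: "finite ?S" by (rule finite_subset[of _ "Pow (nodes \<nu>)"]) auto
  moreover have "?S \<noteq> {}" using assms by blast
  ultimately have "Max (key ` ?S) \<in> key ` ?S" by (intro Max_in) auto
  then obtain W where "W \<in> ?S" and key: "key W = Max (key ` ?S)" by auto
  then have W: "A \<subseteq> W" "W \<subseteq> nodes \<nu>" by auto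
  have W3: "key U \<le> key W" if "A \<subseteq> U" "U \<subseteq> nodes \<nu>" for U
    unfolding key using fS that by (intro Max_ge) auto
  have mx: "excess \<nu> E U \<le> excess \<nu> E W" if "A \<subseteq> U" "U \<subseteq> nodes \<nu>" for U
  proof (rule ccontr)
    assume "\<not> ?thesis"
    then have "(excess \<nu> E W + 1) * (?N + 1) \<le> excess \<nu> E U * (?N + 1)" by (intro mult_right_mono) auto
    moreover have "int (card W) \<le> ?N" using card_mono[OF finite_nodes W(2)] by simp
    ultimately show False using W3[OF that] by (simp add: key_def algebra_simps)
  qed
  moreover have "strict_max \<nu> E W"
    unfolding strict_max_def
  proof (intro conjI allI impI)
    fix U assume U: "W \<subset> U" "U \<subseteq> nodes \<nu>"
    then have "card W < card U" using finite_subset[OF U(2) finite_nodes] by (intro psubset_card_mono)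
    moreover have "key U \<le> key W" "excess \<nu> E U \<le> excess \<nu> E W" using mx[of U] W(1) W3[of U] U by auto
    ultimately show "excess \<nu> E U < excess \<nu> E W" by (cases "excess \<nu> E U = excess \<nu> E W") (auto simp: key_def)
  qed (rule W)
  ultimately show ?thesis using W(1) by blast
qed

text \<open>Otherwise, by supermodularity, \<open>Y \<union> W\<close> would be a larger set with at
  least the excess of \<open>W\<close>.\<close>

lemma strict_max_absorbs:
  assumes "finite E" "strict_max \<nu> E W" "Y \<subseteq> nodes \<nu>" "excess \<nu> E (Y \<inter> W) \<le> excess \<nu> E Y"
  shows "Y \<subseteq> W"
proof (rule ccontr)
  assume "\<not> ?thesis"
  then have "W \<subset> Y \<union> W" by blast
  moreover have WV: "W \<subseteq> nodes \<nu>" using assms(2) by (simp add: strict_max_def)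
  ultimately have "excess \<nu> E (Y \<union> W) < excess \<nu> E W" using assms(2,3) by (auto simp: strict_max_def)
  moreover have "excess \<nu> E Y + excess \<nu> E W \<le> excess \<nu> E (Y \<union> W) + excess \<nu> E (Y \<inter> W)"
    using assms(1,3) WV finite_subset[OF _ finite_nodes] by (intro excess_supermodular) auto
  ultimately show False using assms(4) by simp
qed

lemma tight_absorbed:
  assumes sp: "sparse \<nu> E" and W: "strict_max \<nu> E W" and Y: "Y \<subseteq> nodes \<nu>" "excess \<nu> E Y = - 2"
    and "u \<in> Y \<inter> W" "v \<in> Y \<inter> W" "u \<noteq> v"
  shows "Y \<subseteq> W"
proof (rule strict_max_absorbs[OF sparse_finite[OF sp] W Y(1)])
  have "finite (Y \<inter> W)" using Y(1) finite_subset[OF _ finite_nodes] by blast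
  then have "card {u, v} \<le> card (Y \<inter> W)" using assms by (intro card_mono) auto
  then have "excess \<nu> E (Y \<inter> W) \<le> - 2" using assms Y by (intro sparse_excess[OF sp]) auto
  then show "excess \<nu> E (Y \<inter> W) \<le> excess \<nu> E Y" using Y by simp
qed

text \<open>Two nodes alone already have excess at least \<open>-2\<close>, so a maximal set through
  them meets the sparsity bound with equality.\<close>

lemma tight_block_exists:
  assumes sp: "sparse \<nu> E" and "u \<in> nodes \<nu>" "v \<in> nodes \<nu>" "u \<noteq> v"
  shows "\<exists>Y. strict_max \<nu> E Y \<and> excess \<nu> E Y = - 2 \<and> u \<in> Y \<and> v \<in> Y"
proof -
  have uv: "{u, v} \<subseteq> nodes \<nu>" using assms by simp
  from maximal_excess[OF this, of E] obtain Y where Y: "{u, v} \<subseteq> Y" "strict_max \<nu> E Y"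
    "\<forall>U. {u, v} \<subseteq> U \<longrightarrow> U \<subseteq> nodes \<nu> \<longrightarrow> excess \<nu> E U \<le> excess \<nu> E Y" by metis
  have "excess \<nu> E {u, v} \<le> excess \<nu> E Y" using Y(3) uv by simp
  moreover  have "- 2 \<le> excess \<nu> E {u, v}" using assms(4) by (simp add: excess_def)
  moreover have YV: "Y \<subseteq> nodes \<nu>" using Y(2) by (simp add: strict_max_def)
  then have "card {u, v} \<le> card Y" using Y(1) finite_subset[OF _ finite_nodes] by (intro card_mono) auto
  then have "excess \<nu> E Y \<le> - 2" using assms(4) by (intro sparse_excess[OF sp YV]) auto
  ultimately show ?thesis using Y by (intro exI[of _ Y]) auto
qed

lemma wt_Union:
  assumes "finite \<B>" "\<And>A B. A \<in> \<B> \<Longrightarrow> B \<in> \<B> \<Longrightarrow> A \<noteq> B \<Longrightarrow> A \<inter> B = {}"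
  shows "wt \<nu> (\<Union>\<B>) c = (\<Sum>B\<in>\<B>. wt \<nu> B c)"
  using assms
proof (induction \<B> rule: finite_induct)
  case (insert B \<B>)
  have "B \<inter> A = {}" if "A \<in> \<B>" for A using insert.prems[of B A] insert.hyps that by auto
  then have "B \<inter> \<Union>\<B> = {}" by blast
  then show ?case using wt_Un[of B "\<Union>\<B>" \<nu> c] insert by simp
qed simp

text \<open>The maximal tight sets through \<open>z\<close> partition the other nodes.\<close>

lemma negative_block:
  assumes sp: "sparse \<nu> E" and z: "z \<in> U" "U \<subseteq> nodes \<nu>"
    and absorb: "\<And>Y u. strict_max \<nu> E Y \<Longrightarrow> excess \<nu> E Y = - 2 \<Longrightarrow> z \<in> Y \<Longrightarrow> u \<in> Y \<inter> U \<Longrightarrow> u \<noteq> z \<Longrightarrow> Y \<subseteq> U"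
    and neg: "wt \<nu> (nodes \<nu> - U) c < 0"
  shows "\<exists>Y. strict_max \<nu> E Y \<and> excess \<nu> E Y = - 2 \<and> Y \<inter> U = {z} \<and> wt \<nu> (Y - {z}) c < 0"
proof (rule ccontr)
  assume no: "\<not> ?thesis"
  let ?V = "nodes \<nu>"
  have "\<forall>v\<in>?V - U. \<exists>Y. strict_max \<nu> E Y \<and> excess \<nu> E Y = - 2 \<and> z \<in> Y \<and> v \<in> Y"
    using tight_block_exists[OF sp] z by blast
  from bchoice[OF this] obtain Y where Y: "\<forall>v\<in>?V - U. strict_max \<nu> E (Y v) \<and> excess \<nu> E (Y v) = - 2 \<and> z \<in> Y v \<and> v \<in> Y v" ..
  define \<B> where "\<B> = (\<lambda>v. Y v - {z}) ` (?V - U)"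
  have YV: "Y v \<subseteq> ?V" if "v \<in> ?V - U" for v using Y that by (auto simp: strict_max_def)
  have int: "Y v \<inter> U = {z}" if v: "v \<in> ?V - U" for v
  proof -
    have "u = z" if "u \<in> Y v \<inter> U" for u using absorb[of "Y v" u] Y v that by blast
    then show ?thesis using Y v z by blast
  qed
  have "A \<inter> B = {}" if AB: "A \<in> \<B>" "B \<in> \<B>" "A \<noteq> B" for A B
  proof -
    from AB obtain u v where uv: "u \<in> ?V - U" "A = Y u - {z}" "v \<in> ?V - U" "B = Y v - {z}" by (auto simp: \<B>_def)
    have "False" if w: "w \<in> A" "w \<in> B" for w
    proof -
      have "Y u \<subseteq> Y v" by (rule tight_absorbed[OF sp, of _ _ z w]) (use Y uv YV w in auto)
      moreover have "Y v \<subseteq> Y u" by (rule tight_absorbed[OF sp, of _ _ z w]) (use Y uv YV w in auto)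
      ultimately show False using AB uv by simp
    qed
    then show ?thesis by auto
  qed
  moreover have "finite \<B>" by (simp add: \<B>_def)
  moreover have "\<Union>\<B> = ?V - U"
  proof
    show "\<Union>\<B> \<subseteq> ?V - U" using int YV by (fastforce simp: \<B>_def)
    show "?V - U \<subseteq> \<Union>\<B>" using Y z(1) by (fastforce simp: \<B>_def)
  qed
  ultimately have "wt \<nu> (?V - U) c = (\<Sum>B\<in>\<B>. wt \<nu> B c)" using wt_Union[of \<B> \<nu> c] by metis
  moreover have "wt \<nu> B c \<ge> 0" if "B \<in> \<B>" for B
  proof -
    from that obtain v where "v \<in> ?V - U" "B = Y v - {z}" by (auto simp: \<B>_def)
    then show ?thesis using no Y int[of v] by (metis not_less)
  qed
  ultimately show False using neg sum_nonneg[of \<B> "\<lambda>B. wt \<nu> B c"] by simp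
qed

section \<open>States of the adversary\<close>

text \<open>In a state all answers have been absorbed into one class of balls whose relative colors are known, the root
  class of ball \<open>0\<close>, and a sparse set of NO answers among it and the remaining single balls.\<close>

definition state :: "(nat \<Rightarrow> nat) \<Rightarrow> coloring \<Rightarrow> nat set set \<Rightarrow> bool" where
  "state \<nu> g E \<longleftrightarrow> sparse \<nu> E \<and> 0 < n \<and> \<nu> 0 = 0 \<and> (\<forall>b. \<nu> b = 0 \<or> \<nu> b = b) \<and> \<bar>wt \<nu> {0} g\<bar> \<le> 1"

lemma single_outside:
  assumes "\<And>b. \<nu> b \<in> W \<or> \<nu> b = b" "v \<in> nodes \<nu>" "v \<notin> W"
  shows "single \<nu> v"
proof -
  obtain b where "\<nu> b = v" using assms(2) by (auto simp: nodes_def)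
  moreover from this have "b = v" using assms by metis
  ultimately have "\<nu> v = v" by simp
  moreover have "b = v" if "\<nu> b = v" for b using assms that by metis
  ultimately show ?thesis by (auto simp: single_def)
qed

lemma state_single:
  assumes "state \<nu> g E" "v \<in> nodes \<nu>" "v \<noteq> 0"
  shows "single \<nu> v"
  by (rule single_outside[of \<nu> "{0}"]) (use assms in \<open>auto simp: state_def\<close>)

lemma state_nodes_0: "state \<nu> g E \<Longrightarrow> 0 \<in> nodes \<nu>"
  unfolding state_def nodes_def by (metis imageI lessThan_iff)

lemma abs_wt_single: "single \<nu> v \<Longrightarrow> v \<in> nodes \<nu> \<Longrightarrow> \<bar>wt \<nu> {v} c\<bar> \<le> 1"
  using wt_single by (simp add: val_def)

text \<open>Nodes inside \<open>W\<close> need not be single: besides the root, a freshly contracted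
  node may lie there and is absorbed with \<open>W\<close>.\<close>

definition rooted :: "(nat \<Rightarrow> nat) \<Rightarrow> nat set set \<Rightarrow> nat set \<Rightarrow> bool" where
  "rooted \<nu> E W \<longleftrightarrow> sparse \<nu> E \<and> strict_max \<nu> E W \<and> 0 \<in> W \<and> 0 < n \<and> \<nu> 0 = 0 \<and> (\<forall>b. \<nu> b \<in> W \<or> \<nu> b = b)"

text \<open>All relative colors in \<open>W\<close> are given away and \<open>W\<close> becomes the
  new root class. This settles every query inside \<open>W\<close>, so for a tight set the loss of 1
  pays for the query.\<close>

lemma commit_state:
  assumes r: "rooted \<nu> E W" and c: "c \<in> sig \<nu> g" "proper (inside \<nu> E W) c" "\<bar>wt \<nu> W c\<bar> \<le> 1"
  shows "state (mrg W 0 \<nu>) c (E - inside \<nu> E W)" "cols (mrg W 0 \<nu>) c (E - inside \<nu> E W) \<subseteq> cols \<nu> g E"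
    "psi (mrg W 0 \<nu>) (E - inside \<nu> E W) = psi \<nu> E + 1 + excess \<nu> E W"
    "\<nu> ` e \<subseteq> W \<Longrightarrow> const_on (cols (mrg W 0 \<nu>) c (E - inside \<nu> E W)) e"
proof -
  have sp: "sparse \<nu> E" and W: "strict_max \<nu> E W" "0 \<in> W" and z: "0 < n" "\<nu> 0 = 0" "\<And>b. \<nu> b \<in> W \<or> \<nu> b = b"
    using r by (auto simp: rooted_def)
  show "state (mrg W 0 \<nu>) c (E - inside \<nu> E W)"
    unfolding state_def using merge_sparse[OF sp W(1) subset_refl W(2)] W(2) z c(3) wt_mrg_merged[OF W(2)]
    by (auto simp: mrg_def)
  show "cols (mrg W 0 \<nu>) c (E - inside \<nu> E W) \<subseteq> cols \<nu> g E"
    by (rule merge_cols[OF c(1)]) (rule proper_sig_mrg[OF c(2)])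
  have "W \<subseteq> nodes \<nu>" using W by (simp add: strict_max_def)
  from merge_psi[OF sparse_finite[OF sp] this W(2)]
  show "psi (mrg W 0 \<nu>) (E - inside \<nu> E W) = psi \<nu> E + 1 + excess \<nu> E W" by simp
  assume e: "\<nu> ` e \<subseteq> W"
  show "const_on (cols (mrg W 0 \<nu>) c (E - inside \<nu> E W)) e"
    by (rule const_onI[of _ _ "answer c e"]) (use same_answer[OF sig_mrg_same e] in \<open>auto simp: cols_def\<close>)
qed

text \<open>Sharing at most one node with \<open>W\<close>, the block loses no edge.
  \<open>bnd\<close> is the estimate of \<open>merge_excess\<close> for sets through the new node;
  for other sets the excess does not grow.\<close>

lemma block_persists:
  assumes sp: "sparse \<nu> E" and W: "W \<subseteq> nodes \<nu>" and X: "X \<subseteq> W" "x \<in> X"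
    and Y: "strict_max \<nu> E Y" "Y \<inter> X = {}" "card (Y \<inter> W) \<le> 1"
    and bnd: "\<And>Z. Y \<subset> Z \<Longrightarrow> x \<in> Z \<Longrightarrow> Z \<subseteq> nodes \<nu> \<Longrightarrow>
      excess \<nu> E (Z \<union> W) - excess \<nu> E W - int (card (Z \<inter> W)) < excess \<nu> E Y"
  shows "strict_max (mrg X x \<nu>) (E - inside \<nu> E W) Y" "inside (mrg X x \<nu>) (E - inside \<nu> E W) Y = inside \<nu> E Y"
proof -
  let ?\<nu> = "mrg X x \<nu>" and ?E = "E - inside \<nu> E W"
  have XV: "X \<subseteq> nodes \<nu>" using X W by blast
  have YV: "Y \<subseteq> nodes \<nu>" using Y by (simp add: strict_max_def)
  have fY: "finite Y" and fW: "finite W" using YV W finite_subset[OF _ finite_nodes] by blast+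
  have "e \<notin> inside \<nu> E W" if "e \<in> inside \<nu> E Y" for e
  proof
    assume "e \<in> inside \<nu> E W"
    then have "\<nu> ` e \<subseteq> Y \<inter> W" "e \<in> E" using that by (auto simp: inside_def)
    then have "card (\<nu> ` e) \<le> card (Y \<inter> W)" using fY by (intro card_mono) auto
    then show False using sparse_edge(4)[OF sp \<open>e \<in> E\<close>] Y(3) by simp
  qed
  moreover have "?\<nu> b \<in> Y \<longleftrightarrow> \<nu> b \<in> Y" for b using Y(2) X by (auto simp: mrg_def)
  ultimately show ins: "inside ?\<nu> ?E Y = inside \<nu> E Y" unfolding inside_def by blast
  then have ex: "excess ?\<nu> ?E Y = excess \<nu> E Y" by (simp add: excess_def)
  show "strict_max ?\<nu> ?E Y"
    unfolding strict_max_def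
  proof (intro conjI allI impI)
    show "Y \<subseteq> nodes ?\<nu>" unfolding nodes_mrg[OF XV X(2)] using YV Y(2) by blast
    fix Z assume Z: "Y \<subset> Z" "Z \<subseteq> nodes ?\<nu>"
    then have ZV: "Z \<subseteq> nodes \<nu>" unfolding nodes_mrg[OF XV X(2)] using X W by blast
    then have fZ: "finite Z" using finite_subset[OF _ finite_nodes] by blast
    show "excess ?\<nu> ?E Z < excess ?\<nu> ?E Y"
    proof (cases "x \<in> Z")
      case True
      then show ?thesis
        using merge_excess[OF sparse_finite[OF sp] fZ fW X(1), of x \<nu>] bnd[OF Z(1) True ZV] ex by simp
    next
      case False
      have "excess \<nu> E Z < excess \<nu> E Y" using Y(1) Z ZV by (simp add: strict_max_def)
      then show ?thesis using merge_excess_other[OF sparse_finite[OF sp] False, of X \<nu> "inside \<nu> E W"] ex by simp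
    qed
  qed
qed

lemma extend_persistent_block:
  assumes sp: "sparse \<nu> E" and W: "strict_max \<nu> E W" and X: "X \<subseteq> W" "x \<in> X"
    and Y: "strict_max \<nu> E Y" "Y \<inter> X = {}" "card (Y \<inter> W) \<le> 1" "z \<in> Y"
    and bnd: "\<And>Z. Y \<subset> Z \<Longrightarrow> x \<in> Z \<Longrightarrow> Z \<subseteq> nodes \<nu> \<Longrightarrow>
      excess \<nu> E (Z \<union> W) - excess \<nu> E W - int (card (Z \<inter> W)) < excess \<nu> E Y"
    and c: "c \<in> sig \<nu> g" "proper (inside \<nu> E Y) c" and d: "d \<in> sig \<nu> g"
  shows "\<exists>c'\<in>cols (mrg X x \<nu>) d (E - inside \<nu> E W). total c' \<le> wt \<nu> Y c \<and> (\<forall>b. \<nu> b \<in> Y \<longrightarrow> c' b = c b)"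
proof -
  let ?\<nu> = "mrg X x \<nu>" and ?E = "E - inside \<nu> E W"
  let ?c = "\<lambda>b. if \<nu> b \<in> Y then c b else d b"
  have WV: "W \<subseteq> nodes \<nu>" using W by (simp add: strict_max_def)
  note bp = block_persists[OF sp WV X Y(1-3) bnd]
  have sp': "sparse ?\<nu> ?E" by (rule merge_sparse[OF sp W X])
  have cs: "?c \<in> sig ?\<nu> d" by (rule sig_piecewise[OF c(1) d Y(2) X(2)])
  have "proper (inside \<nu> E Y) ?c" by (rule proper_inside_cong[OF c(2)]) auto
  then have pr: "proper (inside ?\<nu> ?E Y) ?c" using bp(2) by simp
  have m: "?\<nu> b \<in> Y \<longleftrightarrow> \<nu> b \<in> Y" for b using Y(2) X by (auto simp: mrg_def)
  from extend_block[OF sp' bp(1) Y(4) cs pr] obtain c' where c': "c' \<in> cols ?\<nu> d ?E" "total c' \<le> wt ?\<nu> Y ?c"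
    "\<forall>b. ?\<nu> b \<in> Y \<longrightarrow> c' b = ?c b" by blast
  have "wt ?\<nu> Y ?c = wt \<nu> Y ?c" by (rule wt_mrg_other[OF X(2) Y(2)])
  also have "\<dots> = wt \<nu> Y c" by (rule wt_cong) auto
  finally show ?thesis using c' m by (intro bexI[of _ c']) auto
qed

text \<open>For odd \<open>n\<close>, a root class of weight \<open>1\<close> whose majority color always wins would settle the problem; in
  weight \<open>0\<close> this cannot happen.\<close>

definition open_root :: "(nat \<Rightarrow> nat) \<Rightarrow> coloring \<Rightarrow> nat set set \<Rightarrow> bool" where
  "open_root \<nu> g E \<longleftrightarrow> (\<exists>c\<in>cols \<nu> g E. wt \<nu> {0} c \<ge> 0 \<and> total c < 0)"

text \<open>The root has weight 0 in every coloring, so a coloring of positive total may simply be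
  complemented.\<close>

lemma open_root_zero:
  assumes "sparse \<nu> E" "wt \<nu> {0} g = 0" "odd n"
  shows "open_root \<nu> g E"
proof -
  obtain c where c: "c \<in> cols \<nu> g E" using colorable[OF assms(1)] by blast
  have w0: "wt \<nu> {0} d = 0" if "d \<in> cols \<nu> g E" for d
    using wt_sig_abs[OF _ sig_refl, of d \<nu> g 0] that assms(2) by (simp add: cols_def)
  have "total c \<noteq> 0" using total_parity[of c] assms(3) by auto
  then have "total c < 0 \<or> total (flp \<nu> (nodes \<nu>) c) < 0" using total_flp_nodes[of \<nu> c] by auto
  then show ?thesis unfolding open_root_def using c cols_flp_nodes[OF assms(1) c] w0 by (metis order_refl)
qed

section \<open>Absorbing a set while keeping the root open\<close>

lemma rootedD:
  assumes "rooted \<nu> E W"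
  shows "sparse \<nu> E" "strict_max \<nu> E W" "0 \<in> W" "0 < n" "\<nu> 0 = 0" "\<nu> b \<in> W \<or> \<nu> b = b" "W \<subseteq> nodes \<nu>"
  using assms by (auto simp: rooted_def strict_max_def)

text \<open>\<open>W - {v}\<close> is contracted with weight 0 and \<open>v\<close> stays free, so
  \<open>minority_single\<close> yields a coloring of negative total with \<open>v\<close> True. In
  it \<open>W\<close> has weight 1, which witnesses openness. The potential is unchanged by this
  contraction, so \<open>psi \<nu> E \<ge> 3\<close> supplies the three nodes.\<close>

lemma commit_open_crossing:
  assumes r: "rooted \<nu> E W" and W: "excess \<nu> E W = - 2" "psi \<nu> E \<ge> 3" and n: "odd n"
    and wv: "\<And>v. v \<in> W - {0} \<Longrightarrow> single \<nu> v \<or> wt \<nu> {v} g = 0"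
    and c: "c \<in> sig \<nu> g" "v \<in> W - {0}" "proper (inside \<nu> E W) c" "proper (inside \<nu> E W) (flp \<nu> {v} c)"
      "wt \<nu> W c = 1" "wt \<nu> {v} c = 1"
  shows "\<exists>c\<in>sig \<nu> g. proper (inside \<nu> E W) c \<and> \<bar>wt \<nu> W c\<bar> \<le> 1 \<and> open_root (mrg W 0 \<nu>) c (E - inside \<nu> E W)"
proof -
  note R = rootedD[OF r]
  let ?X = "W - {v}" and ?E = "E - inside \<nu> E W"
  let ?\<nu> = "mrg ?X 0 \<nu>"
  have X: "?X \<subseteq> W" "0 \<in> ?X" "?X \<subseteq> nodes \<nu>" using R(3,7) c(2) by auto
  have sp: "sparse ?\<nu> ?E" by (rule merge_sparse[OF R(1,2) X(1,2)])
  have sv: "single \<nu> v" using wv[OF c(2)] wt_sig_abs[OF c(1) sig_refl, of v] c(6) by auto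
  have X0: "wt \<nu> ?X c = 0" using wt_Diff[of "{v}" W \<nu> c] c(2,5,6) by simp
  have nodes: "nodes ?\<nu> = insert 0 (nodes \<nu> - ?X)" by (rule nodes_mrg[OF X(3,2)])
  have fW: "finite W" using R(7) finite_subset[OF _ finite_nodes] by blast
  have "card W = Suc (card ?X)" using c(2) fW by (metis DiffD1 card_Suc_Diff1)
  then have "psi ?\<nu> ?E = psi \<nu> E" using merge_psi[OF sparse_finite[OF R(1)] X(3,2), of W] W(1) by simp
  then have "3 \<le> card (nodes ?\<nu>)" using W(2) by (simp add: psi_def)
  moreover have "single ?\<nu> u" if u: "u \<in> nodes ?\<nu> - {0}" for u
  proof -
    have uX: "u \<notin> ?X" "u \<in> nodes \<nu>" "u \<noteq> 0" using u nodes by auto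
    have "single \<nu> u"
    proof (cases "u = v")
      case False
      then show ?thesis using uX R(6) by (intro single_outside[of \<nu> W]) auto
    qed (use sv in simp)
    note su = this single_self[OF this]
    have "?\<nu> b = u \<longleftrightarrow> b = u" for b
    proof (cases "\<nu> b \<in> ?X")
      case True
      then have "b \<noteq> u" using su(2) uX by auto
      then show ?thesis using True uX by (simp add: mrg_def)
    next
      case False
      then have "?\<nu> b = \<nu> b" unfolding mrg_def by (rule if_not_P)
      then show ?thesis using su(1) by (simp add: single_def)
    qed
    then show ?thesis by (simp add: single_def)
  qed
  moreover have "v \<in> nodes ?\<nu> - {0}" using nodes c(2) R(7) by auto
  moreover have "\<bar>wt ?\<nu> {0} c\<bar> \<le> 1" using wt_mrg_merged[OF X(2), of \<nu> c] X0 by simp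
  moreover have "0 \<in> nodes ?\<nu>" using nodes by simp
  ultimately obtain d where d: "d \<in> cols ?\<nu> c ?E" "d v" "total d < 0" using minority_single[OF sp _ _ _ _ n, of 0 c v] by blast
  then have ds: "d \<in> sig ?\<nu> c" by (simp add: cols_def)
  then have dg: "d \<in> sig \<nu> g" using mrg_sig_subset[OF c(1)] by blast
  have pr: "proper (inside \<nu> E W) d" using sig_mrg_one_free[OF c(1) ds] c(2-4) same_proper by blast
  have "wt \<nu> ?X d = 0"
    using sig_mrg_cases[OF ds] wt_cong[of \<nu> ?X d c] wt_compl[of \<nu> ?X d c] X0 by auto
  moreover have "wt \<nu> {v} d = 1" using wt_single[OF sv] c(2) R(7) d(2) by (auto simp: val_def)
  ultimately have w1: "wt \<nu> W d = 1" using wt_Diff[of "{v}" W \<nu> d] c(2) by simp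
  have "d \<in> cols (mrg W 0 \<nu>) d ?E" using d(1) sig_refl by (simp add: cols_def)
  then have "open_root (mrg W 0 \<nu>) d ?E" unfolding open_root_def using d(3) w1 wt_mrg_merged[OF R(3), of \<nu> d] by force
  then show ?thesis using dg pr w1 by (intro bexI[of _ d]) auto
qed

text \<open>The ends of the root path have weight at least 1 and average 1, so both have weight 1;
  there the root is free against a rest of weight 0. The negative total of \<open>c1\<close> must
  come from outside \<open>W\<close>, hence from a tight block through the root that survives
  contracting \<open>W - {0}\<close>.\<close>

lemma commit_open_no_crossing:
  assumes r: "rooted \<nu> E W" and W: "excess \<nu> E W = - 2" "2 \<le> card W" and n: "odd n"
    and c1: "c1 \<in> cols \<nu> g E" "wt \<nu> {0} c1 = 1" "total c1 < 0"
    and pos: "\<And>c. c \<in> sig \<nu> g \<Longrightarrow> proper (inside \<nu> E W) c \<Longrightarrow> wt \<nu> {0} c = 1 \<Longrightarrow> wt \<nu> W c \<ge> 1"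
  shows "\<exists>c\<in>sig \<nu> g. proper (inside \<nu> E W) c \<and> \<bar>wt \<nu> W c\<bar> \<le> 1 \<and> open_root (mrg W 0 \<nu>) c (E - inside \<nu> E W)"
proof -
  note R = rootedD[OF r]
  let ?X = "W - {0}" and ?E = "E - inside \<nu> E W" and ?I = "inside \<nu> E W"
  have c1s: "c1 \<in> sig \<nu> g" and c1p: "proper E c1" using c1 by (auto simp: cols_def)
  have c1I: "proper (inside \<nu> E U) c1" for U by (rule proper_mono[OF c1p]) (auto simp: inside_def)
  have "\<exists>c. c \<in> sig \<nu> g \<and> proper ?I c \<and> proper ?I (flp \<nu> {0} c) \<and> wt \<nu> W c = 1 \<and> wt \<nu> {0} c = 1"
  proof (rule root_path[OF R(1,7,3) c1s c1I])
    fix D and m :: nat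
    assume D: "\<And>i. i \<le> m \<Longrightarrow> D i \<in> sig \<nu> g \<and> proper ?I (D i) \<and> (\<forall>a. \<nu> a = 0 \<longrightarrow> D i a = c1 a)"
      and fl: "proper ?I (flp \<nu> {0} (D 0))" and sum: "wt \<nu> W (D 0) + wt \<nu> W (D m) = 2 * wt \<nu> {0} c1"
    have w: "wt \<nu> {0} (D i) = 1" if "i \<le> m" for i using D[OF that] wt_cong[of \<nu> "{0}" "D i" c1] c1(2) by simp
    have "wt \<nu> W (D i) \<ge> 1" if "i \<le> m" for i using pos[of "D i"] D[OF that] w[OF that] by simp
    from this[OF le0] this[OF order_refl] have "wt \<nu> W (D 0) = 1" using sum c1(2) by simp
    then show ?thesis using D[of 0] fl w[of 0] by (intro exI[of _ "D 0"]) simp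
  qed
  then obtain c where c: "c \<in> sig \<nu> g" "proper ?I c" "proper ?I (flp \<nu> {0} c)" "wt \<nu> W c = 1" "wt \<nu> {0} c = 1" by blast
  have X0: "wt \<nu> ?X c = 0" using wt_Diff[of "{0}" W \<nu> c] R(3) c by simp
  have "wt \<nu> W c1 \<ge> 1" by (rule pos[OF c1s c1I c1(2)])
  then have "wt \<nu> (nodes \<nu> - W) c1 < 0" using wt_Diff[OF R(7), of \<nu> c1] c1(3) by (simp add: wt_nodes)
  moreover have "Y \<subseteq> W" if "strict_max \<nu> E Y" "excess \<nu> E Y = - 2" "0 \<in> Y" "u \<in> Y \<inter> W" "u \<noteq> 0" for Y u
    by (rule tight_absorbed[OF R(1,2), of Y 0 u]) (use that R(3) in \<open>auto simp: strict_max_def\<close>)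
  ultimately obtain Y where Y: "strict_max \<nu> E Y" "excess \<nu> E Y = - 2" "Y \<inter> W = {0}" "wt \<nu> (Y - {0}) c1 < 0"
    using negative_block[OF R(1,3,7), of c1] by blast
  obtain x where x: "x \<in> ?X"
  proof -
    have "W \<noteq> {0}" using W(2) by auto
    then show ?thesis using that R(3) by blast
  qed
  have fW: "finite W" using R(7) finite_subset[OF _ finite_nodes] by blast
  have "\<exists>d\<in>cols (mrg ?X x \<nu>) c ?E. total d \<le> wt \<nu> Y c1 \<and> (\<forall>b. \<nu> b \<in> Y \<longrightarrow> d b = c1 b)"
  proof (rule extend_persistent_block[OF R(1,2) _ x Y(1)])
    fix Z assume Z: "Y \<subset> Z" "x \<in> Z" "Z \<subseteq> nodes \<nu>"
    have "Y \<noteq> {0}" using Y(4) by auto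
    then have "W \<subset> Z \<union> W" using Z Y(3) by blast
    then have "excess \<nu> E (Z \<union> W) < - 2" using R(2,7) Z W(1) by (auto simp: strict_max_def)
    moreover have "card {0, x} \<le> card (Z \<inter> W)" using x Z Y(3) R(3) fW by (intro card_mono) auto
    ultimately show "excess \<nu> E (Z \<union> W) - excess \<nu> E W - int (card (Z \<inter> W)) < excess \<nu> E Y"
      using W(1) Y(2) x by simp
  qed (use Y R(3) c1s c1I c(1) in auto)
  then obtain d where d: "d \<in> cols (mrg ?X x \<nu>) c ?E" "total d \<le> wt \<nu> Y c1" "\<And>b. \<nu> b \<in> Y \<Longrightarrow> d b = c1 b" by blast
  have ds: "d \<in> sig (mrg ?X x \<nu>) c" using d(1) by (simp add: cols_def)
  then have dg: "d \<in> sig \<nu> g" using mrg_sig_subset[OF c(1)] by blast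
  have pr: "proper ?I d" using sig_mrg_one_free[OF c(1) ds R(3)] c(2,3) same_proper by blast
  have "wt \<nu> ?X d = 0"
    using sig_mrg_cases[OF ds] wt_cong[of \<nu> ?X d c] wt_compl[of \<nu> ?X d c] X0 by auto
  moreover have d0: "wt \<nu> {0} d = 1" using wt_cong[of \<nu> "{0}" d c1] d(3) c1(2) Y(3) by auto
  ultimately have w1: "wt \<nu> W d = 1" using wt_Diff[of "{0}" W \<nu> d] R(3) by simp
  have "0 \<in> Y" using Y(3) by blast
  then have "wt \<nu> Y c1 \<le> 0" using wt_Diff[of "{0}" Y \<nu> c1] Y(4) c1(2) by simp
  moreover have "odd (total d)" using total_parity n by simp
  ultimately have "total d < 0" using d(2) by (cases "total d = 0") auto
  moreover have "d \<in> cols (mrg W 0 \<nu>) d ?E" using d(1) sig_refl by (simp add: cols_def)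
  ultimately have "open_root (mrg W 0 \<nu>) d ?E" unfolding open_root_def using w1 wt_mrg_merged[OF R(3), of \<nu> d] by force
  then show ?thesis using dg pr w1 by (intro bexI[of _ d]) auto
qed

text \<open>For even weight, 0 is attained and openness is automatic. For odd weight, either some
  coloring forces a sign change on its root path, or root weight 1 always forces weight at least 1
  on \<open>W\<close>.\<close>

lemma commit_open:
  assumes r: "rooted \<nu> E W" and W: "excess \<nu> E W = - 2" "psi \<nu> E \<ge> 3" "2 \<le> card W" and n: "odd n"
    and wv: "\<And>v. v \<in> W - {0} \<Longrightarrow> single \<nu> v \<or> wt \<nu> {v} g = 0" and w0: "\<bar>wt \<nu> {0} g\<bar> \<le> 1"
    and op: "open_root \<nu> g E"
  shows "\<exists>c\<in>sig \<nu> g. proper (inside \<nu> E W) c \<and> \<bar>wt \<nu> W c\<bar> \<le> 1 \<and> open_root (mrg W 0 \<nu>) c (E - inside \<nu> E W)"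
proof -
  note R = rootedD[OF r]
  let ?I = "inside \<nu> E W"
  have wv1: "\<bar>wt \<nu> {v} g\<bar> \<le> 1" if "v \<in> W - {0}" for v
    using wv[OF that] abs_wt_single[of \<nu> v g] that R(7) by auto
  from op obtain c1 where c1: "c1 \<in> cols \<nu> g E" "wt \<nu> {0} c1 \<ge> 0" "total c1 < 0" by (auto simp: open_root_def)
  have c1s: "c1 \<in> sig \<nu> g" and c1p: "proper E c1" using c1 by (auto simp: cols_def)
  have c1I: "proper ?I c1" by (rule proper_mono[OF c1p]) (auto simp: inside_def)
  have w1: "wt \<nu> {0} c1 \<le> 1" using wt_sig_abs[OF c1s sig_refl, of 0] w0 by simp
  show ?thesis
  proof (cases "even (wt \<nu> W c1)")
    case True
    then obtain c where c: "c \<in> sig \<nu> g" "proper ?I c" "wt \<nu> W c = 0"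
      using weight_attained[OF R(1,7,3) c1s c1I wv1, of 0] c1(2) w1 by auto
    have "open_root (mrg W 0 \<nu>) c (E - ?I)"
      by (rule open_root_zero) (use merge_sparse[OF R(1,2) subset_refl R(3)] wt_mrg_merged[OF R(3), of \<nu> c] c n in auto)
    then show ?thesis using c by (intro bexI[of _ c]) auto
  next
    case False
    show ?thesis
    proof (cases "\<exists>c\<in>sig \<nu> g. proper ?I c \<and> (wt \<nu> {0} c = 0 \<or> wt \<nu> {0} c = 1 \<and> wt \<nu> W c < 0)")
      case True
      then obtain c where c: "c \<in> sig \<nu> g" "proper ?I c" "wt \<nu> {0} c = 0 \<or> wt \<nu> {0} c = 1 \<and> wt \<nu> W c < 0" by blast
      have "odd (wt \<nu> W c)" using False wt_parity[of \<nu> W c c1] by simp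
      moreover have "wt \<nu> {0} c \<le> 0 \<or> wt \<nu> W c < 0" "0 \<le> wt \<nu> {0} c \<or> 0 < wt \<nu> W c" using c(3) by auto
      ultimately obtain c' v where "c' \<in> sig \<nu> g" "v \<in> W - {0}" "proper ?I c'" "proper ?I (flp \<nu> {v} c')"
        "wt \<nu> W c' = 1" "wt \<nu> {v} c' = 1" using weight_crossing[OF R(1,7,3) c(1,2) wv1] by blast
      then show ?thesis by (intro commit_open_crossing[OF r W(1,2) n wv])
    next
      case no: False
      then have "wt \<nu> {0} c1 = 1" using c1s c1I c1(2) w1 by force
      moreover have "wt \<nu> W c \<ge> 1" if "c \<in> sig \<nu> g" "proper ?I c" "wt \<nu> {0} c = 1" for c
      proof -
        have "odd (wt \<nu> W c)" using False wt_parity[of \<nu> W c c1] by simp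
        then have "wt \<nu> W c \<noteq> 0" by auto
        then show ?thesis using no that by force
      qed
      ultimately show ?thesis using commit_open_no_crossing[OF r W(1,3) n c1(1) _ c1(3)] by blast
    qed
  qed
qed

text \<open>Two values are allowed so that either parity can be met when a set is absorbed, while
  the root never favors its color \<open>s\<close>.\<close>

definition oriented :: "bool \<Rightarrow> (nat \<Rightarrow> nat) \<Rightarrow> coloring \<Rightarrow> bool" where
  "oriented s \<nu> g \<longleftrightarrow> (\<forall>c\<in>sig \<nu> g. c 0 = s \<longrightarrow> wt \<nu> {0} c = 0 \<or> wt \<nu> {0} c = - 1)"

lemma cols_with_root_color:
  assumes "sparse \<nu> E" "0 < n"
  shows "\<exists>c\<in>cols \<nu> g E. c 0 = s"
proof -
  obtain c where c: "c \<in> cols \<nu> g E" using colorable[OF assms(1)] by blast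
  have "flp \<nu> (nodes \<nu>) c 0 = (\<not> c 0)" using assms(2) by (auto simp: flp_def nodes_def)
  then show ?thesis using c cols_flp_nodes[OF assms(1) c] by (cases "c 0 = s") auto
qed

lemma oriented_merged:
  assumes "rooted \<nu> E W" "c 0 = s" "wt \<nu> W c = 0 \<or> wt \<nu> W c = - 1"
  shows "oriented s (mrg W 0 \<nu>) c"
  unfolding oriented_def
proof (intro ballI impI)
  note R = rootedD[OF assms(1)]
  fix d assume d: "d \<in> sig (mrg W 0 \<nu>) c" "d 0 = s"
  have "mrg W 0 \<nu> 0 = 0" using R by (simp add: mrg_def)
  then have "wt (mrg W 0 \<nu>) {0} d = wt \<nu> W c"
    using wt_sig_same[OF d(1) sig_refl, of 0] assms(2) d(2) wt_mrg_merged[OF R(3), of \<nu> c] by simp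
  then show "wt (mrg W 0 \<nu>) {0} d = 0 \<or> wt (mrg W 0 \<nu>) {0} d = - 1" using assms(3) by simp
qed

text \<open>The value of the right parity among 0 and \<open>-1\<close> is within 1 of the current
  root weight, so it is attained without changing the color of ball \<open>0\<close>.\<close>

lemma commit_oriented:
  assumes r: "rooted \<nu> E W" and wv: "\<And>v. v \<in> W - {0} \<Longrightarrow> \<bar>wt \<nu> {v} g\<bar> \<le> 1" and o: "oriented s \<nu> g"
  shows "\<exists>c\<in>sig \<nu> g. proper (inside \<nu> E W) c \<and> \<bar>wt \<nu> W c\<bar> \<le> 1 \<and> oriented s (mrg W 0 \<nu>) c"
proof -
  note R = rootedD[OF r]
  let ?I = "inside \<nu> E W"
  obtain c0 where c0: "c0 \<in> cols \<nu> g E" "c0 0 = s" using cols_with_root_color[OF R(1,4)] by blast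
  have c0s: "c0 \<in> sig \<nu> g" and c0p: "proper E c0" using c0 by (auto simp: cols_def)
  have c0I: "proper ?I c0" by (rule proper_mono[OF c0p]) (auto simp: inside_def)
  have w: "wt \<nu> {0} c0 = 0 \<or> wt \<nu> {0} c0 = - 1" using o c0s c0(2) by (simp add: oriented_def)
  define t :: int where "t = (if even (wt \<nu> W c0) then 0 else - 1)"
  have "even (wt \<nu> W c0 - t)" by (simp add: t_def)
  moreover have "wt \<nu> {0} c0 - 1 \<le> t" "t \<le> wt \<nu> {0} c0 + 1" using w by (auto simp: t_def)
  ultimately obtain c where c: "c \<in> sig \<nu> g" "proper ?I c" "\<forall>a. \<nu> a = 0 \<longrightarrow> c a = c0 a" "wt \<nu> W c = t"
    using weight_attained[OF R(1,7,3) c0s c0I wv, of t] by blast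
  have "c 0 = s" using c(3) R(5) c0(2) by simp
  moreover have "t = 0 \<or> t = - 1" by (simp add: t_def)
  ultimately show ?thesis using c oriented_merged[OF r, of c s] by (intro bexI[of _ c]) auto
qed

text \<open>Weight 0 of the contracted part makes it as harmless as a single ball when it is
  absorbed later. Even weight of \<open>W\<close> frees two nodes; odd weight frees only one, but
  then the answer to \<open>e\<close> is settled at once.\<close>

lemma contract_singles:
  assumes st: "state \<nu> g E" and W: "strict_max \<nu> E W" "0 \<notin> W" and e: "\<nu> ` e \<subseteq> W" "card e = 3"
  shows "\<exists>X x c. X \<subseteq> W \<and> x \<in> X \<and> c \<in> sig \<nu> g \<and> wt \<nu> X c = 0 \<and>
    (\<forall>c'\<in>sig (mrg X x \<nu>) c. proper (inside \<nu> E W) c') \<and>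
    (card X + 1 = card W \<and> (\<forall>c'\<in>sig (mrg X x \<nu>) c. answer c' e = answer c e) \<or> card X + 2 = card W)"
proof -
  have sp: "sparse \<nu> E" and cl: "\<And>b. \<nu> b = 0 \<or> \<nu> b = b" using st by (auto simp: state_def)
  have WV: "W \<subseteq> nodes \<nu>" using W by (simp add: strict_max_def)
  have fW: "finite W" using WV finite_subset[OF _ finite_nodes] by blast
  have sg: "single \<nu> v" if "v \<in> W" for v using state_single[OF st] that WV W(2) by auto
  have eW: "e \<subseteq> W" using e(1) cl W(2) by (metis image_subset_iff subsetI)
  then have cW: "3 \<le> card W" using card_mono[OF fW] e(2) by metis
  obtain c0 where "c0 \<in> cols \<nu> g E" using colorable[OF sp] by blast
  then have c0: "c0 \<in> sig \<nu> g" "proper E c0" by (auto simp: cols_def)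
  have c0I: "proper (inside \<nu> E W) c0" by (rule proper_mono[OF c0(2)]) (auto simp: inside_def)
  show ?thesis
  proof (cases "even (wt \<nu> W g)")
    case True
    have "W \<noteq> {}" using cW by auto
    from two_free_singles[OF sp WV this sg True] obtain u v c where uv: "u \<in> W" "v \<in> W" "u \<noteq> v" "c \<in> sig \<nu> g"
      "proper (inside \<nu> E W) c" "proper (inside \<nu> E W) (flp \<nu> {u} c)" "proper (inside \<nu> E W) (flp \<nu> {v} c)"
      "proper (inside \<nu> E W) (flp \<nu> {v} (flp \<nu> {u} c))" "wt \<nu> (W - {u, v}) c = 0" by blast
    have cX: "card (W - {u, v}) + 2 = card W" using uv(1-3) cW fW by (subst card_Diff_subset) auto
    then have "W - {u, v} \<noteq> {}" using cW by (metis Suc_n_not_le_n add_0 card.empty numeral_2_eq_2 numeral_3_eq_3)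
    then obtain x where x: "x \<in> W - {u, v}" by blast
    have "proper (inside \<nu> E W) c'" if "c' \<in> sig (mrg (W - {u, v}) x \<nu>) c" for c'
      using sig_mrg_two_free[OF uv(4) that uv(3)] same_proper uv(5-8) by blast
    then show ?thesis using uv x cX by (intro exI[of _ "W - {u, v}"] exI[of _ x] exI[of _ c]) blast
  next
    case False
    from one_free_single[OF sp WV sg False eW e(2) c0(1) c0I] obtain u c where u: "u \<in> W" "c \<in> sig \<nu> g"
      "proper (inside \<nu> E W) c" "proper (inside \<nu> E W) (flp \<nu> {u} c)" "wt \<nu> (W - {u}) c = 0"
      "answer c e = answer (flp \<nu> {u} c) e" by blast
    have cX: "card (W - {u}) + 1 = card W" using u(1) fW cW by simp
    then have "W - {u} \<noteq> {}" using cW by fastforce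
    then obtain x where x: "x \<in> W - {u}" by blast
    have s: "same_up_to_compl \<nu> W c' c \<or> same_up_to_compl \<nu> W c' (flp \<nu> {u} c)" if "c' \<in> sig (mrg (W - {u}) x \<nu>) c" for c'
      by (rule sig_mrg_one_free[OF u(2) that u(1)])
    have "proper (inside \<nu> E W) c'" "answer c' e = answer c e" if "c' \<in> sig (mrg (W - {u}) x \<nu>) c" for c'
      using s[OF that] same_proper[of \<nu> W c'] same_answer[of \<nu> W c' _ e, OF _ e(1)] u(3,4,6) by blast+
    then show ?thesis using u x cX by (intro exI[of _ "W - {u}"] exI[of _ x] exI[of _ c]) blast
  qed
qed

lemma add_edge:
  assumes st: "state \<nu> g E" and e: "e \<subseteq> {..<n}" "card e = 3" "inj_on \<nu> e" "e \<notin> E"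
    and ex: "\<And>Z. Z \<subseteq> nodes \<nu> \<Longrightarrow> \<nu> ` e \<subseteq> Z \<Longrightarrow> excess \<nu> E Z \<le> - 3"
  shows "state \<nu> g (insert e E)" "cols \<nu> g (insert e E) \<subseteq> cols \<nu> g E" "const_on (cols \<nu> g (insert e E)) e"
    "psi \<nu> (insert e E) = psi \<nu> E - 1"
proof -
  have sp: "sparse \<nu> E" using st by (simp add: state_def)
  have fE: "finite E" using sp by (rule sparse_finite)
  have "excess \<nu> (insert e E) Z \<le> - 2" if "Z \<subseteq> nodes \<nu>" "2 \<le> card Z" for Z
    using sparse_excess[OF sp that] ex[OF that(1)] excess_insert[OF fE e(4), of \<nu> Z] by auto
  then have "sparse \<nu> (insert e E)" unfolding sparse_def using sp fE e by (auto simp: sparse_def)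
  then show "state \<nu> g (insert e E)" using st by (simp add: state_def)
  show "cols \<nu> g (insert e E) \<subseteq> cols \<nu> g E" by (auto simp: cols_def proper_def)
  show "const_on (cols \<nu> g (insert e E)) e" by (auto simp: cols_def proper_def const_on_def)
  show "psi \<nu> (insert e E) = psi \<nu> E - 1" using fE e(4) by (simp add: psi_def)
qed

lemma two_nodes_of_query:
  assumes "\<not> const_on (cols \<nu> g E) e" "finite e"
  shows "2 \<le> card (\<nu> ` e)"
proof (rule ccontr)
  assume "\<not> ?thesis"
  then have "card (\<nu> ` e) \<le> Suc 0" by simp
  then have "\<forall>x\<in>\<nu> ` e. \<forall>y\<in>\<nu> ` e. x = y" using assms(2) card_le_Suc0_iff_eq[of "\<nu> ` e"] by blast
  then have eq: "\<nu> a = \<nu> b" if "a \<in> e" "b \<in> e" for a b using that by blast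
  have "answer c e = answer g e" if "c \<in> cols \<nu> g E" for c
  proof -
    have "c \<in> sig \<nu> g" using that by (simp add: cols_def)
    then have "(c a = c b) = (g a = g b)" if "a \<in> e" "b \<in> e" for a b using eq[OF that] by (rule sigD)
    then show ?thesis unfolding answer_def by blast
  qed
  then show False using const_onI assms(1) by blast
qed

text \<open>Only the root class can contain two balls of \<open>e\<close>. Then \<open>0\<close> is
  a node of \<open>e\<close> and \<open>e\<close> has at most two nodes, whose excess is at least
  \<open>-2\<close>.\<close>

lemma query_inj:
  assumes st: "state \<nu> g E" and e: "card e = 3" and ex: "excess \<nu> E (insert 0 (\<nu> ` e)) \<le> - 3"
  shows "inj_on \<nu> e"
proof (rule ccontr)
  assume ni: "\<not> inj_on \<nu> e"
  have fe: "finite e" using e by (intro card_ge_0_finite) simp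
  from ni obtain a b where ab: "a \<in> e" "b \<in> e" "a \<noteq> b" "\<nu> a = \<nu> b" by (auto simp: inj_on_def)
  then have "\<nu> a = 0" using st unfolding state_def by metis
  then have "0 \<in> \<nu> ` e" using ab(1) by (metis imageI)
  then have "insert 0 (\<nu> ` e) = \<nu> ` e" by blast
  moreover have "card (\<nu> ` e) \<noteq> 3" using ni e fe eq_card_imp_inj_on by force
  moreover have "card (\<nu> ` e) \<le> 3" using card_image_le[OF fe, of \<nu>] e by simp
  ultimately show False using ex by (simp add: excess_def)
qed

lemma rooted_state:
  assumes "state \<nu> g E" "strict_max \<nu> E W" "0 \<in> W"
  shows "rooted \<nu> E W"
proof -
  have "\<nu> b \<in> W \<or> \<nu> b = b" for b using assms(1,3) unfolding state_def by metis
  then show ?thesis using assms by (simp add: rooted_def state_def)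
qed

text \<open>The new node and the root lie in a tight block \<open>Z\<close>, so absorbing
  \<open>Z\<close> restores a single nontrivial class. Either the answer to \<open>e\<close> is
  settled and this absorption costs the one unit, or the gained unit pays for it and the query is
  treated anew.\<close>

lemma contract_step:
  assumes st: "state \<nu> g E" and W: "strict_max \<nu> E W" "excess \<nu> E W = - 2" "0 \<notin> W" and e: "\<nu> ` e \<subseteq> W" "card e = 3"
  obtains X x c Z \<nu>' E' where "\<nu>' = mrg X x \<nu>" "E' = E - inside \<nu> E W" "X \<subseteq> W" "x \<in> X" "c \<in> sig \<nu> g"
    "cols \<nu>' c E' \<subseteq> cols \<nu> g E" "rooted \<nu>' E' Z" "excess \<nu>' E' Z = - 2" "2 \<le> card Z"
    "\<And>v. v \<in> Z - {0} \<Longrightarrow> single \<nu>' v \<or> wt \<nu>' {v} c = 0" "card (nodes \<nu>') \<le> card (nodes \<nu>)"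
    "psi \<nu>' E' = psi \<nu> E \<and> const_on (cols \<nu>' c E') e \<or> psi \<nu>' E' = psi \<nu> E + 1"
proof -
  have sp: "sparse \<nu> E" and cl: "\<And>b. \<nu> b = 0 \<or> \<nu> b = b" and z: "0 < n" "\<nu> 0 = 0" using st by (auto simp: state_def)
  have WV: "W \<subseteq> nodes \<nu>" using W by (simp add: strict_max_def)
  from contract_singles[OF st W(1,3) e] obtain X x c where X: "X \<subseteq> W" "x \<in> X" "c \<in> sig \<nu> g" "wt \<nu> X c = 0"
    "\<And>c'. c' \<in> sig (mrg X x \<nu>) c \<Longrightarrow> proper (inside \<nu> E W) c'"
    "card X + 1 = card W \<and> (\<forall>c'\<in>sig (mrg X x \<nu>) c. answer c' e = answer c e) \<or> card X + 2 = card W" by metis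
  let ?\<nu> = "mrg X x \<nu>" and ?E = "E - inside \<nu> E W"
  have XV: "X \<subseteq> nodes \<nu>" using X WV by blast
  have sp1: "sparse ?\<nu> ?E" by (rule merge_sparse[OF sp W(1) X(1,2)])
  have sub: "cols ?\<nu> c ?E \<subseteq> cols \<nu> g E" by (rule merge_cols[OF X(3,5)])
  have nodes: "nodes ?\<nu> = insert x (nodes \<nu> - X)" by (rule nodes_mrg[OF XV X(2)])
  have "0 \<in> nodes \<nu>" by (rule state_nodes_0[OF st])
  moreover have "0 \<notin> X" using X(1) W(3) by blast
  ultimately have z1: "0 \<in> nodes ?\<nu>" "x \<in> nodes ?\<nu>" "0 \<noteq> x" using nodes X(2) by (simp, simp, metis)
  from tight_block_exists[OF sp1 z1] obtain Z where Z: "strict_max ?\<nu> ?E Z" "excess ?\<nu> ?E Z = - 2" "0 \<in> Z" "x \<in> Z" by blast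
  have \<nu>b: "?\<nu> b = 0 \<or> ?\<nu> b = x \<or> ?\<nu> b = b" for b using cl[of b] by (auto simp: mrg_def)
  have "?\<nu> b \<in> Z \<or> ?\<nu> b = b" for b using \<nu>b[of b] Z(3,4) by metis
  moreover have "?\<nu> 0 = 0" using z(2) \<open>0 \<notin> X\<close> by (simp add: mrg_def)
  ultimately have r: "rooted ?\<nu> ?E Z" unfolding rooted_def using sp1 Z z(1) by simp
  have ZV: "Z \<subseteq> nodes ?\<nu>" using Z(1) by (simp add: strict_max_def)
  have "card {0, x} \<le> card Z" using Z finite_subset[OF ZV finite_nodes] by (intro card_mono) auto
  then have cZ: "2 \<le> card Z" using z1(3) by simp
  have wz: "single ?\<nu> v \<or> wt ?\<nu> {v} c = 0" if v: "v \<in> Z - {0}" for v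
  proof (cases "v = x")
    case True
    then show ?thesis using wt_mrg_merged[OF X(2), of \<nu> c] X(4) by simp
  next
    case False
    then have "single ?\<nu> v" using v ZV \<nu>b by (intro single_outside[of _ "{0, x}"]) auto
    then show ?thesis ..
  qed
  have "card X > 0" using X(2) finite_subset[OF XV finite_nodes] by (auto simp: card_gt_0_iff)
  then have cn: "card (nodes ?\<nu>) \<le> card (nodes \<nu>)" using card_nodes_mrg[OF XV X(2)] by simp
  have "psi ?\<nu> ?E = psi \<nu> E \<and> const_on (cols ?\<nu> c ?E) e \<or> psi ?\<nu> ?E = psi \<nu> E + 1"
    using X(6)
  proof
    assume a: "card X + 1 = card W \<and> (\<forall>c'\<in>sig ?\<nu> c. answer c' e = answer c e)"
    then have "const_on (cols ?\<nu> c ?E) e" by (intro const_onI[of _ _ "answer c e"]) (auto simp: cols_def)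
    then show ?thesis using merge_psi[OF sparse_finite[OF sp] XV X(2), of W] W(2) a by auto
  next
    assume "card X + 2 = card W"
    then show ?thesis using merge_psi[OF sparse_finite[OF sp] XV X(2), of W] W(2) by auto
  qed
  then show ?thesis using that[OF refl refl X(1-3) sub r Z(2) cZ wz cn] by blast
qed

lemma card_nodes_commit:
  assumes "rooted \<nu> E W" "2 \<le> card W"
  shows "card (nodes (mrg W 0 \<nu>)) < card (nodes \<nu>)"
  using card_nodes_mrg[OF rootedD(7,3)[OF assms(1)]] assms(2) by simp

text \<open>One unit pays for absorbing a tight set through ball \<open>0\<close> and the query, for
  recording a new edge, or for a contraction that settles the query. A contraction with two free
  nodes costs nothing in total but may leave the query undecided; the induction on the number of
  nodes then continues.\<close>

lemma oriented_step:
  assumes "state \<nu> g E" "oriented s \<nu> g" and e: "e \<subseteq> {..<n}" "card e = 3"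
  shows "\<exists>\<nu>' g' E'. state \<nu>' g' E' \<and> oriented s \<nu>' g' \<and> cols \<nu>' g' E' \<subseteq> cols \<nu> g E \<and>
    const_on (cols \<nu>' g' E') e \<and> psi \<nu> E - 1 \<le> psi \<nu>' E'"
  using assms(1,2)
proof (induction "card (nodes \<nu>)" arbitrary: \<nu> g E rule: less_induct)
  case less
  note st = less.prems(1) and o = less.prems(2)
  have sp: "sparse \<nu> E" using st by (simp add: state_def)
  have fe: "finite e" using e by (intro card_ge_0_finite) simp
  show ?case
  proof (cases "const_on (cols \<nu> g E) e")
    case True
    then show ?thesis using st o by (intro exI[of _ \<nu>] exI[of _ g] exI[of _ E]) auto
  next
    case nc: False
    have eV: "\<nu> ` e \<subseteq> nodes \<nu>" using e by (auto simp: nodes_def)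
    have AV: "insert 0 (\<nu> ` e) \<subseteq> nodes \<nu>" using eV state_nodes_0[OF st] by simp
    have c2: "2 \<le> card (\<nu> ` e)" by (rule two_nodes_of_query[OF nc fe])
    have c2': "2 \<le> card Z" if "\<nu> ` e \<subseteq> Z" "Z \<subseteq> nodes \<nu>" for Z
      using card_mono[OF finite_subset[OF that(2) finite_nodes] that(1)] c2 by simp
    from maximal_excess[OF AV, of E] obtain U where U: "insert 0 (\<nu> ` e) \<subseteq> U" "strict_max \<nu> E U"
      and Um: "\<forall>Z. insert 0 (\<nu> ` e) \<subseteq> Z \<longrightarrow> Z \<subseteq> nodes \<nu> \<longrightarrow> excess \<nu> E Z \<le> excess \<nu> E U" by metis
    have UV: "U \<subseteq> nodes \<nu>" using U by (simp add: strict_max_def)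
    have "excess \<nu> E U \<le> - 2" using sparse_excess[OF sp UV c2'] U(1) UV by simp
    then consider (tight) "excess \<nu> E U = - 2" | (loose) "excess \<nu> E U \<le> - 3" by linarith
    then show ?thesis
    proof cases
      case tight
      have r: "rooted \<nu> E U" by (rule rooted_state[OF st U(2)]) (use U(1) in simp)
      have "\<bar>wt \<nu> {v} g\<bar> \<le> 1" if "v \<in> U - {0}" for v
        using state_single[OF st] abs_wt_single[of \<nu> v g] that UV by auto
      from commit_oriented[OF r this o] obtain c where c: "c \<in> sig \<nu> g" "proper (inside \<nu> E U) c"
        "\<bar>wt \<nu> U c\<bar> \<le> 1" "oriented s (mrg U 0 \<nu>) c" by blast
      note cs = commit_state[OF r c(1-3)]
      show ?thesis
        by (intro exI[of _ "mrg U 0 \<nu>"] exI[of _ c] exI[of _ "E - inside \<nu> E U"]) (use cs c(4) tight U(1) in auto)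
    next
      case loose
      have "excess \<nu> E (insert 0 (\<nu> ` e)) \<le> - 3" using Um[rule_format, OF subset_refl AV] loose by simp
      then have inj: "inj_on \<nu> e" by (rule query_inj[OF st e(2)])
      have eE: "e \<notin> E" using nc by (auto simp: const_on_def cols_def proper_def)
      show ?thesis
      proof (cases "\<exists>Z\<subseteq>nodes \<nu>. \<nu> ` e \<subseteq> Z \<and> excess \<nu> E Z > - 3")
        case False
        then have "\<And>Z. Z \<subseteq> nodes \<nu> \<Longrightarrow> \<nu> ` e \<subseteq> Z \<Longrightarrow> excess \<nu> E Z \<le> - 3" by (meson not_le)
        note ae = add_edge[OF st e inj eE this]
        show ?thesis by (intro exI[of _ \<nu>] exI[of _ g] exI[of _ "insert e E"]) (use ae o in auto)
      next
        case True
        then obtain Z0 where Z0: "Z0 \<subseteq> nodes \<nu>" "\<nu> ` e \<subseteq> Z0" "excess \<nu> E Z0 > - 3" by blast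
        from maximal_excess[OF eV, of E] obtain W where W: "\<nu> ` e \<subseteq> W" "strict_max \<nu> E W"
          and Wm: "\<forall>Z. \<nu> ` e \<subseteq> Z \<longrightarrow> Z \<subseteq> nodes \<nu> \<longrightarrow> excess \<nu> E Z \<le> excess \<nu> E W" by metis
        have WV: "W \<subseteq> nodes \<nu>" using W by (simp add: strict_max_def)
        have "excess \<nu> E W \<le> - 2" using sparse_excess[OF sp WV c2'] W(1) WV by simp
        moreover have "excess \<nu> E W > - 3" using Wm[rule_format, OF Z0(2,1)] Z0(3) by simp
        ultimately have tW: "excess \<nu> E W = - 2" by simp
        have W0: "0 \<notin> W"
        proof
          assume "0 \<in> W"
          then have "excess \<nu> E W \<le> excess \<nu> E U" using Um W(1) WV by simp
          then show False using tW loose by simp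
        qed
        show ?thesis
        proof (rule contract_step[OF st W(2) tW W0 W(1) e(2)])
          fix X x c Z \<nu>1 E1
          assume s1: "\<nu>1 = mrg X x \<nu>" "X \<subseteq> W" "x \<in> X" "c \<in> sig \<nu> g" "cols \<nu>1 c E1 \<subseteq> cols \<nu> g E"
            "rooted \<nu>1 E1 Z" "excess \<nu>1 E1 Z = - 2" "2 \<le> card Z"
            and wz: "\<And>v. v \<in> Z - {0} \<Longrightarrow> single \<nu>1 v \<or> wt \<nu>1 {v} c = 0" and cn: "card (nodes \<nu>1) \<le> card (nodes \<nu>)"
            and ps: "psi \<nu>1 E1 = psi \<nu> E \<and> const_on (cols \<nu>1 c E1) e \<or> psi \<nu>1 E1 = psi \<nu> E + 1"
          have "wt \<nu>1 {0} d = wt \<nu> {0} d" for d unfolding s1(1) using s1(2,3) W0 by (intro wt_mrg_other) auto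
          then have o1: "oriented s \<nu>1 c" using o mrg_sig_subset[OF s1(4), of X x] s1(1) by (auto simp: oriented_def)
          have "\<bar>wt \<nu>1 {v} c\<bar> \<le> 1" if "v \<in> Z - {0}" for v
            using wz[OF that] abs_wt_single[of \<nu>1 v c] rootedD(7)[OF s1(6)] that by auto
          from commit_oriented[OF s1(6) this o1] obtain d where d: "d \<in> sig \<nu>1 c" "proper (inside \<nu>1 E1 Z) d"
            "\<bar>wt \<nu>1 Z d\<bar> \<le> 1" "oriented s (mrg Z 0 \<nu>1) d" by blast
          note cs = commit_state[OF s1(6) d(1-3)]
          let ?\<nu> = "mrg Z 0 \<nu>1" and ?E = "E1 - inside \<nu>1 E1 Z"
          have sub: "cols ?\<nu> d ?E \<subseteq> cols \<nu> g E" using cs(2) s1(5) by blast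
          from ps show ?thesis
          proof
            assume a: "psi \<nu>1 E1 = psi \<nu> E \<and> const_on (cols \<nu>1 c E1) e"
            then have "const_on (cols ?\<nu> d ?E) e" using const_on_subset cs(2) by blast
            then show ?thesis using cs(1,3) d(4) a s1(7) sub
              by (intro exI[of _ ?\<nu>] exI[of _ d] exI[of _ ?E]) auto
          next
            assume a: "psi \<nu>1 E1 = psi \<nu> E + 1"
            have "card (nodes ?\<nu>) < card (nodes \<nu>)" using card_nodes_commit[OF s1(6,8)] cn by simp
            from less.hyps[OF this cs(1) d(4)] obtain \<nu>' g' E' where n': "state \<nu>' g' E'" "oriented s \<nu>' g'"
              "cols \<nu>' g' E' \<subseteq> cols ?\<nu> d ?E" "const_on (cols \<nu>' g' E') e" "psi ?\<nu> ?E - 1 \<le> psi \<nu>' E'" by blast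
            have "psi ?\<nu> ?E = psi \<nu> E" using cs(3) a s1(7) by simp
            then show ?thesis using n' sub by (intro exI[of _ \<nu>'] exI[of _ g'] exI[of _ E']) auto
          qed
        qed
      qed
    qed
  qed
qed

text \<open>The bound on \<open>total\<close> is inherited by subsets of the colorings, so it never has to be re-established.\<close>

definition closed_root :: "bool \<Rightarrow> (nat \<Rightarrow> nat) \<Rightarrow> coloring \<Rightarrow> nat set set \<Rightarrow> bool" where
  "closed_root s \<nu> g E \<longleftrightarrow> oriented s \<nu> g \<and> (\<forall>c\<in>cols \<nu> g E. c 0 = s \<longrightarrow> total c \<ge> - 1)"

text \<open>For this color of ball \<open>0\<close> the weight outside \<open>U\<close> is never
  negative, so root weight 0 or \<open>-1\<close> bounds the total from below. The coloring
  \<open>c1\<close> has negative weight on \<open>U\<close>, which lets the root path reach such a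
  value even if the root had weight 1.\<close>

lemma close_root:
  assumes st: "state \<nu> g E" and U: "strict_max \<nu> E U" "0 \<in> U"
    and c1: "c1 \<in> cols \<nu> g E" "wt \<nu> {0} c1 \<ge> 0" "total c1 < 0"
    and nn: "\<And>c. c \<in> cols \<nu> g E \<Longrightarrow> c 0 = c1 0 \<Longrightarrow> wt \<nu> (nodes \<nu> - U) c \<ge> 0"
  shows "\<exists>c\<in>sig \<nu> g. proper (inside \<nu> E U) c \<and> \<bar>wt \<nu> U c\<bar> \<le> 1 \<and> closed_root (c1 0) (mrg U 0 \<nu>) c (E - inside \<nu> E U)"
proof -
  have r: "rooted \<nu> E U" by (rule rooted_state[OF st U])
  note R = rootedD[OF r]
  let ?I = "inside \<nu> E U"
  have c1s: "c1 \<in> sig \<nu> g" and c1p: "proper E c1" using c1 by (auto simp: cols_def)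
  have c1I: "proper ?I c1" by (rule proper_mono[OF c1p]) (auto simp: inside_def)
  have wU: "wt \<nu> U d = total d - wt \<nu> (nodes \<nu> - U) d" for d using wt_Diff[OF R(7), of \<nu> d] by (simp add: wt_nodes)
  have neg: "wt \<nu> U c1 \<le> - 1" using wU[of c1] nn[OF c1(1)] c1(3) by simp
  define t :: int where "t = (if even (wt \<nu> U c1) then 0 else - 1)"
  have "even (wt \<nu> U c1 - t)" by (simp add: t_def)
  moreover have "wt \<nu> U c1 \<le> t" "t \<le> wt \<nu> {0} c1 + 1" using neg c1(2) by (auto simp: t_def)
  moreover have "\<bar>wt \<nu> {v} g\<bar> \<le> 1" if "v \<in> U - {0}" for v
    using state_single[OF st] abs_wt_single[of \<nu> v g] that R(7) by auto
  ultimately obtain c where c: "c \<in> sig \<nu> g" "proper ?I c" "\<forall>a. \<nu> a = 0 \<longrightarrow> c a = c1 a" "wt \<nu> U c = t"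
    using weight_attained[OF R(1,7,3) c1s c1I, of t] by blast
  have t: "t = 0 \<or> t = - 1" by (simp add: t_def)
  have or: "oriented (c1 0) (mrg U 0 \<nu>) c" by (rule oriented_merged[OF r]) (use c R(5) t in auto)
  have w1: "\<bar>wt \<nu> U c\<bar> \<le> 1" using c(4) t by auto
  note cs = commit_state[OF r c(1,2) w1]
  have "total d \<ge> - 1" if d: "d \<in> cols (mrg U 0 \<nu>) c (E - ?I)" "d 0 = c1 0" for d
  proof -
    have "d \<in> sig (mrg U 0 \<nu>) c" using d(1) by (simp add: cols_def)
    then have "wt (mrg U 0 \<nu>) {0} d = 0 \<or> wt (mrg U 0 \<nu>) {0} d = - 1" using or d(2) unfolding oriented_def by blast
    then have "wt \<nu> U d \<ge> - 1" using wt_mrg_merged[OF U(2), of \<nu> d] by auto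
    then show ?thesis using wU[of d] nn[of d] cs(2) d by auto
  qed
  then have "closed_root (c1 0) (mrg U 0 \<nu>) c (E - ?I)" using or by (simp add: closed_root_def)
  then show ?thesis using c w1 by blast
qed

lemma open_root_from_block:
  assumes "c' \<in> cols \<nu> g E" "total c' \<le> wt \<nu>0 Y c" "wt \<nu>0 Y c \<le> 0" "odd n" "wt \<nu> {0} c' \<ge> 0"
  shows "open_root \<nu> g E"
proof -
  have "odd (total c')" using total_parity assms(4) by simp
  then have "total c' < 0" using assms(2,3) by (cases "total c' = 0") auto
  then show ?thesis unfolding open_root_def using assms(1,5) by blast
qed

text \<open>\<open>Y\<close> will witness openness after the query. If \<open>U\<close> has excess
  \<open>-3\<close>, a set over \<open>Y\<close> and \<open>e\<close> of excess \<open>-3\<close>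
  would lie in \<open>U\<close>, so \<open>Y\<close> is chosen to meet \<open>U\<close> only in the
  root. If \<open>U\<close> has smaller excess, no such set exists by maximality.\<close>

lemma far_block:
  assumes st: "state \<nu> g E" and U: "insert 0 (\<nu> ` e) \<subseteq> U" "strict_max \<nu> E U" "excess \<nu> E U \<le> - 3"
    and Um: "\<And>Z. insert 0 (\<nu> ` e) \<subseteq> Z \<Longrightarrow> Z \<subseteq> nodes \<nu> \<Longrightarrow> excess \<nu> E Z \<le> excess \<nu> E U"
    and c1: "c1 \<in> cols \<nu> g E" "wt \<nu> {0} c1 \<ge> 0" "total c1 < 0"
    and ex: "excess \<nu> E U = - 3 \<Longrightarrow> \<exists>c\<in>cols \<nu> g E. c 0 = c1 0 \<and> wt \<nu> (nodes \<nu> - U) c < 0"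
  shows "\<exists>Y. \<exists>c\<in>cols \<nu> g E. strict_max \<nu> E Y \<and> excess \<nu> E Y = - 2 \<and> 0 \<in> Y \<and> wt \<nu> {0} c \<ge> 0 \<and> wt \<nu> Y c \<le> 0 \<and>
    (\<forall>Z. Y \<union> \<nu> ` e \<subseteq> Z \<longrightarrow> Z \<subseteq> nodes \<nu> \<longrightarrow> excess \<nu> E Z \<le> - 4)"
proof -
  have sp: "sparse \<nu> E" and z0: "\<nu> 0 = 0" and w0: "\<bar>wt \<nu> {0} g\<bar> \<le> 1" using st by (auto simp: state_def)
  have UV: "U \<subseteq> nodes \<nu>" using U by (simp add: strict_max_def)
  have "\<exists>Y. \<exists>c\<in>cols \<nu> g E. strict_max \<nu> E Y \<and> excess \<nu> E Y = - 2 \<and> 0 \<in> Y \<and> wt \<nu> {0} c = wt \<nu> {0} c1 \<and> wt \<nu> (Y - {0}) c < 0 \<and>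
    (excess \<nu> E U = - 3 \<longrightarrow> Y \<inter> U = {0})"
  proof (cases "excess \<nu> E U = - 3")
    case True
    from ex[OF True] obtain c where c: "c \<in> cols \<nu> g E" "c 0 = c1 0" "wt \<nu> (nodes \<nu> - U) c < 0" by blast
    have "Y \<subseteq> U" if "strict_max \<nu> E Y" "excess \<nu> E Y = - 2" "0 \<in> Y" "u \<in> Y \<inter> U" "u \<noteq> 0" for Y u
      by (rule tight_absorbed[OF sp U(2), of Y 0 u]) (use that U(1) in \<open>auto simp: strict_max_def\<close>)
    then obtain Y where Y: "strict_max \<nu> E Y" "excess \<nu> E Y = - 2" "Y \<inter> U = {0}" "wt \<nu> (Y - {0}) c < 0"
      using negative_block[OF sp _ UV _ c(3), of 0] U(1) by blast
    have "wt \<nu> {0} c = wt \<nu> {0} c1" using wt_sig_same[of c \<nu> g c1 0] c c1(1) z0 by (simp add: cols_def)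
    moreover have "0 \<in> Y" using Y(3) by blast
    ultimately show ?thesis using Y c(1) by blast
  next
    case False
    have "wt \<nu> (nodes \<nu> - {0}) c1 = total c1 - wt \<nu> {0} c1"
      using wt_Diff[of "{0}" "nodes \<nu>" \<nu> c1] state_nodes_0[OF st] by (simp add: wt_nodes)
    then have "wt \<nu> (nodes \<nu> - {0}) c1 < 0" using c1 by simp
    then obtain Y where Y: "strict_max \<nu> E Y" "excess \<nu> E Y = - 2" "Y \<inter> {0} = {0}" "wt \<nu> (Y - {0}) c1 < 0"
      using negative_block[OF sp, of 0 "{0}" c1] state_nodes_0[OF st] by blast
    then have "0 \<in> Y" by blast
    then show ?thesis using Y c1(1) False by blast
  qed
  then obtain Y c where Y: "c \<in> cols \<nu> g E" "strict_max \<nu> E Y" "excess \<nu> E Y = - 2" "0 \<in> Y"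
    "wt \<nu> {0} c = wt \<nu> {0} c1" "wt \<nu> (Y - {0}) c < 0" "excess \<nu> E U = - 3 \<longrightarrow> Y \<inter> U = {0}" by blast
  have "c \<in> sig \<nu> g" using Y(1) by (simp add: cols_def)
  then have "\<bar>wt \<nu> {0} c\<bar> \<le> 1" using wt_sig_abs[OF _ sig_refl] w0 by metis
  moreover have "wt \<nu> (Y - {0}) c = wt \<nu> Y c - wt \<nu> {0} c" using Y(4) by (intro wt_Diff) auto
  ultimately have wY: "wt \<nu> Y c \<le> 0" using Y(6) by simp
  have "excess \<nu> E Z \<le> - 4" if Z: "Y \<union> \<nu> ` e \<subseteq> Z" "Z \<subseteq> nodes \<nu>" for Z
  proof (rule ccontr)
    assume n4: "\<not> ?thesis"
    have A: "insert 0 (\<nu> ` e) \<subseteq> Z" using Z Y(4) by blast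
    have "excess \<nu> E Z \<le> excess \<nu> E U" by (rule Um[OF A Z(2)])
    then have u3: "excess \<nu> E U = - 3" "excess \<nu> E Z = - 3" using U(3) n4 by auto
    have "excess \<nu> E (Z \<inter> U) \<le> excess \<nu> E U" by (rule Um) (use A U(1) UV in auto)
    then have "Z \<subseteq> U" using u3 by (intro strict_max_absorbs[OF sparse_finite[OF sp] U(2) Z(2)]) simp
    then have "Y = {0}" using Y(7) u3(1) Z(1) by blast
    then show False using Y(6) by simp
  qed
  then show ?thesis using Y wY c1(2) by (intro exI[of _ Y] bexI[of _ c]) auto
qed

text \<open>The margin \<open>-4\<close> leaves at most \<open>-3\<close> after the new edge, so
  \<open>Y\<close> stays strictly maximal. Extending its coloring gives a total that is at most 0
  and odd, hence negative.\<close>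

lemma open_step_add_edge:
  assumes st: "state \<nu> g E" and n: "odd n" and e: "e \<subseteq> {..<n}" "card e = 3" "inj_on \<nu> e" "e \<notin> E"
    and ex: "\<And>Z. Z \<subseteq> nodes \<nu> \<Longrightarrow> \<nu> ` e \<subseteq> Z \<Longrightarrow> excess \<nu> E Z \<le> - 3"
    and Y: "strict_max \<nu> E Y" "excess \<nu> E Y = - 2" "0 \<in> Y" and far: "\<And>Z. Y \<union> \<nu> ` e \<subseteq> Z \<Longrightarrow> Z \<subseteq> nodes \<nu> \<Longrightarrow> excess \<nu> E Z \<le> - 4"
    and c: "c \<in> cols \<nu> g E" "wt \<nu> {0} c \<ge> 0" "wt \<nu> Y c \<le> 0"
  shows "open_root \<nu> g (insert e E)"
proof -
  have sp: "sparse \<nu> E" using st by (simp add: state_def)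
  have fE: "finite E" using sp by (rule sparse_finite)
  note ae = add_edge[OF st e ex]
  have sp': "sparse \<nu> (insert e E)" using ae(1) by (simp add: state_def)
  have YV: "Y \<subseteq> nodes \<nu>" using Y by (simp add: strict_max_def)
  note ei = excess_insert[OF fE e(4), of \<nu>]
  have eY: "\<not> \<nu> ` e \<subseteq> Y" using far[of Y] YV Y(2) by auto
  have "strict_max \<nu> (insert e E) Y"
    unfolding strict_max_def
  proof (intro conjI allI impI YV)
    fix Z assume Z: "Y \<subset> Z" "Z \<subseteq> nodes \<nu>"
    show "excess \<nu> (insert e E) Z < excess \<nu> (insert e E) Y"
    proof (cases "\<nu> ` e \<subseteq> Z")
      case True
      then have "excess \<nu> E Z \<le> - 4" using Z by (intro far) auto
      then show ?thesis using ei[of Z] ei[of Y] eY Y(2) by simp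
    next
      case False
      have "excess \<nu> E Z < excess \<nu> E Y" using Y(1) Z by (simp add: strict_max_def)
      then show ?thesis using ei[of Z] ei[of Y] eY False by simp
    qed
  qed
  moreover have cs: "c \<in> sig \<nu> g" "proper E c" using c by (auto simp: cols_def)
  moreover have "proper (inside \<nu> (insert e E) Y) c" by (rule proper_mono[OF cs(2)]) (use eY in \<open>auto simp: inside_def\<close>)
  ultimately obtain c' where c': "c' \<in> cols \<nu> g (insert e E)" "total c' \<le> wt \<nu> Y c" "\<forall>b. \<nu> b \<in> Y \<longrightarrow> c' b = c b"
    using extend_block[OF sp' _ Y(3)] by blast
  have "wt \<nu> {0} c' = wt \<nu> {0} c" using c'(3) Y(3) by (intro wt_cong) auto
  then show ?thesis using open_root_from_block[OF c'(1,2) c(3) n] c(2) by simp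
qed

text \<open>The block and \<open>W\<close> are disjoint: a common node would give
  \<open>-2 - 2 \<le> -4 - 1\<close> by supermodularity. Thus \<open>Y\<close> survives the
  contraction.\<close>

lemma open_root_contracted:
  assumes st: "state \<nu> g E" and n: "odd n" and W: "strict_max \<nu> E W" "excess \<nu> E W = - 2" "0 \<notin> W" and e: "\<nu> ` e \<subseteq> W"
    and X: "X \<subseteq> W" "x \<in> X" "d \<in> sig \<nu> g"
    and Y: "strict_max \<nu> E Y" "excess \<nu> E Y = - 2" "0 \<in> Y" and far: "\<And>Z. Y \<union> \<nu> ` e \<subseteq> Z \<Longrightarrow> Z \<subseteq> nodes \<nu> \<Longrightarrow> excess \<nu> E Z \<le> - 4"
    and c: "c \<in> cols \<nu> g E" "wt \<nu> {0} c \<ge> 0" "wt \<nu> Y c \<le> 0"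
  shows "open_root (mrg X x \<nu>) d (E - inside \<nu> E W)"
proof -
  have sp: "sparse \<nu> E" using st by (simp add: state_def)
  have WV: "W \<subseteq> nodes \<nu>" and YV: "Y \<subseteq> nodes \<nu>" using W Y by (auto simp: strict_max_def)
  have fW: "finite W" and fY: "finite Y" using WV YV finite_subset[OF _ finite_nodes] by blast+
  have YW: "Y \<inter> W = {}"
  proof (rule ccontr)
    assume ne: "Y \<inter> W \<noteq> {}"
    have "excess \<nu> E (Y \<inter> W) \<le> - 1"
    proof (cases "2 \<le> card (Y \<inter> W)")
      case True
      then have "excess \<nu> E (Y \<inter> W) \<le> - 2" using YV by (intro sparse_excess[OF sp]) auto
      then show ?thesis by simp
    next
      case False
      have "inside \<nu> E (Y \<inter> W) = {}"
      proof (rule ccontr)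
        assume "inside \<nu> E (Y \<inter> W) \<noteq> {}"
        then obtain f where f: "f \<in> E" "\<nu> ` f \<subseteq> Y \<inter> W" by (auto simp: inside_def)
        then have "card (\<nu> ` f) \<le> card (Y \<inter> W)" using fY by (intro card_mono) auto
        then show False using sparse_edge(4)[OF sp f(1)] False by simp
      qed
      moreover have "card (Y \<inter> W) \<ge> 1" using ne fY by (simp add: Suc_le_eq card_gt_0_iff)
      ultimately show ?thesis by (simp add: excess_def)
    qed
    moreover have "excess \<nu> E (Y \<union> W) \<le> - 4" by (rule far) (use e YV WV in auto)
    moreover have "excess \<nu> E Y + excess \<nu> E W \<le> excess \<nu> E (Y \<union> W) + excess \<nu> E (Y \<inter> W)"
      by (rule excess_supermodular[OF sparse_finite[OF sp] fY fW])
    ultimately show False using Y(2) W(2) by simp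
  qed
  have cs: "c \<in> sig \<nu> g" "proper E c" using c by (auto simp: cols_def)
  have cI: "proper (inside \<nu> E Y) c" by (rule proper_mono[OF cs(2)]) (auto simp: inside_def)
  have bnd: "excess \<nu> E (Z \<union> W) - excess \<nu> E W - int (card (Z \<inter> W)) < excess \<nu> E Y"
    if Z: "Y \<subset> Z" "x \<in> Z" "Z \<subseteq> nodes \<nu>" for Z
  proof -
    have "excess \<nu> E (Z \<union> W) \<le> - 4" by (rule far) (use Z e WV in auto)
    moreover have "card (Z \<inter> W) \<ge> 1" using Z(2) X(1,2) fW by (auto simp: Suc_le_eq card_gt_0_iff)
    ultimately show ?thesis using W(2) Y(2) by simp
  qed
  have YX: "Y \<inter> X = {}" "card (Y \<inter> W) \<le> 1" using YW X(1) by auto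
  from extend_persistent_block[OF sp W(1) X(1,2) Y(1) YX Y(3) bnd cs(1) cI X(3)] obtain c' where
    c': "c' \<in> cols (mrg X x \<nu>) d (E - inside \<nu> E W)" "total c' \<le> wt \<nu> Y c" "\<forall>b. \<nu> b \<in> Y \<longrightarrow> c' b = c b" by blast
  have "wt (mrg X x \<nu>) {0} c' = wt \<nu> {0} c'" using X(1,2) W(3) by (intro wt_mrg_other) auto
  also have "\<dots> = wt \<nu> {0} c" using c'(3) Y(3) by (intro wt_cong) auto
  finally show ?thesis using open_root_from_block[OF c'(1,2) c(3) n] c(2) by simp
qed

text \<open>The cases of \<open>oriented_step\<close> recur. The new question arises when no tight
  set contains ball \<open>0\<close> and the query: either the root is closed along a set of excess
  \<open>-3\<close>, which costs 2, or a far block keeps it open.\<close>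

lemma open_step:
  assumes "state \<nu> g E" "open_root \<nu> g E" "psi \<nu> E \<ge> 3" and n: "odd n" and e: "e \<subseteq> {..<n}" "card e = 3"
  shows "\<exists>\<nu>' g' E'. state \<nu>' g' E' \<and> cols \<nu>' g' E' \<subseteq> cols \<nu> g E \<and> const_on (cols \<nu>' g' E') e \<and>
    (open_root \<nu>' g' E' \<and> psi \<nu> E - 1 \<le> psi \<nu>' E' \<or> (\<exists>s. closed_root s \<nu>' g' E') \<and> psi \<nu> E - 2 \<le> psi \<nu>' E')"
  using assms(1-3)
proof (induction "card (nodes \<nu>)" arbitrary: \<nu> g E rule: less_induct)
  case less
  note st = less.prems(1) and op = less.prems(2) and p3 = less.prems(3)
  have sp: "sparse \<nu> E" and w0: "\<bar>wt \<nu> {0} g\<bar> \<le> 1" using st by (auto simp: state_def)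
  have fe: "finite e" using e by (intro card_ge_0_finite) simp
  show ?case
  proof (cases "const_on (cols \<nu> g E) e")
    case True
    then show ?thesis using st op by (intro exI[of _ \<nu>] exI[of _ g] exI[of _ E]) auto
  next
    case nc: False
    have eV: "\<nu> ` e \<subseteq> nodes \<nu>" using e by (auto simp: nodes_def)
    have AV: "insert 0 (\<nu> ` e) \<subseteq> nodes \<nu>" using eV state_nodes_0[OF st] by simp
    have c2: "2 \<le> card (\<nu> ` e)" by (rule two_nodes_of_query[OF nc fe])
    have c2': "2 \<le> card Z" if "\<nu> ` e \<subseteq> Z" "Z \<subseteq> nodes \<nu>" for Z
      using card_mono[OF finite_subset[OF that(2) finite_nodes] that(1)] c2 by simp
    from maximal_excess[OF AV, of E] obtain U where U: "insert 0 (\<nu> ` e) \<subseteq> U" "strict_max \<nu> E U"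
      and Um: "\<forall>Z. insert 0 (\<nu> ` e) \<subseteq> Z \<longrightarrow> Z \<subseteq> nodes \<nu> \<longrightarrow> excess \<nu> E Z \<le> excess \<nu> E U" by metis
    have UV: "U \<subseteq> nodes \<nu>" and U0: "0 \<in> U" and Ue: "\<nu> ` e \<subseteq> U" using U by (auto simp: strict_max_def)
    have r: "rooted \<nu> E U" by (rule rooted_state[OF st U(2) U0])
    have "excess \<nu> E U \<le> - 2" using sparse_excess[OF sp UV c2'[OF Ue UV]] .
    then consider (tight) "excess \<nu> E U = - 2" | (loose) "excess \<nu> E U \<le> - 3" by linarith
    then show ?thesis
    proof cases
      case tight
      have "single \<nu> v \<or> wt \<nu> {v} g = 0" if "v \<in> U - {0}" for v using state_single[OF st] that UV by auto
      from commit_open[OF r tight p3 c2'[OF Ue UV] n this w0 op] obtain c where c: "c \<in> sig \<nu> g"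
        "proper (inside \<nu> E U) c" "\<bar>wt \<nu> U c\<bar> \<le> 1" "open_root (mrg U 0 \<nu>) c (E - inside \<nu> E U)" by blast
      note cs = commit_state[OF r c(1-3)]
      show ?thesis
        by (intro exI[of _ "mrg U 0 \<nu>"] exI[of _ c] exI[of _ "E - inside \<nu> E U"]) (use cs c(4) tight Ue in auto)
    next
      case loose
      from op obtain c1 where c1: "c1 \<in> cols \<nu> g E" "wt \<nu> {0} c1 \<ge> 0" "total c1 < 0" by (auto simp: open_root_def)
      show ?thesis
      proof (cases "excess \<nu> E U = - 3 \<and> (\<forall>c\<in>cols \<nu> g E. c 0 = c1 0 \<longrightarrow> wt \<nu> (nodes \<nu> - U) c \<ge> 0)")
        case True
        from close_root[OF st U(2) U0 c1] True obtain c where c: "c \<in> sig \<nu> g" "proper (inside \<nu> E U) c"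
          "\<bar>wt \<nu> U c\<bar> \<le> 1" "closed_root (c1 0) (mrg U 0 \<nu>) c (E - inside \<nu> E U)" by blast
        note cs = commit_state[OF r c(1-3)]
        show ?thesis
          by (intro exI[of _ "mrg U 0 \<nu>"] exI[of _ c] exI[of _ "E - inside \<nu> E U"]) (use cs c(4) True Ue in auto)
      next
        case False
        then have "\<exists>c\<in>cols \<nu> g E. c 0 = c1 0 \<and> wt \<nu> (nodes \<nu> - U) c < 0" if "excess \<nu> E U = - 3"
          using that by (meson not_le)
        from far_block[OF st U loose Um[rule_format] c1 this] obtain Y c where c: "c \<in> cols \<nu> g E" "wt \<nu> {0} c \<ge> 0" "wt \<nu> Y c \<le> 0"
          and Y: "strict_max \<nu> E Y" "excess \<nu> E Y = - 2" "0 \<in> Y"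
          and far: "\<forall>Z. Y \<union> \<nu> ` e \<subseteq> Z \<longrightarrow> Z \<subseteq> nodes \<nu> \<longrightarrow> excess \<nu> E Z \<le> - 4" by blast
        have "excess \<nu> E (insert 0 (\<nu> ` e)) \<le> - 3" using Um[rule_format, OF subset_refl AV] loose by simp
        then have inj: "inj_on \<nu> e" by (rule query_inj[OF st e(2)])
        have eE: "e \<notin> E" using nc by (auto simp: const_on_def cols_def proper_def)
        show ?thesis
        proof (cases "\<exists>Z\<subseteq>nodes \<nu>. \<nu> ` e \<subseteq> Z \<and> excess \<nu> E Z > - 3")
          case False
          then have l3: "\<And>Z. Z \<subseteq> nodes \<nu> \<Longrightarrow> \<nu> ` e \<subseteq> Z \<Longrightarrow> excess \<nu> E Z \<le> - 3" by (meson not_le)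
          note ae = add_edge[OF st e inj eE l3]
          have "open_root \<nu> g (insert e E)" by (rule open_step_add_edge[OF st n e inj eE l3 Y far[rule_format] c])
          then show ?thesis by (intro exI[of _ \<nu>] exI[of _ g] exI[of _ "insert e E"]) (use ae in auto)
        next
          case True
          then obtain Z0 where Z0: "Z0 \<subseteq> nodes \<nu>" "\<nu> ` e \<subseteq> Z0" "excess \<nu> E Z0 > - 3" by blast
          from maximal_excess[OF eV, of E] obtain W where W: "\<nu> ` e \<subseteq> W" "strict_max \<nu> E W"
            and Wm: "\<forall>Z. \<nu> ` e \<subseteq> Z \<longrightarrow> Z \<subseteq> nodes \<nu> \<longrightarrow> excess \<nu> E Z \<le> excess \<nu> E W" by metis
          have WV: "W \<subseteq> nodes \<nu>" using W by (simp add: strict_max_def)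
          have "excess \<nu> E W \<le> - 2" using sparse_excess[OF sp WV c2'] W(1) WV by simp
          moreover have "excess \<nu> E W > - 3" using Wm[rule_format, OF Z0(2,1)] Z0(3) by simp
          ultimately have tW: "excess \<nu> E W = - 2" by simp
          have W0: "0 \<notin> W"
          proof
            assume "0 \<in> W"
            then have "excess \<nu> E W \<le> excess \<nu> E U" using Um W(1) WV by simp
            then show False using tW loose by simp
          qed
          show ?thesis
          proof (rule contract_step[OF st W(2) tW W0 W(1) e(2)])
            fix X x c' Z \<nu>1 E1
            assume s0: "\<nu>1 = mrg X x \<nu>" "E1 = E - inside \<nu> E W"
              and s1: "X \<subseteq> W" "x \<in> X" "c' \<in> sig \<nu> g" "cols \<nu>1 c' E1 \<subseteq> cols \<nu> g E"
              "rooted \<nu>1 E1 Z" "excess \<nu>1 E1 Z = - 2" "2 \<le> card Z"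
              and wz: "\<And>v. v \<in> Z - {0} \<Longrightarrow> single \<nu>1 v \<or> wt \<nu>1 {v} c' = 0" and cn: "card (nodes \<nu>1) \<le> card (nodes \<nu>)"
              and ps: "psi \<nu>1 E1 = psi \<nu> E \<and> const_on (cols \<nu>1 c' E1) e \<or> psi \<nu>1 E1 = psi \<nu> E + 1"
            have op1: "open_root \<nu>1 c' E1" unfolding s0
              by (rule open_root_contracted[OF st n W(2) tW W0 W(1) s1(1-3) Y far[rule_format] c])
            have "wt \<nu>1 {0} c' = wt \<nu> {0} c'" unfolding s0(1) using s1(1,2) W0 by (intro wt_mrg_other) auto
            then have w1: "\<bar>wt \<nu>1 {0} c'\<bar> \<le> 1" using wt_sig_abs[OF s1(3) sig_refl, of 0] w0 by simp
            have p1: "psi \<nu>1 E1 \<ge> 3" using ps p3 by auto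
            from commit_open[OF s1(5,6) p1 s1(7) n wz w1 op1] obtain d where d: "d \<in> sig \<nu>1 c'" "proper (inside \<nu>1 E1 Z) d"
              "\<bar>wt \<nu>1 Z d\<bar> \<le> 1" "open_root (mrg Z 0 \<nu>1) d (E1 - inside \<nu>1 E1 Z)" by blast
            note cs = commit_state[OF s1(5) d(1-3)]
            let ?\<nu> = "mrg Z 0 \<nu>1" and ?E = "E1 - inside \<nu>1 E1 Z"
            have sub: "cols ?\<nu> d ?E \<subseteq> cols \<nu> g E" using cs(2) s1(4) by blast
            from ps show ?thesis
            proof
              assume a: "psi \<nu>1 E1 = psi \<nu> E \<and> const_on (cols \<nu>1 c' E1) e"
              then have "const_on (cols ?\<nu> d ?E) e" using const_on_subset cs(2) by blast
              then show ?thesis using cs(1,3) d(4) a s1(6) sub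
                by (intro exI[of _ ?\<nu>] exI[of _ d] exI[of _ ?E]) auto
            next
              assume a: "psi \<nu>1 E1 = psi \<nu> E + 1"
              have "card (nodes ?\<nu>) < card (nodes \<nu>)" using card_nodes_commit[OF s1(5,7)] cn by simp
              moreover have ps2: "psi ?\<nu> ?E = psi \<nu> E" using cs(3) a s1(6) by simp
              ultimately obtain \<nu>' g' E' where n': "state \<nu>' g' E'" "cols \<nu>' g' E' \<subseteq> cols ?\<nu> d ?E"
                "const_on (cols \<nu>' g' E') e" "open_root \<nu>' g' E' \<and> psi ?\<nu> ?E - 1 \<le> psi \<nu>' E' \<or>
                  (\<exists>s. closed_root s \<nu>' g' E') \<and> psi ?\<nu> ?E - 2 \<le> psi \<nu>' E'"
                using less.hyps[OF _ cs(1) d(4)] p3 by metis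
              then show ?thesis using sub unfolding ps2 by (intro exI[of _ \<nu>'] exI[of _ g'] exI[of _ E']) auto
            qed
          qed
        qed
      qed
    qed
  qed
qed

section \<open>Lower bounds\<close>

lemma majority_color_iff_total: "majority_color n c col \<longleftrightarrow> val col * total c > 0"
proof -
  let ?T = "{i. i < n \<and> c i}" and ?F = "{i. i < n \<and> \<not> c i}"
  have un: "?T \<union> ?F = {..<n}" "?T \<inter> ?F = {}" by auto
  then have n: "card ?T + card ?F = n" using card_Un_disjoint[of ?T ?F] by simp
  have "total c = (\<Sum>i\<in>?T. val (c i)) + (\<Sum>i\<in>?F. val (c i))"
    unfolding total_def un(1)[symmetric] by (rule sum.union_disjoint) (use un in auto)
  also have "(\<Sum>i\<in>?T. val (c i)) = (\<Sum>i\<in>?T. 1)" by (rule sum.cong) (auto simp: val_def)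
  also have "(\<Sum>i\<in>?F. val (c i)) = (\<Sum>i\<in>?F. - 1)" by (rule sum.cong) (auto simp: val_def)
  finally have "total c = int (card ?T) - int (card ?F)" by simp
  then show ?thesis using n by (cases col) (auto simp: majority_color_def val_def)
qed

lemma correct_output_None_iff: "correct_output n c None \<longleftrightarrow> total c = 0"
proof
  assume "correct_output n c None"
  then have "\<not> majority_color n c True" "\<not> majority_color n c False" by auto
  then show "total c = 0" by (simp add: majority_color_iff_total val_def)
qed (simp add: majority_color_iff_total)

lemma state_root_path:
  assumes st: "state \<nu> g E" and c: "c \<in> cols \<nu> g E"
  obtains D m k where "\<And>i. i \<le> m \<Longrightarrow> D i \<in> cols \<nu> g E \<and> D i 0 = c 0"
    "\<And>i. i < m \<Longrightarrow> total (D (Suc i)) = total (D i) + 2 \<or> total (D (Suc i)) = total (D i) - 2"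
    "k \<le> m" "D k = c" "total (D 0) + total (D m) = 2 * wt \<nu> {0} c" "Suc m = card (nodes \<nu>)"
proof -
  have sp: "sparse \<nu> E" and z: "\<nu> 0 = 0" using st by (auto simp: state_def)
  have cs: "c \<in> sig \<nu> g" "proper (inside \<nu> E (nodes \<nu>)) c" using c sp by (auto simp: cols_def inside_nodes)
  show ?thesis
  proof (rule root_path[OF sp subset_refl state_nodes_0[OF st] cs])
    fix D and m k :: nat
    assume D: "\<And>i. i \<le> m \<Longrightarrow> D i \<in> sig \<nu> g \<and> proper (inside \<nu> E (nodes \<nu>)) (D i) \<and> (\<forall>a. \<nu> a = 0 \<longrightarrow> D i a = c a)"
      and st': "\<And>i. i < m \<Longrightarrow> \<exists>v\<in>nodes \<nu> - {0}. D (Suc i) = flp \<nu> {v} (D i)"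
      and k: "k \<le> m" "D k = c" and sum: "wt \<nu> (nodes \<nu>) (D 0) + wt \<nu> (nodes \<nu>) (D m) = 2 * wt \<nu> {0} c"
      and m: "Suc m = card (nodes \<nu>)"
    have 1: "D i \<in> cols \<nu> g E \<and> D i 0 = c 0" if "i \<le> m" for i
      using D[OF that] sp z by (simp add: cols_def inside_nodes)
    have 2: "total (D (Suc i)) = total (D i) + 2 \<or> total (D (Suc i)) = total (D i) - 2" if i: "i < m" for i
    proof -
      from st'[OF i] obtain v where v: "v \<in> nodes \<nu>" "v \<noteq> 0" "D (Suc i) = flp \<nu> {v} (D i)" by blast
      have "total (D (Suc i)) = total (D i) - 2 * val (D i v)"
        using wt_flp_single_node[OF v(1), of \<nu> "D i"] wt_single[OF state_single[OF st v(1,2)] v(1)] v(3) by (simp add: wt_nodes)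
      then show ?thesis by (simp add: val_def)
    qed
    show thesis by (rule that[OF 1 2 k _ m]) (use sum in \<open>simp_all add: wt_nodes\<close>)
  qed
qed

text \<open>A coloring of total 0 refutes every ball. Consecutive colorings of a root path differ in
  total, so one of them refutes \<open>None\<close>; two nodes guarantee such a step.\<close>

lemma no_output_even:
  assumes st: "state \<nu> g E" and "even n" "2 \<le> card (nodes \<nu>)"
  shows "\<exists>c\<in>cols \<nu> g E. \<not> correct_output n c a"
proof -
  have sp: "sparse \<nu> E" using st by (simp add: state_def)
  obtain c0 where c0: "c0 \<in> cols \<nu> g E" using colorable[OF sp] by blast
  have cs: "c0 \<in> sig \<nu> g" "proper (inside \<nu> E (nodes \<nu>)) c0" using c0 sp by (auto simp: cols_def inside_nodes)
  have "\<bar>wt \<nu> {0} c0\<bar> \<le> 1" using wt_sig_abs[OF cs(1) sig_refl, of 0] st by (simp add: state_def)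
  moreover have "even (wt \<nu> (nodes \<nu>) c0)" using total_parity assms(2) by (simp add: wt_nodes)
  moreover have "\<bar>wt \<nu> {v} g\<bar> \<le> 1" if "v \<in> nodes \<nu> - {0}" for v
    using state_single[OF st] abs_wt_single[of \<nu> v g] that by auto
  ultimately obtain c where "c \<in> sig \<nu> g" "proper (inside \<nu> E (nodes \<nu>)) c" "wt \<nu> (nodes \<nu>) c = 0"
    using weight_attained[OF sp subset_refl state_nodes_0[OF st] cs, of 0] by force
  then have c: "c \<in> cols \<nu> g E" "total c = 0" using sp by (auto simp: cols_def inside_nodes wt_nodes)
  show ?thesis
  proof (cases a)
    case (Some b)
    then show ?thesis using c by (intro bexI[of _ c]) (auto simp: majority_color_iff_total)
  next
    case None
    show ?thesis
    proof (rule state_root_path[OF st c(1)])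
      fix D and m k :: nat
      assume D: "\<And>i. i \<le> m \<Longrightarrow> D i \<in> cols \<nu> g E \<and> D i 0 = c 0"
        and step: "\<And>i. i < m \<Longrightarrow> total (D (Suc i)) = total (D i) + 2 \<or> total (D (Suc i)) = total (D i) - 2"
        and m: "Suc m = card (nodes \<nu>)"
      have m0: "0 < m" using m assms(3) by simp
      have "total (D 0) \<noteq> 0 \<or> total (D (Suc 0)) \<noteq> 0" using step[OF m0] by auto
      then show ?thesis using D[of 0] D[of "Suc 0"] m0 None correct_output_None_iff by auto
    qed
  qed
qed

text \<open>\<open>c\<close> and \<open>d\<close> color the root class alike but have opposite
  majorities, which refutes its balls; all other balls are refuted by
  \<open>minority_single\<close>.\<close>

lemma no_output_odd:
  assumes st: "state \<nu> g E" and n: "odd n" "3 \<le> card (nodes \<nu>)"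
    and c: "c \<in> cols \<nu> g E" "total c < 0" and d: "d \<in> cols \<nu> g E" "total d > 0" and cd: "c 0 = d 0"
  shows "\<exists>c\<in>cols \<nu> g E. \<not> correct_output n c a"
proof (cases a)
  case None
  then show ?thesis using c correct_output_None_iff by (intro bexI[of _ c]) auto
next
  case (Some b)
  have sp: "sparse \<nu> E" and z: "\<nu> 0 = 0" and w0: "\<bar>wt \<nu> {0} g\<bar> \<le> 1" using st by (auto simp: state_def)
  show ?thesis
  proof (cases "b < n")
    case False
    then show ?thesis using Some c(1) by (intro bexI[of _ c]) auto
  next
    case b: True
    show ?thesis
    proof (cases "\<nu> b = 0")
      case True
      have "c \<in> sig \<nu> g" "d \<in> sig \<nu> g" using c d by (auto simp: cols_def)
      then have "(c b = c 0) = (d b = d 0)" using sigD[of c \<nu> g b 0] sigD[of d \<nu> g b 0] True z by simp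
      then have "c b = d b" using cd by auto
      then have "\<not> val (c b) * total c > 0 \<or> \<not> val (d b) * total d > 0"
        using c(2) d(2) by (cases "c b") (auto simp: val_def)
      then show ?thesis using c(1) d(1) Some by (auto simp: majority_color_iff_total)
    next
      case False
      have "\<nu> b = b" using False st unfolding state_def by metis
      then have bV: "b \<in> nodes \<nu> - {0}" using b False unfolding nodes_def by (metis DiffI imageI lessThan_iff singletonD)
      have "single \<nu> v" if "v \<in> nodes \<nu> - {0}" for v using state_single[OF st] that by auto
      from minority_single[OF sp state_nodes_0[OF st] w0 this n(2,1) bV] obtain f where
        "f \<in> cols \<nu> g E" "f b" "total f < 0" by blast
      then show ?thesis using Some by (intro bexI[of _ f]) (auto simp: majority_color_iff_total val_def)
    qed
  qed
qed

lemma psi_le_card: "psi \<nu> E \<le> int (card (nodes \<nu>))"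
  by (simp add: psi_def)

text \<open>Each query costs one unit of \<open>psi\<close>; the 2 units kept back guarantee the two
  nodes that \<open>no_output_even\<close> needs.\<close>

lemma even_not_solvable:
  assumes "even n" "state \<nu> g E" "oriented s \<nu> g" "int k + 2 \<le> psi \<nu> E"
  shows "\<not> solvable n k (cols \<nu> g E)"
  using assms(2-4)
proof (induction k arbitrary: \<nu> g E)
  case 0
  then show ?case using psi_le_card[of \<nu> E] by (intro not_solvable no_output_even assms(1)) auto
next
  case (Suc k)
  show ?case
  proof (rule not_solvable)
    show "\<exists>c\<in>cols \<nu> g E. \<not> correct_output n c a" for a
      using Suc.prems psi_le_card[of \<nu> E] by (intro no_output_even assms(1)) auto
    fix l e assume l: "Suc k = Suc l" and e: "e \<subseteq> {..<n}" "card e = 3"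
    from oriented_step[OF Suc.prems(1,2) e] obtain \<nu>' g' E' where s: "state \<nu>' g' E'" "oriented s \<nu>' g'"
      "cols \<nu>' g' E' \<subseteq> cols \<nu> g E" "const_on (cols \<nu>' g' E') e" "psi \<nu> E - 1 \<le> psi \<nu>' E'" by blast
    have "\<not> solvable n l (cols \<nu>' g' E')" using Suc.IH[OF s(1,2)] s(5) Suc.prems(3) l by simp
    then show "\<exists>D\<subseteq>cols \<nu> g E. const_on D e \<and> \<not> solvable n l D" using s(3,4) by blast
  qed
qed

text \<open>Totals on the root path are odd and at least \<open>-1\<close>, and those at its ends
  sum to 0 or \<open>-2\<close>. If the first is positive, the last is negative; if the first is
  \<open>-1\<close>, the next is positive.\<close>

lemma closed_root_no_output:
  assumes st: "state \<nu> g E" and n: "odd n" "3 \<le> card (nodes \<nu>)" and cl: "closed_root s \<nu> g E"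
  shows "\<exists>c\<in>cols \<nu> g E. \<not> correct_output n c a"
proof -
  have sp: "sparse \<nu> E" and n0: "0 < n" using st by (auto simp: state_def)
  have od: "odd (total c)" for c using total_parity n by simp
  obtain c where c: "c \<in> cols \<nu> g E" "c 0 = s" using cols_with_root_color[OF sp n0] by blast
  then have w: "wt \<nu> {0} c = 0 \<or> wt \<nu> {0} c = - 1" using cl by (auto simp: closed_root_def oriented_def cols_def)
  show ?thesis
  proof (rule state_root_path[OF st c(1)])
    fix D and m k :: nat
    assume D: "\<And>i. i \<le> m \<Longrightarrow> D i \<in> cols \<nu> g E \<and> D i 0 = c 0"
      and step: "\<And>i. i < m \<Longrightarrow> total (D (Suc i)) = total (D i) + 2 \<or> total (D (Suc i)) = total (D i) - 2"
      and sum: "total (D 0) + total (D m) = 2 * wt \<nu> {0} c" and m: "Suc m = card (nodes \<nu>)"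
    have m0: "0 < m" using m n by simp
    have ge: "total (D i) \<ge> - 1" "total (D i) \<noteq> 0" if "i \<le> m" for i
    proof -
      show "total (D i) \<ge> - 1" using cl D[OF that] c(2) unfolding closed_root_def by blast
      show "total (D i) \<noteq> 0" using od[of "D i"] by auto
    qed
    have D0: "D 0 \<in> cols \<nu> g E" "D 0 0 = c 0" and Dm: "D m \<in> cols \<nu> g E" "D m 0 = c 0"
      and D1: "D (Suc 0) \<in> cols \<nu> g E" "D (Suc 0) 0 = c 0"
      using D[OF le0] D[OF order_refl] D[OF Suc_leI[OF m0]] by blast+
    consider "total (D 0) > 0" | "total (D 0) = - 1" using ge(1)[OF le0] ge(2)[OF le0] by linarith
    then show ?thesis
    proof cases
      case 1
      have "wt \<nu> {0} c \<le> 0" using w by linarith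
      then have "total (D m) < 0" using sum 1 by linarith
      then show ?thesis using no_output_odd[OF st n Dm(1) _ D0(1) 1] Dm(2) D0(2) by simp
    next
      case 2
      then have "total (D (Suc 0)) > 0" using step[OF m0] ge(1)[OF Suc_leI[OF m0]] by linarith
      then show ?thesis using no_output_odd[OF st n D0(1) _ D1(1)] 2 D0(2) D1(2) by simp
    qed
  qed
qed

text \<open>The ends of the root path through the negative witness have totals of nonnegative sum;
  being odd, they are not both negative.\<close>

lemma open_root_no_output:
  assumes st: "state \<nu> g E" and n: "odd n" "3 \<le> card (nodes \<nu>)" and op: "open_root \<nu> g E"
  shows "\<exists>c\<in>cols \<nu> g E. \<not> correct_output n c a"
proof -
  have od: "odd (total c)" for c using total_parity n by simp
  from op obtain c where c: "c \<in> cols \<nu> g E" "wt \<nu> {0} c \<ge> 0" "total c < 0" by (auto simp: open_root_def)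
  show ?thesis
  proof (rule state_root_path[OF st c(1)])
    fix D and m k :: nat
    assume D: "\<And>i. i \<le> m \<Longrightarrow> D i \<in> cols \<nu> g E \<and> D i 0 = c 0"
      and sum: "total (D 0) + total (D m) = 2 * wt \<nu> {0} c"
    have "total (D 0) \<noteq> 0" "total (D m) \<noteq> 0" using od[of "D 0"] od[of "D m"] by auto
    then have "total (D 0) > 0 \<or> total (D m) > 0" using sum c(2) by auto
    then show ?thesis using no_output_odd[OF st n c(1,3)] D[of 0] D[of m] by auto
  qed
qed

lemma closed_root_not_solvable:
  assumes "odd n" "state \<nu> g E" "closed_root s \<nu> g E" "int k + 3 \<le> psi \<nu> E"
  shows "\<not> solvable n k (cols \<nu> g E)"
  using assms(2-4)
proof (induction k arbitrary: \<nu> g E)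
  case 0
  then show ?case using psi_le_card[of \<nu> E] by (intro not_solvable closed_root_no_output assms(1)) auto
next
  case (Suc k)
  show ?case
  proof (rule not_solvable)
    show "\<exists>c\<in>cols \<nu> g E. \<not> correct_output n c a" for a
      using Suc.prems psi_le_card[of \<nu> E] by (intro closed_root_no_output[OF _ assms(1)]) auto
    fix l e assume l: "Suc k = Suc l" and e: "e \<subseteq> {..<n}" "card e = 3"
    have "oriented s \<nu> g" using Suc.prems(2) by (simp add: closed_root_def)
    from oriented_step[OF Suc.prems(1) this e] obtain \<nu>' g' E' where s: "state \<nu>' g' E'" "oriented s \<nu>' g'"
      "cols \<nu>' g' E' \<subseteq> cols \<nu> g E" "const_on (cols \<nu>' g' E') e" "psi \<nu> E - 1 \<le> psi \<nu>' E'" by blast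
    have "closed_root s \<nu>' g' E'" using s(2,3) Suc.prems(2) by (auto simp: closed_root_def)
    then have "\<not> solvable n l (cols \<nu>' g' E')" using Suc.IH[OF s(1)] s(5) Suc.prems(3) l by simp
    then show "\<exists>D\<subseteq>cols \<nu> g E. const_on D e \<and> \<not> solvable n l D" using s(3,4) by blast
  qed
qed

text \<open>One unit more than for a closed root, because the query at which the root is closed may
  cost two.\<close>

lemma open_root_not_solvable:
  assumes "odd n" "state \<nu> g E" "open_root \<nu> g E" "int k + 4 \<le> psi \<nu> E"
  shows "\<not> solvable n k (cols \<nu> g E)"
  using assms(2-4)
proof (induction k arbitrary: \<nu> g E)
  case 0
  then show ?case using psi_le_card[of \<nu> E] by (intro not_solvable open_root_no_output assms(1)) auto
next
  case (Suc k)
  show ?case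
  proof (rule not_solvable)
    show "\<exists>c\<in>cols \<nu> g E. \<not> correct_output n c a" for a
      using Suc.prems psi_le_card[of \<nu> E] by (intro open_root_no_output[OF _ assms(1)]) auto
    fix l e assume l: "Suc k = Suc l" and e: "e \<subseteq> {..<n}" "card e = 3"
    have "3 \<le> psi \<nu> E" using Suc.prems(3) by simp
    from open_step[OF Suc.prems(1,2) this assms(1) e] obtain \<nu>' g' E' where s: "state \<nu>' g' E'"
      "cols \<nu>' g' E' \<subseteq> cols \<nu> g E" "const_on (cols \<nu>' g' E') e"
      "open_root \<nu>' g' E' \<and> psi \<nu> E - 1 \<le> psi \<nu>' E' \<or> (\<exists>s. closed_root s \<nu>' g' E') \<and> psi \<nu> E - 2 \<le> psi \<nu>' E'" by blast
    from s(4) have "\<not> solvable n l (cols \<nu>' g' E')"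
    proof
      assume "open_root \<nu>' g' E' \<and> psi \<nu> E - 1 \<le> psi \<nu>' E'"
      then show ?thesis using Suc.IH[OF s(1)] Suc.prems(3) l by simp
    next
      assume "(\<exists>s. closed_root s \<nu>' g' E') \<and> psi \<nu> E - 2 \<le> psi \<nu>' E'"
      then show ?thesis using closed_root_not_solvable[OF assms(1) s(1)] Suc.prems(3) l by auto
    qed
    then show "\<exists>D\<subseteq>cols \<nu> g E. const_on D e \<and> \<not> solvable n l D" using s(2,3) by blast
  qed
qed

lemma initial_state:
  assumes "0 < n"
  shows "state id g {}" "psi id {} = int n" "cols id g {} = UNIV" "wt id {0} c = val (c 0)"
proof -
  have "{b. b < n \<and> b = 0} = {0}" using assms by auto
  then show w: "wt id {0} c = val (c 0)" for c by (simp add: wt_def)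
  have "sparse id {}" by (auto simp: sparse_def excess_def inside_def)
  then show "state id g {}" using assms w by (auto simp: state_def val_def)
  show "psi id {} = int n" by (simp add: psi_def nodes_def)
  show "cols id g {} = UNIV" by (auto simp: cols_def sig_def proper_def)
qed

end

lemma q3_lower_even:
  assumes "even n" "2 \<le> n"
  shows "enat (n - 1) \<le> q3 n"
proof -
  have n0: "0 < n" using assms by simp
  note i = initial_state[OF n0]
  have "oriented n False id (\<lambda>_. True)" using i(4) by (auto simp: oriented_def val_def)
  from even_not_solvable[OF assms(1) i(1) this, of "n - 2"] have "\<not> solvable n (n - 2) UNIV"
    using assms(2) i(2,3) by simp
  from q3_ge[OF this] show ?thesis using assms(2) Suc_diff_le[of 2 n] by simp
qed

lemma q3_lower_odd:
  assumes "odd n" "5 \<le> n"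
  shows "enat (n - 3) \<le> q3 n"
proof -
  have n0: "0 < n" using assms by simp
  note i = initial_state[OF n0]
  \<comment> \<open>The witness colors ball \<open>0\<close> against all others: its class has
    weight 1 and the total is negative.\<close>
  have "total n (\<lambda>b. b = 0) = (\<Sum>b<n. (if b = 0 then 2 else 0) - 1)"
    unfolding total_def by (rule sum.cong) (auto simp: val_def)
  also have "\<dots> = 2 - int n" using n0 by (simp add: sum_subtractf)
  finally have "total n (\<lambda>b. b = 0) < 0" using assms(2) by simp
  then have "open_root n id (\<lambda>_. True) {}" unfolding open_root_def i(3)
    by (intro bexI[of _ "\<lambda>b. b = 0"]) (auto simp: i(4) val_def)
  from open_root_not_solvable[OF assms(1) i(1) this, of "n - 4"] have "\<not> solvable n (n - 4) UNIV"
    using assms(2) i(2,3) by simp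
  from q3_ge[OF this] show ?thesis using assms(2) Suc_diff_le[of 4 n] by simp
qed

theorem theorem3p1:
  fixes n m r :: nat
  assumes "n = 4 * m + r" and "m \<ge> 1" and "r \<in> {0, 1, 2, 3}"
  shows "(r = 0 \<longrightarrow> enat (n - 1) \<le> q3 n \<and> q3 n \<le> enat n) \<and>
         (r = 1 \<longrightarrow> enat (n - 3) \<le> q3 n \<and> q3 n \<le> enat (n - 1)) \<and>
         (r = 2 \<longrightarrow> enat (n - 1) \<le> q3 n \<and> q3 n \<le> enat (n + 1)) \<and>
         (r = 3 \<longrightarrow> enat (n - 3) \<le> q3 n \<and> q3 n \<le> enat n)"
proof -
  note up = q3_upper_bounds[OF assms(2)]
  have "enat (n - 1) \<le> q3 n" if "r = 0 \<or> r = 2" using that assms by (intro q3_lower_even) auto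
  moreover have "enat (n - 3) \<le> q3 n" if "r = 1 \<or> r = 3" using that assms by (intro q3_lower_odd) auto
  moreover have "q3 n \<le> enat n" if "r = 0 \<or> r = 3" using that up assms(1) by auto
  moreover have "q3 n \<le> enat (n - 1)" if "r = 1" using up(2) assms(1) that by simp
  moreover have "q3 n \<le> enat (n + 1)" if "r = 2"
  proof -
    have "n = 4 * m + 2" "n + 1 = 4 * m + 3" using assms(1) that by auto
    then show ?thesis using up(3) by metis
  qed
  ultimately show ?thesis by blast
qed

end
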